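(* Let $k\ge 1$, let $(M,g)$ be a compact oriented Riemannian manifold of dimension $4k$, and let $R$ be its Riemann curvature tensor. Then $*R^k$ satisfies the Bianchi identity, i.e. $$\sum_{l=1}^{2k+1}(-1)^l( *R^k)_{i_1\dots\hat{i_l}\dots i_{2k+1}\,i_l\,j_1\dots j_{2k-1}}=0$$ for all indices $i_1,\dots,i_{2k+1},j_1,\dots,j_{2k-1}$.
   Context: The Riemann curvature tensor is $R(X,Y,Z,W)=g(R(X,Y)W,Z)$ with $R(X,Y)W=\nabla_X\nabla_YW-\nabla_Y\nabla_XW-\nabla_{[X,Y]}W$, $\nabla$ the Levi-Civita connection; it is regarded as a section of $\Lambda^2T^*M\otimes\Lambda^2T^*M$. Products are taken with the wedge product of double forms, $(\phi_1\otimes\psi_1)\wedge(\phi_2\otimes\psi_2)=(\phi_1\wedge\phi_2)\otimes(\psi_1\wedge\psi_2)$, and $R^k=R\wedge\dots\wedge R$ ($k$ factors), a section of $\Lambda^{2k}T^*M\otimes\Lambda^{2k}T^*M$. On each $\Lambda^{2k}T^*_xM$ the star operator is defined by $\alpha\wedge*\beta=(\alpha,\beta)\epsilon$, where $\epsilon$ is the volume element and $(\cdot,\cdot)$ is the inner product making $\{e^{i_1}\wedge\dots\wedge e^{i_{2k}}:i_1<\dots<i_{2k}\}$ orthonormal for an orthonormal coframe $\{e^i\}$; on double forms $*(\alpha\otimes\beta)=*\alpha\otimes*\beta$, so $*R^k$ is again a section of $\Lambda^{2k}T^*M\otimes\Lambda^{2k}T^*M$. Its components are written with the first $2k$ indices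 for the first factor and the last $2k$ for the second; the hat denotes omission of an index. *)

theory Defs
  imports "HOL-Analysis.Analysis" "HOL-Library.Function_Algebras" "HOL-Combinatorics.Permutations"
begin

text \<open>Pointwise scalar multiplication on functions. Tangent vectors are functionals and vector
  fields are functions into tangent vectors, so that both become elements of a real vector space.\<close>

instantiation "fun" :: (type, real_vector) real_vector
begin

definition scaleR_fun :: "real \<Rightarrow> ('a \<Rightarrow> 'b) \<Rightarrow> 'a \<Rightarrow> 'b"
  where "scaleR_fun c f = (\<lambda>x. c *\<^sub>R f x)"

instance
  by standard (auto simp: scaleR_fun_def fun_eq_iff algebra_simps)

end

section \<open>Forms and double forms on a vector space\<close>

text \<open>A \<open>p\<close>-form on a subspace \<open>V\<close> is a function on lists of vectors, set to \<open>0\<close>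
  outside the lists of length \<open>p\<close> in \<open>V\<close>, so that equality of forms is equality of functions.
  A double form is a function of two lists.\<close>

type_synonym 'v form = "'v list \<Rightarrow> real"
type_synonym 'v double_form = "'v list \<Rightarrow> 'v list \<Rightarrow> real"

definition alt_forms :: "'v::real_vector set \<Rightarrow> nat \<Rightarrow> 'v form set" where
  "alt_forms V p = {\<omega>.
     (\<forall>v. \<not> (length v = p \<and> set v \<subseteq> V) \<longrightarrow> \<omega> v = 0) \<and>
     (\<forall>v i a b u w. length v = p \<and> set v \<subseteq> V \<and> i < p \<and> u \<in> V \<and> w \<in> V \<longrightarrow>
        \<omega> (v[i := a *\<^sub>R u + b *\<^sub>R w]) = a * \<omega> (v[i := u]) + b * \<omega> (v[i := w])) \<and>
     (\<forall>v i j. length v = p \<and> set v \<subseteq> V \<and> i < j \<and> j < p \<and> v ! i = v ! j \<longrightarrow> \<omega> v = 0)}"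

text \<open>The normalisation is the one for which \<open>e\<^sup>1 \<and> \<dots> \<and> e\<^sup>p\<close> takes the value \<open>1\<close> on
  \<open>(e\<^sub>1, \<dots>, e\<^sub>p)\<close>.\<close>

definition wedge :: "nat \<Rightarrow> nat \<Rightarrow> 'v form \<Rightarrow> 'v form \<Rightarrow> 'v form" where
  "wedge p q \<phi> \<psi> v = (if length v = p + q then
     (\<Sum>\<sigma> | \<sigma> permutes {..<p + q}. of_int (sign \<sigma>) *
        \<phi> (take p (permute_list \<sigma> v)) * \<psi> (drop p (permute_list \<sigma> v))) / (fact p * fact q)
     else 0)"

definition tensor :: "'v form \<Rightarrow> 'v form \<Rightarrow> 'v double_form" where
  "tensor \<phi> \<psi> v w = \<phi> v * \<psi> w"

text \<open>The wedge product of a \<open>(p,p)\<close>- and a \<open>(q,q)\<close>-double form: the bilinear extension of the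
  rule \<open>dwedge_tensor\<close> below.\<close>

definition dwedge :: "nat \<Rightarrow> nat \<Rightarrow> 'v double_form \<Rightarrow> 'v double_form \<Rightarrow> 'v double_form" where
  "dwedge p q \<Phi> \<Psi> v w = (if length v = p + q \<and> length w = p + q then
     (\<Sum>\<sigma> | \<sigma> permutes {..<p + q}. \<Sum>\<tau> | \<tau> permutes {..<p + q}.
        of_int (sign \<sigma>) * of_int (sign \<tau>) *
        \<Phi> (take p (permute_list \<sigma> v)) (take p (permute_list \<tau> w)) *
        \<Psi> (drop p (permute_list \<sigma> v)) (drop p (permute_list \<tau> w)))
       / ((fact p * fact q) * (fact p * fact q))
     else 0)"

lemma dwedge_tensor:
  "dwedge p q (tensor \<phi>\<^sub>1 \<psi>\<^sub>1) (tensor \<phi>\<^sub>2 \<psi>\<^sub>2) = tensor (wedge p q \<phi>\<^sub>1 \<phi>\<^sub>2) (wedge p q \<psi>\<^sub>1 \<psi>\<^sub>2)"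
  by (auto simp: fun_eq_iff dwedge_def tensor_def wedge_def sum_product mult_ac)

primrec dpow :: "nat \<Rightarrow> 'v double_form \<Rightarrow> nat \<Rightarrow> 'v double_form" where
  "dpow p \<Phi> 0 = (\<lambda>v w. if v = [] \<and> w = [] then 1 else 0)"
| "dpow p \<Phi> (Suc k) = dwedge p (p * k) \<Phi> (dpow p \<Phi> k)"

definition orthonormal_frame :: "'v::real_vector set \<Rightarrow> ('v \<Rightarrow> 'v \<Rightarrow> real) \<Rightarrow> 'v list \<Rightarrow> bool" where
  "orthonormal_frame V G e \<longleftrightarrow> set e \<subseteq> V \<and> span (set e) = V \<and>
     (\<forall>i<length e. \<forall>j<length e. G (e ! i) (e ! j) = (if i = j then 1 else 0))"

text \<open>The inner product on \<open>p\<close>-forms for which the products \<open>e\<^sup>I\<close> (\<open>I\<close> increasing) of an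
  orthonormal coframe are orthonormal; the \<open>e\<^sup>I\<close>-coefficient of \<open>\<alpha>\<close> is its value on \<open>nths e I\<close>.
  The result does not depend on the orthonormal frame that is chosen.\<close>

definition form_inner ::
  "'v::real_vector set \<Rightarrow> ('v \<Rightarrow> 'v \<Rightarrow> real) \<Rightarrow> nat \<Rightarrow> 'v form \<Rightarrow> 'v form \<Rightarrow> real" where
  "form_inner V G p \<alpha> \<beta> = (let e = (SOME e. orthonormal_frame V G e) in
     \<Sum>I | I \<subseteq> {..<dim V} \<and> card I = p. \<alpha> (nths e I) * \<beta> (nths e I))"

text \<open>The volume element is the multiple of unit length of a nonzero top form \<open>\<mu>\<close> defining the
  orientation (a basis is positive iff \<open>\<mu>\<close> is positive on it).\<close>

definition volume_element ::
  "'v::real_vector set \<Rightarrow> ('v \<Rightarrow> 'v \<Rightarrow> real) \<Rightarrow> 'v form \<Rightarrow> 'v form" where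
  "volume_element V G \<mu> = (\<lambda>v. \<mu> v / sqrt (form_inner V G (dim V) \<mu> \<mu>))"

definition hodge ::
  "'v::real_vector set \<Rightarrow> ('v \<Rightarrow> 'v \<Rightarrow> real) \<Rightarrow> 'v form \<Rightarrow> nat \<Rightarrow> 'v form \<Rightarrow> 'v form" where
  "hodge V G \<mu> p \<beta> = (THE \<gamma>. \<gamma> \<in> alt_forms V (dim V - p) \<and>
     (\<forall>\<alpha>\<in>alt_forms V p.
        wedge p (dim V - p) \<alpha> \<gamma> = (\<lambda>v. form_inner V G p \<alpha> \<beta> * volume_element V G \<mu> v)))"

text \<open>The star operator on \<open>(p,p)\<close>-double forms is the star operator applied in both slots, so
  that \<open>\<alpha> \<otimes> \<beta>\<close> goes to \<open>*\<alpha> \<otimes> *\<beta>\<close>.\<close>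

definition dhodge ::
  "'v::real_vector set \<Rightarrow> ('v \<Rightarrow> 'v \<Rightarrow> real) \<Rightarrow> 'v form \<Rightarrow> nat \<Rightarrow> 'v double_form \<Rightarrow> 'v double_form" where
  "dhodge V G \<mu> p \<Phi> v w = hodge V G \<mu> p (\<lambda>v'. hodge V G \<mu> p (\<Phi> v') w) v"

section \<open>Smooth manifolds\<close>

primrec Ck_on :: "nat \<Rightarrow> 'a::real_normed_vector set \<Rightarrow> ('a \<Rightarrow> 'b::real_normed_vector) \<Rightarrow> bool" where
  "Ck_on 0 S f \<longleftrightarrow> continuous_on S f"
| "Ck_on (Suc k) S f \<longleftrightarrow> (\<forall>x\<in>S. f differentiable (at x)) \<and>
     (\<forall>u. Ck_on k S (\<lambda>x. frechet_derivative f (at x) u))"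

definition smooth_on :: "'a::real_normed_vector set \<Rightarrow> ('a \<Rightarrow> 'b::real_normed_vector) \<Rightarrow> bool" where
  "smooth_on S f \<longleftrightarrow> (\<forall>k. Ck_on k S f)"

text \<open>A chart is a pair of a domain and a coordinate map. The manifold is the whole of the
  topological space \<open>'m\<close>; its model space \<open>'e\<close> has the dimension of the manifold.\<close>

type_synonym ('m, 'e) chart = "'m set \<times> ('m \<Rightarrow> 'e)"

definition smooth_atlas :: "('m::topological_space, 'e::euclidean_space) chart set \<Rightarrow> bool" where
  "smooth_atlas A \<longleftrightarrow>
     (\<Union>(U, \<phi>)\<in>A. U) = UNIV \<and>
     (\<forall>(U, \<phi>)\<in>A. open U \<and> open (\<phi> ` U) \<and> homeomorphism U (\<phi> ` U) \<phi> (inv_into U \<phi>)) \<and>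
     (\<forall>(U, \<phi>)\<in>A. \<forall>(W, \<psi>)\<in>A. smooth_on (\<phi> ` (U \<inter> W)) (\<psi> \<circ> inv_into U \<phi>))"

text \<open>Smoothness of a real function on an open subset \<open>W\<close> of the manifold.\<close>

definition smooth_fun ::
  "('m::topological_space, 'e::euclidean_space) chart set \<Rightarrow> 'm set \<Rightarrow> ('m \<Rightarrow> real) \<Rightarrow> bool" where
  "smooth_fun A W f \<longleftrightarrow> (\<forall>(U, \<phi>)\<in>A. smooth_on (\<phi> ` (U \<inter> W)) (f \<circ> inv_into U \<phi>))"

definition smooth_near ::
  "('m::topological_space, 'e::euclidean_space) chart set \<Rightarrow> 'm \<Rightarrow> ('m \<Rightarrow> real) \<Rightarrow> bool" where
  "smooth_near A x f \<longleftrightarrow> (\<exists>W. open W \<and> x \<in> W \<and> smooth_fun A W f)"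

text \<open>A tangent vector at \<open>x\<close> is a directional derivative at \<open>x\<close>, acting on the functions that
  are smooth near \<open>x\<close>. On all other functions it is \<open>0\<close> by convention, so that equality of tangent
  vectors is equality of functionals.\<close>

type_synonym 'm tangent = "('m \<Rightarrow> real) \<Rightarrow> real"
type_synonym 'm vfield = "'m \<Rightarrow> 'm tangent"

definition chart_vector ::
  "('m::topological_space, 'e::euclidean_space) chart set \<Rightarrow> ('m, 'e) chart \<Rightarrow> 'm \<Rightarrow> 'e \<Rightarrow> 'm tangent" where
  "chart_vector A c x u f = (if smooth_near A x f
     then frechet_derivative (f \<circ> inv_into (fst c) (snd c)) (at (snd c x)) u else 0)"

definition tangent_space ::
  "('m::topological_space, 'e::euclidean_space) chart set \<Rightarrow> 'm \<Rightarrow> 'm tangent set" where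
  "tangent_space A x = {chart_vector A c x u | c u. c \<in> A \<and> x \<in> fst c}"

definition vector_fields ::
  "('m::topological_space, 'e::euclidean_space) chart set \<Rightarrow> 'm vfield set" where
  "vector_fields A = {X. (\<forall>x. X x \<in> tangent_space A x) \<and>
     (\<forall>W f. open W \<and> smooth_fun A W f \<longrightarrow> smooth_fun A W (\<lambda>x. X x f))}"

definition lie_bracket ::
  "('m::topological_space, 'e::euclidean_space) chart set \<Rightarrow> 'm vfield \<Rightarrow> 'm vfield \<Rightarrow> 'm vfield" where
  "lie_bracket A X Y x f = (if smooth_near A x f
     then X x (\<lambda>y. Y y f) - Y x (\<lambda>y. X y f) else 0)"

text \<open>The orientation of the manifold is given by a nowhere vanishing smooth form of top degree.\<close>

definition orientation_form ::
  "('m::topological_space, 'e::euclidean_space) chart set \<Rightarrow> ('m \<Rightarrow> 'm tangent form) \<Rightarrow> bool" where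
  "orientation_form A \<mu> \<longleftrightarrow>
     (\<forall>x. \<mu> x \<in> alt_forms (tangent_space A x) DIM('e) \<and> (\<exists>v. \<mu> x v \<noteq> 0)) \<and>
     (\<forall>Xs. length Xs = DIM('e) \<and> set Xs \<subseteq> vector_fields A \<longrightarrow>
        smooth_fun A UNIV (\<lambda>x. \<mu> x (map (\<lambda>X. X x) Xs)))"

section \<open>Riemannian manifolds\<close>

definition riemannian_metric ::
  "('m::topological_space, 'e::euclidean_space) chart set \<Rightarrow>
     ('m \<Rightarrow> 'm tangent \<Rightarrow> 'm tangent \<Rightarrow> real) \<Rightarrow> bool" where
  "riemannian_metric A g \<longleftrightarrow>
     (\<forall>x. \<forall>u\<in>tangent_space A x. \<forall>v\<in>tangent_space A x.
        g x u v = g x v u \<and>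
        (\<forall>w\<in>tangent_space A x. \<forall>a b. g x (a *\<^sub>R u + b *\<^sub>R v) w = a * g x u w + b * g x v w) \<and>
        (u \<noteq> 0 \<longrightarrow> g x u u > 0)) \<and>
     (\<forall>X\<in>vector_fields A. \<forall>Y\<in>vector_fields A. smooth_fun A UNIV (\<lambda>x. g x (X x) (Y x)))"

definition affine_connection ::
  "('m::topological_space, 'e::euclidean_space) chart set \<Rightarrow>
     ('m vfield \<Rightarrow> 'm vfield \<Rightarrow> 'm vfield) \<Rightarrow> bool" where
  "affine_connection A nabla \<longleftrightarrow>
     (\<forall>X\<in>vector_fields A. \<forall>Y\<in>vector_fields A.
        nabla X Y \<in> vector_fields A \<and>
        (\<forall>Z\<in>vector_fields A.
           nabla (X + Y) Z = nabla X Z + nabla Y Z \<and>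
           nabla Z (X + Y) = nabla Z X + nabla Z Y) \<and>
        (\<forall>f. smooth_fun A UNIV f \<longrightarrow>
           nabla (\<lambda>x. f x *\<^sub>R X x) Y = (\<lambda>x. f x *\<^sub>R nabla X Y x) \<and>
           nabla X (\<lambda>x. f x *\<^sub>R Y x) = (\<lambda>x. f x *\<^sub>R nabla X Y x + X x f *\<^sub>R Y x)))"

definition levi_civita ::
  "('m::topological_space, 'e::euclidean_space) chart set \<Rightarrow>
     ('m \<Rightarrow> 'm tangent \<Rightarrow> 'm tangent \<Rightarrow> real) \<Rightarrow>
     ('m vfield \<Rightarrow> 'm vfield \<Rightarrow> 'm vfield) \<Rightarrow> bool" where
  "levi_civita A g nabla \<longleftrightarrow> affine_connection A nabla \<and>
     (\<forall>X\<in>vector_fields A. \<forall>Y\<in>vector_fields A. nabla X Y - nabla Y X = lie_bracket A X Y) \<and>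
     (\<forall>X\<in>vector_fields A. \<forall>Y\<in>vector_fields A. \<forall>Z\<in>vector_fields A. \<forall>x.
        X x (\<lambda>y. g y (Y y) (Z y)) = g x (nabla X Y x) (Z x) + g x (Y x) (nabla X Z x))"

definition curvature_operator ::
  "('m::topological_space, 'e::euclidean_space) chart set \<Rightarrow>
     ('m vfield \<Rightarrow> 'm vfield \<Rightarrow> 'm vfield) \<Rightarrow> 'm vfield \<Rightarrow> 'm vfield \<Rightarrow> 'm vfield \<Rightarrow> 'm vfield" where
  "curvature_operator A nabla X Y W =
     nabla X (nabla Y W) - nabla Y (nabla X W) - nabla (lie_bracket A X Y) W"

text \<open>The curvature tensor at \<open>x\<close> is evaluated on tangent vectors by extending them to vector
  fields; being tensorial, it does not depend on the extensions.\<close>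

definition extend_vector ::
  "('m::topological_space, 'e::euclidean_space) chart set \<Rightarrow> 'm \<Rightarrow> 'm tangent \<Rightarrow> 'm vfield" where
  "extend_vector A x u = (SOME X. X \<in> vector_fields A \<and> X x = u)"

definition riemann_tensor ::
  "('m::topological_space, 'e::euclidean_space) chart set \<Rightarrow>
     ('m \<Rightarrow> 'm tangent \<Rightarrow> 'm tangent \<Rightarrow> real) \<Rightarrow>
     ('m vfield \<Rightarrow> 'm vfield \<Rightarrow> 'm vfield) \<Rightarrow> 'm \<Rightarrow>
     'm tangent \<Rightarrow> 'm tangent \<Rightarrow> 'm tangent \<Rightarrow> 'm tangent \<Rightarrow> real" where
  "riemann_tensor A g nabla x u v z w =
     g x (curvature_operator A nabla
            (extend_vector A x u) (extend_vector A x v) (extend_vector A x w) x) z"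

definition riemann_double_form ::
  "('m::topological_space, 'e::euclidean_space) chart set \<Rightarrow>
     ('m \<Rightarrow> 'm tangent \<Rightarrow> 'm tangent \<Rightarrow> real) \<Rightarrow>
     ('m vfield \<Rightarrow> 'm vfield \<Rightarrow> 'm vfield) \<Rightarrow> 'm \<Rightarrow> 'm tangent double_form" where
  "riemann_double_form A g nabla x v w = (if length v = 2 \<and> length w = 2
     then riemann_tensor A g nabla x (v ! 0) (v ! 1) (w ! 0) (w ! 1) else 0)"

definition star_riemann_pow ::
  "('m::topological_space, 'e::euclidean_space) chart set \<Rightarrow>
     ('m \<Rightarrow> 'm tangent \<Rightarrow> 'm tangent \<Rightarrow> real) \<Rightarrow> ('m \<Rightarrow> 'm tangent form) \<Rightarrow>
     ('m vfield \<Rightarrow> 'm vfield \<Rightarrow> 'm vfield) \<Rightarrow> nat \<Rightarrow> 'm \<Rightarrow> 'm tangent double_form" where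
  "star_riemann_pow A g \<mu> nabla k x =
     dhodge (tangent_space A x) (g x) (\<mu> x) (2 * k) (dpow 2 (riemann_double_form A g nabla x) k)"

text \<open>Components with respect to a frame, the indices being numbered from \<open>0\<close>.\<close>

definition component :: "'v list \<Rightarrow> 'v double_form \<Rightarrow> nat list \<Rightarrow> nat list \<Rightarrow> real" where
  "component e \<Phi> I J = \<Phi> (map ((!) e) I) (map ((!) e) J)"

end

theory Submission
  imports Defs "HOL-Combinatorics.Multiset_Permutations"
begin

text \<open>The identity is pointwise linear algebra once the first Bianchi identity of \<open>R\<close> is known, and it
holds because the star operator moves the skew-symmetrisation in \<open>i\<^sub>1, \<dots>, i\<^sub>2\<^sub>k\<^sub>+\<^sub>1\<close> onto the
arguments of a single factor \<open>R\<close>.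

Algebra. Let \<open>E\<close> be an orthonormal frame of the tangent space \<open>V\<close>, \<open>n = dim V\<close>, and \<open>\<epsilon>\<close> the volume
element. The star operator is contraction with \<open>\<epsilon>\<close>:
\<open>*\<beta>(v) = 1/p! \<Sum>\<^sub>a \<beta>(E\<^sub>a) \<epsilon>(E\<^sub>a, v)\<close>, the sum running over all index lists \<open>a\<close> of length \<open>p\<close> (lemma
\<open>hodge_eq\<close>). Since \<open>\<epsilon>\<close> is alternating, the skew-symmetrisations inside the wedge powers are absorbed
by the contraction (\<open>sum_dpow_antisymmetric\<close>), so that up to a constant
\<open>*R\<^sup>k(v, w) = \<Sum>\<^sub>a \<Sum>\<^sub>b R(a\<^sub>1 a\<^sub>2; b\<^sub>1 b\<^sub>2) R(a\<^sub>3 a\<^sub>4; b\<^sub>3 b\<^sub>4) \<dots> \<epsilon>(E\<^sub>a, v) \<epsilon>(E\<^sub>b, w)\<close>.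
In the Bianchi sum the vector \<open>v\<^sub>l\<close> is removed from the first \<open>\<epsilon>\<close> and inserted into the second one. The
\<open>n + 1\<close> vectors \<open>E\<^sub>a, v\<close> of an \<open>n\<close>-dimensional space satisfy Cramer's relation: the alternating sum, over
all of them, of a linear function of one vector times \<open>\<epsilon>\<close> of the others is zero (\<open>cramer_identity\<close>).
Hence the sum over \<open>l\<close> may be replaced by minus the sum over the positions \<open>j\<close> of \<open>a\<close>, in which \<open>E\<close> with
index \<open>a\<^sub>j\<close> is removed from the first \<open>\<epsilon>\<close> and inserted into the second. For fixed \<open>j\<close> the second \<open>\<epsilon>\<close> is now
alternating in \<open>a\<^sub>j\<close> and in the two \<open>b\<close>-indices of the factor \<open>R\<close> that contains \<open>a\<^sub>j\<close>, so the cyclic sum of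
this factor over these three arguments appears, and it is zero (\<open>bianchi_contraction\<close>). This gives
\<open>star_power_bianchi\<close>.

Geometry. What remains is the Bianchi identity of the curvature tensor, in both pairs of arguments.
Jacobi's identity and the vanishing of torsion give the cyclic identity for
\<open>R(X,Y)Z\<close>, compatibility with the metric gives skew-symmetry in the last two arguments, and together they
imply symmetry under exchange of the pairs (\<open>riemann_bianchi\<close>). All of this is carried out with the vector
fields that extend the given tangent vectors, and such extensions exist by a bump function
(\<open>vector_field_extension\<close>). The tangent space has dimension \<open>4k\<close>: a chart makes it a linear image of the
model space, and it carries a nonzero alternating form of degree \<open>4k\<close>.\<close>

section \<open>Antisymmetric functions of lists\<close>

text \<open>The sign change is required for adjacent entries only. In this form it is an equation about
concatenated lists, which is preserved when a prefix or a suffix is held fixed, and it generates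
all permutations (\<open>antisymmetric_permute\<close>).\<close>

definition antisymmetric :: "('a list \<Rightarrow> real) \<Rightarrow> bool" where
  "antisymmetric h \<longleftrightarrow> (\<forall>xs x y ys. h (xs @ x # y # ys) = - h (xs @ y # x # ys))"

lemma antisymmetricD: "antisymmetric h \<Longrightarrow> h (xs @ x # y # ys) = - h (xs @ y # x # ys)"
  unfolding antisymmetric_def by blast

lemma antisymmetric_Cons: "antisymmetric h \<Longrightarrow> antisymmetric (\<lambda>v. h (z # v))"
  unfolding antisymmetric_def by (metis append_Cons)

lemma antisymmetric_append_left: "antisymmetric h \<Longrightarrow> antisymmetric (\<lambda>v. h (us @ v))"
  unfolding antisymmetric_def by (metis append_assoc)

lemma antisymmetric_append_right: "antisymmetric h \<Longrightarrow> antisymmetric (\<lambda>v. h (v @ us))"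
  unfolding antisymmetric_def by (metis append_Cons append_assoc)

lemma antisymmetric_map: "antisymmetric h \<Longrightarrow> antisymmetric (\<lambda>v. h (map f v))"
  unfolding antisymmetric_def map_append list.map by blast

lemma antisymmetric_sum: "(\<And>i. i \<in> S \<Longrightarrow> antisymmetric (h i)) \<Longrightarrow> antisymmetric (\<lambda>v. \<Sum>i\<in>S. h i v)"
proof -
  assume h: "\<And>i. i \<in> S \<Longrightarrow> antisymmetric (h i)"
  show ?thesis
    unfolding antisymmetric_def sum_negf[symmetric]
    by (intro allI sum.cong refl antisymmetricD[OF h])
qed

lemma antisymmetric_mult: "antisymmetric h \<Longrightarrow> antisymmetric (\<lambda>v. c * h v)"
  "antisymmetric h \<Longrightarrow> antisymmetric (\<lambda>v. h v * c)"
  unfolding antisymmetric_def by (metis mult_minus_right, metis mult_minus_left)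

lemma antisymmetric_diff:
  "antisymmetric h \<Longrightarrow> antisymmetric h' \<Longrightarrow> antisymmetric (\<lambda>v. h v - h' v)"
  unfolding antisymmetric_def by (metis minus_diff_minus)

lemma antisymmetric_move:
  assumes "antisymmetric h"
  shows "h (us @ x # vs @ ws) = (-1) ^ length vs * h (us @ vs @ x # ws)"
proof (induction vs arbitrary: us)
  case (Cons z vs)
  have "h (us @ x # z # vs @ ws) = - h ((us @ [z]) @ x # vs @ ws)"
    using antisymmetricD[OF assms, of us x z "vs @ ws"] by simp
  also have "\<dots> = - ((-1) ^ length vs * h ((us @ [z]) @ vs @ x # ws))"
    using Cons[of "us @ [z]"] by simp
  finally show ?case by simp
qed simp

lemma antisymmetric_swap:
  assumes "antisymmetric h"
  shows "h (us @ x # vs @ y # ws) = - h (us @ y # vs @ x # ws)"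
proof -
  have "h (us @ x # vs @ y # ws) = (-1) ^ length vs * h ((us @ vs) @ x # y # ws)"
    using antisymmetric_move[OF assms, of us x vs "y # ws"] by simp
  also have "\<dots> = - ((-1) ^ length vs * h ((us @ vs) @ y # x # ws))"
    using antisymmetricD[OF assms, of "us @ vs" x y ws] by simp
  also have "\<dots> = - h (us @ y # vs @ x # ws)"
    using antisymmetric_move[OF assms, of us y vs "x # ws"] by simp
  finally show ?thesis .
qed

lemma antisymmetric_not_distinct:
  assumes "antisymmetric h" "\<not> distinct v"
  shows "h v = 0"
proof -
  obtain us vs ws x where "v = us @ [x] @ vs @ [x] @ ws"
    using not_distinct_decomp[OF assms(2)] by blast
  then show ?thesis
    using antisymmetric_swap[OF assms(1), of us x vs x ws] by simp
qed

lemma antisymmetric_append_commute: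
  assumes "antisymmetric h"
  shows "h (xs @ ys) = (-1) ^ (length xs * length ys) * h (ys @ xs)"
proof -
  have "h (zs @ xs @ ys) = (-1) ^ (length xs * length ys) * h (zs @ ys @ xs)" for zs
  proof (induction xs arbitrary: zs)
    case (Cons x xs)
    have "h (zs @ (x # xs) @ ys) = h ((zs @ [x]) @ xs @ ys)" by simp
    also have "\<dots> = (-1) ^ (length xs * length ys) * h ((zs @ [x]) @ ys @ xs)"
      by (rule Cons)
    also have "h ((zs @ [x]) @ ys @ xs) = (-1) ^ length ys * h (zs @ ys @ x # xs)"
      using antisymmetric_move[OF assms, of zs x ys xs] by simp
    finally show ?case by (simp add: power_add mult.commute)
  qed simp
  from this[of "[]"] show ?thesis by simp
qed

lemma permute_list_transpose:
  assumes "i < j" "j < length v"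
  shows "permute_list (Transposition.transpose i j) v =
    take i v @ v ! j # take (j - Suc i) (drop (Suc i) v) @ v ! i # drop (Suc j) v"
proof (rule nth_equalityI)
  fix l assume l: "l < length (permute_list (Transposition.transpose i j) v)"
  have "min (length v - Suc i) (j - Suc i) = j - Suc i"
    using assms by auto
  then show "permute_list (Transposition.transpose i j) v ! l =
    (take i v @ v ! j # take (j - Suc i) (drop (Suc i) v) @ v ! i # drop (Suc j) v) ! l"
    using assms l
    by (auto simp: permute_list_def nth_append nth_Cons' Transposition.transpose_def min_def)
qed (use assms in \<open>auto simp: min_def\<close>)

lemma split_list_two:
  assumes "i < j" "j < length v"
  shows "v = take i v @ v ! i # take (j - Suc i) (drop (Suc i) v) @ v ! j # drop (Suc j) v"
proof -
  have "v = take i v @ v ! i # drop (Suc i) v"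
    using assms by (simp add: id_take_nth_drop)
  moreover have "drop (Suc i) v = take (j - Suc i) (drop (Suc i) v) @ v ! j # drop (Suc j) v"
    using assms id_take_nth_drop[of "j - Suc i" "drop (Suc i) v"] by simp
  ultimately show ?thesis by metis
qed

lemma antisymmetric_transpose:
  assumes "antisymmetric h" "i < length v" "j < length v" "i \<noteq> j"
  shows "h (permute_list (Transposition.transpose i j) v) = - h v"
proof -
  have *: "h (permute_list (Transposition.transpose i j) v) = - h v" if "i < j" "j < length v" for i j
    using permute_list_transpose[OF that] split_list_two[OF that]
      antisymmetric_swap[OF assms(1), of "take i v" "v ! j" _ "v ! i"] by metis
  show ?thesis
    using *[of i j] *[of j i] assms by (metis linorder_neq_iff transpose_commute)
qed

lemma antisymmetric_permute:
  assumes "antisymmetric h" "\<sigma> permutes {..<length v}"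
  shows "h (permute_list \<sigma> v) = of_int (sign \<sigma>) * h v"
proof -
  have "\<forall>v. length v = m \<longrightarrow> h (permute_list \<sigma> v) = of_int (sign \<sigma>) * h v"
    if "\<sigma> permutes {..<m}" for m
    using that finite_lessThan
  proof (induction rule: permutes_induct)
    case (swap a b p)
    show ?case
    proof (intro allI impI)
      fix v :: "'a list" assume v: "length v = m"
      have "permute_list (Transposition.transpose a b \<circ> p) v =
          permute_list p (permute_list (Transposition.transpose a b) v)"
        using swap v by (simp add: permute_list_compose)
      moreover have "sign (Transposition.transpose a b \<circ> p) = - sign p"
        using swap by (subst sign_compose) (auto simp: sign_swap_id permutation_swap_id intro: permutes_imp_permutation)
      ultimately show "h (permute_list (Transposition.transpose a b \<circ> p) v) =
          of_int (sign (Transposition.transpose a b \<circ> p)) * h v"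
        using swap v antisymmetric_transpose[OF assms(1), of a v b] by simp
    qed
  qed simp
  then show ?thesis using assms(2) by blast
qed

text \<open>Two rearrangements of the same list differ by the same sign in both functions, so the product does
not see the order. This is how signs disappear from all contractions below.\<close>

lemma antisymmetric_mset_eq:
  assumes "antisymmetric h" "antisymmetric h'" "mset v = mset w"
  shows "h v * h' v = h w * h' w"
proof -
  obtain \<sigma> where s: "\<sigma> permutes {..<length w}" "permute_list \<sigma> w = v"
    using assms(3) by (rule mset_eq_permutation)
  have "real_of_int (sign \<sigma>) * real_of_int (sign \<sigma>) = 1"
    by (metis of_int_1 of_int_mult sign_idempotent)
  then show ?thesis
    using antisymmetric_permute[OF assms(1) s(1)] antisymmetric_permute[OF assms(2) s(1)] s(2)
    by (simp add: mult_ac)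
qed

text \<open>Reindexing the sum by composition with an adjacent transposition changes every sign. The value \<open>0\<close>
at other lengths is the convention of the wedge products.\<close>

lemma antisymmetric_antisymmetrization:
  fixes f :: "'a list \<Rightarrow> real"
  shows "antisymmetric (\<lambda>v. if length v = m then
    \<Sum>\<sigma> | \<sigma> permutes {..<m}. of_int (sign \<sigma>) * f (permute_list \<sigma> v) else 0)"
  unfolding antisymmetric_def
proof (intro allI)
  fix us ws :: "'a list" and x y
  let ?i = "length us" and ?v = "us @ y # x # ws"
  let ?t = "Transposition.transpose ?i (Suc ?i)"
  show "(if length (us @ x # y # ws) = m then
      \<Sum>\<sigma> | \<sigma> permutes {..<m}. of_int (sign \<sigma>) * f (permute_list \<sigma> (us @ x # y # ws)) else 0) =
    - (if length (us @ y # x # ws) = m then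
      \<Sum>\<sigma> | \<sigma> permutes {..<m}. of_int (sign \<sigma>) * f (permute_list \<sigma> (us @ y # x # ws)) else 0)"
  proof (cases "length ?v = m")
    case True
    have v: "us @ x # y # ws = permute_list ?t ?v"
      by (subst permute_list_transpose) (auto simp: nth_append)
    have t: "?t permutes {..<m}"
      using True by (intro permutes_swap_id) auto
    have "(\<Sum>\<sigma> | \<sigma> permutes {..<m}. of_int (sign \<sigma>) * f (permute_list \<sigma> (us @ x # y # ws))) =
        (\<Sum>\<sigma> | \<sigma> permutes {..<m}. - (of_int (sign (?t \<circ> \<sigma>)) * f (permute_list (?t \<circ> \<sigma>) ?v)))"
    proof (rule sum.cong[OF refl])
      fix \<sigma> assume "\<sigma> \<in> {\<sigma>. \<sigma> permutes {..<m}}"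
      then have s: "\<sigma> permutes {..<m}" by simp
      have "sign (?t \<circ> \<sigma>) = - sign \<sigma>"
        using s by (subst sign_compose) (auto simp: sign_swap_id permutation_swap_id intro: permutes_imp_permutation)
      then show "of_int (sign \<sigma>) * f (permute_list \<sigma> (us @ x # y # ws)) =
          - (of_int (sign (?t \<circ> \<sigma>)) * f (permute_list (?t \<circ> \<sigma>) ?v))"
        using s True by (simp only: v permute_list_compose[of \<sigma> ?v ?t])
    qed
    also have "\<dots> = - (\<Sum>\<sigma> | \<sigma> permutes {..<m}. of_int (sign \<sigma>) * f (permute_list \<sigma> ?v))"
      unfolding sum_negf
      using setum_permutations_compose_left[OF t, of "\<lambda>\<sigma>. of_int (sign \<sigma>) * f (permute_list \<sigma> ?v)"]
      by (rule arg_cong[OF sym])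
    finally have "(\<Sum>\<sigma> | \<sigma> permutes {..<m}. of_int (sign \<sigma>) * f (permute_list \<sigma> (us @ x # y # ws))) =
      - (\<Sum>\<sigma> | \<sigma> permutes {..<m}. of_int (sign \<sigma>) * f (permute_list \<sigma> ?v))" .
    moreover have "length (us @ x # y # ws) = m" using True by simp
    ultimately show ?thesis using True by presburger
  qed simp
qed

section \<open>Sums over index lists\<close>

text \<open>Contractions are sums over all index lists of a given length, repetitions included. Such a sum factors
along concatenation and is invariant under permutation of positions, whereas a sum over increasing
indices is neither.\<close>

definition index_lists :: "nat \<Rightarrow> nat \<Rightarrow> nat list set" where
  "index_lists n m = {a. set a \<subseteq> {..<n} \<and> length a = m}"

lemma finite_index_lists [simp]: "finite (index_lists n m)"
  unfolding index_lists_def by (rule finite_lists_length_eq) simp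

lemma index_lists_0 [simp]: "index_lists n 0 = {[]}"
  by (auto simp: index_lists_def)

lemma sum_index_lists_append:
  "(\<Sum>c\<in>index_lists n (p + q). f c) = (\<Sum>a\<in>index_lists n p. \<Sum>b\<in>index_lists n q. f (a @ b))"
proof -
  have "(\<Sum>a\<in>index_lists n p. \<Sum>b\<in>index_lists n q. f (a @ b)) =
      (\<Sum>(a, b)\<in>index_lists n p \<times> index_lists n q. f (a @ b))"
    by (simp add: sum.cartesian_product)
  also have "\<dots> = (\<Sum>c\<in>index_lists n (p + q). f c)"
    by (rule sum.reindex_bij_witness[where i = "\<lambda>c. (take p c, drop p c)" and j = "\<lambda>(a, b). a @ b"])
      (auto simp: index_lists_def dest: in_set_takeD in_set_dropD)
  finally show ?thesis by simp
qed

lemma sum_index_lists_Suc: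
  "(\<Sum>c\<in>index_lists n (Suc m). f c) = (\<Sum>x<n. \<Sum>a\<in>index_lists n m. f (x # a))"
proof -
  have "(\<Sum>a\<in>index_lists n 1. g a) = (\<Sum>x<n. g [x])" for g :: "nat list \<Rightarrow> 'a"
    by (rule sum.reindex_bij_witness[where i = "\<lambda>x. [x]" and j = hd])
      (auto simp: index_lists_def length_Suc_conv)
  then show ?thesis
    using sum_index_lists_append[of f n 1 m] by simp
qed

lemma sum_index_lists_permute:
  assumes "\<sigma> permutes {..<m}"
  shows "(\<Sum>a\<in>index_lists n m. f (permute_list \<sigma> a)) = (\<Sum>a\<in>index_lists n m. f a)"
proof (rule sum.reindex_bij_witness[where i = "permute_list (inv \<sigma>)" and j = "permute_list \<sigma>"])
  fix a assume a: "a \<in> index_lists n m"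
  have i: "inv \<sigma> permutes {..<m}" by (rule permutes_inv[OF assms])
  show "permute_list (inv \<sigma>) (permute_list \<sigma> a) = a"
    using a i permute_list_compose[of "inv \<sigma>" a \<sigma>] assms
    by (simp add: index_lists_def permutes_inv_o)
  show "permute_list \<sigma> (permute_list (inv \<sigma>) a) = a"
    using a assms permute_list_compose[of \<sigma> a "inv \<sigma>"]
    by (simp add: index_lists_def permutes_inv_o)
  show "permute_list \<sigma> a \<in> index_lists n m" "permute_list (inv \<sigma>) a \<in> index_lists n m"
    using a assms i by (auto simp: index_lists_def)
qed simp

text \<open>The bijection \<open>\<sigma> \<mapsto> (\<sigma>(0), \<dots>, \<sigma>(n - 1))\<close> onto the lists without repetition turns the permutation
sums that define the wedge product into contractions.\<close>

lemma sum_permutations_index_lists: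
  assumes "\<And>c. c \<in> index_lists n n \<Longrightarrow> \<not> distinct c \<Longrightarrow> f c = 0"
  shows "(\<Sum>\<sigma> | \<sigma> permutes {..<n}. f (map \<sigma> [0..<n])) = (\<Sum>c\<in>index_lists n n. f c)"
proof -
  let ?P = "{\<sigma>. \<sigma> permutes {..<n}}" and ?f = "\<lambda>\<sigma>. map \<sigma> [0..<n]"
  have inj: "inj_on ?f ?P"
  proof (rule inj_onI)
    fix \<sigma> \<tau> assume "\<sigma> \<in> ?P" "\<tau> \<in> ?P" "?f \<sigma> = ?f \<tau>"
    then have "\<sigma> permutes {..<n}" "\<tau> permutes {..<n}" "\<forall>i<n. \<sigma> i = \<tau> i"
      by (auto simp: map_eq_conv)
    then show "\<sigma> = \<tau>"
      by (metis ext lessThan_iff permutes_not_in)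
  qed
  have "?f ` ?P = {c \<in> index_lists n n. distinct c}"
  proof (intro equalityI subsetI)
    fix c assume "c \<in> ?f ` ?P"
    then obtain \<sigma> where s: "\<sigma> permutes {..<n}" "c = map \<sigma> [0..<n]" by auto
    then show "c \<in> {c \<in> index_lists n n. distinct c}"
      by (auto simp: index_lists_def distinct_map permutes_inj_on dest: permutes_in_image[THEN iffD2])
  next
    fix c assume c: "c \<in> {c \<in> index_lists n n. distinct c}"
    then have "card (set c) = n" "set c \<subseteq> {..<n}"
      by (auto simp: index_lists_def distinct_card)
    then have "set c = {..<n}" by (simp add: card_subset_eq)
    then have "mset c = mset [0..<n]"
      using c by (intro set_eq_iff_mset_eq_distinct[THEN iffD1]) (simp_all add: atLeast0LessThan)
    then obtain \<sigma> where s: "\<sigma> permutes {..<length [0..<n]}" "permute_list \<sigma> [0..<n] = c"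
      by (rule mset_eq_permutation)
    have "map \<sigma> [0..<n] = c"
      using s(1) permutes_in_image[OF s(1)] unfolding s(2)[symmetric] permute_list_def by auto
    then show "c \<in> ?f ` ?P" using s(1) by auto
  qed
  then have "(\<Sum>\<sigma>\<in>?P. f (?f \<sigma>)) = (\<Sum>c\<in>{c \<in> index_lists n n. distinct c}. f c)"
    using sum.reindex[OF inj, of f] by simp
  also have "\<dots> = (\<Sum>c\<in>index_lists n n. f c)"
    using assms by (intro sum.mono_neutral_left) auto
  finally show ?thesis .
qed

text \<open>The contraction of \<open>\<epsilon> \<otimes> \<epsilon>\<close> over \<open>q\<close> indices is \<open>q!\<close> times the signed sum over the permutations of the
other \<open>p\<close> indices. A nonzero
summand has \<open>b\<close> enumerating the complement of \<open>a\<close> and \<open>a'\<close> rearranging \<open>a\<close>; then the signs of \<open>a'\<close> in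
\<open>\<beta>\<close> and in \<open>e\<close> cancel, so each of these \<open>p! q!\<close> summands equals \<open>\<beta> a\<close>.\<close>

lemma contraction_identity:
  fixes \<beta> e :: "nat list \<Rightarrow> real"
  assumes \<beta>: "antisymmetric \<beta>" and e: "antisymmetric e" "e [0..<n] ^ 2 = 1"
    and pq: "p + q = n" and a: "a \<in> index_lists n p"
  shows "(\<Sum>a'\<in>index_lists n p. \<Sum>b\<in>index_lists n q. \<beta> a' * (e (a @ b) * e (a' @ b))) =
    fact p * fact q * \<beta> a"
proof (cases "distinct a")
  case False
  then have "\<not> distinct (a @ b)" for b by simp
  then have "e (a @ b) = 0" for b using antisymmetric_not_distinct[OF e(1)] by blast
  then show ?thesis using antisymmetric_not_distinct[OF \<beta> False] by simp
next
  case True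
  define S where "S = permutations_of_set (set a)"
  define T where "T = permutations_of_set ({..<n} - set a)"
  have card_a: "card (set a) = p" "set a \<subseteq> {..<n}"
    using True a by (auto simp: index_lists_def distinct_card)
  then have card_T: "card ({..<n} - set a) = q"
    using pq by (subst card_Diff_subset) auto
  have S: "S \<subseteq> index_lists n p" and T: "T \<subseteq> index_lists n q"
    using card_a card_T
    by (auto simp: S_def T_def permutations_of_set_def index_lists_def distinct_card)
      (metis distinct_card, metis distinct_card)
  have summand: "\<beta> a' * (e (a @ b) * e (a' @ b)) = (if a' \<in> S \<and> b \<in> T then \<beta> a else 0)"
    if ab: "a' \<in> index_lists n p" "b \<in> index_lists n q" for a' b
  proof (cases "distinct (a @ b) \<and> distinct (a' @ b)")
    case False
    then have "e (a @ b) * e (a' @ b) = 0"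
      using antisymmetric_not_distinct[OF e(1)] by (metis mult_eq_0_iff)
    moreover have "\<not> (a' \<in> S \<and> b \<in> T)"
      using False True by (auto simp: S_def T_def permutations_of_set_def)
    ultimately show ?thesis by auto
  next
    case d: True
    have full: "set (c @ b) = {..<n}" if "c \<in> index_lists n p" "distinct (c @ b)" for c
    proof (rule card_subset_eq)
      show "set (c @ b) \<subseteq> {..<n}" using that ab by (auto simp: index_lists_def)
      show "card (set (c @ b)) = card {..<n}"
        using distinct_card[OF that(2)] that(1) ab pq by (auto simp: index_lists_def)
    qed simp
    have sb: "set b = {..<n} - set a" "set a' = set a"
      using full[OF a] full[OF ab(1)] d by auto
    then have ST: "a' \<in> S" "b \<in> T"
      using d by (auto simp: S_def T_def permutations_of_set_def)
    have "mset a = mset a'"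
      using sb(2) d by (intro set_eq_iff_mset_eq_distinct[THEN iffD1]) simp_all
    then have "\<beta> a' * e (a' @ b) = \<beta> a * e (a @ b)"
      using antisymmetric_mset_eq[OF \<beta> antisymmetric_append_right[OF e(1)]] by metis
    moreover have "e (a @ b) * e (a @ b) = 1"
    proof -
      have "mset (a @ b) = mset [0..<n]"
        using full[OF a] d
        by (intro set_eq_iff_mset_eq_distinct[THEN iffD1]) (simp_all add: atLeast0LessThan)
      then show ?thesis
        using antisymmetric_mset_eq[OF e(1) e(1)] e(2) by (metis power2_eq_square)
    qed
    ultimately show ?thesis using ST
      by (metis mult.assoc mult.commute mult.right_neutral)
  qed
  have "(\<Sum>a'\<in>index_lists n p. \<Sum>b\<in>index_lists n q. \<beta> a' * (e (a @ b) * e (a' @ b))) =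
      (\<Sum>(a', b)\<in>index_lists n p \<times> index_lists n q. if a' \<in> S \<and> b \<in> T then \<beta> a else 0)"
    using summand by (simp add: sum.cartesian_product)
  also have "\<dots> = (\<Sum>(a', b)\<in>S \<times> T. \<beta> a)"
    using S T by (intro sum.mono_neutral_cong_right) (auto split: if_splits)
  also have "\<dots> = fact p * fact q * \<beta> a"
    using card_a card_T by (simp add: S_def T_def card_cartesian_product case_prod_beta)
  finally show ?thesis .
qed

section \<open>Multilinear and alternating forms\<close>

text \<open>Concatenation makes this condition independent of a degree and compatible with recursion on
lists. For a form that vanishes outside the lists of one length it is the usual multilinearity.\<close>

definition multilinear_on :: "'v::real_vector set \<Rightarrow> ('v list \<Rightarrow> real) \<Rightarrow> bool" where
  "multilinear_on V \<omega> \<longleftrightarrow> (\<forall>xs ys u w a b. set xs \<subseteq> V \<and> set ys \<subseteq> V \<and> u \<in> V \<and> w \<in> V \<longrightarrow>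
     \<omega> (xs @ (a *\<^sub>R u + b *\<^sub>R w) # ys) = a * \<omega> (xs @ u # ys) + b * \<omega> (xs @ w # ys))"

lemma multilinear_onD:
  assumes "multilinear_on V \<omega>" "set xs \<subseteq> V" "set ys \<subseteq> V" "u \<in> V" "w \<in> V"
  shows "\<omega> (xs @ (a *\<^sub>R u + b *\<^sub>R w) # ys) = a * \<omega> (xs @ u # ys) + b * \<omega> (xs @ w # ys)"
  using assms unfolding multilinear_on_def by blast

lemma multilinear_on_append_left:
  assumes "multilinear_on V \<omega>" "set us \<subseteq> V"
  shows "multilinear_on V (\<lambda>v. \<omega> (us @ v))"
  unfolding multilinear_on_def
  using multilinear_onD[OF assms(1), of "us @ _"] assms(2) by simp

lemma multilinear_on_append_right:
  assumes "multilinear_on V \<omega>" "set us \<subseteq> V"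
  shows "multilinear_on V (\<lambda>v. \<omega> (v @ us))"
  unfolding multilinear_on_def
  using multilinear_onD[OF assms(1), of _ "_ @ us"] assms(2) by simp

lemma multilinear_on_Cons:
  "multilinear_on V \<omega> \<Longrightarrow> x \<in> V \<Longrightarrow> multilinear_on V (\<lambda>v. \<omega> (x # v))"
  using multilinear_on_append_left[of V \<omega> "[x]"] by simp

lemma multilinear_on_sum:
  assumes "\<And>i. i \<in> S \<Longrightarrow> multilinear_on V (f i)"
  shows "multilinear_on V (\<lambda>v. \<Sum>i\<in>S. f i v)"
  unfolding multilinear_on_def
proof (intro allI impI)
  fix xs ys u w a b
  assume "set xs \<subseteq> V \<and> set ys \<subseteq> V \<and> u \<in> V \<and> w \<in> V"
  then show "(\<Sum>i\<in>S. f i (xs @ (a *\<^sub>R u + b *\<^sub>R w) # ys)) =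
      a * (\<Sum>i\<in>S. f i (xs @ u # ys)) + b * (\<Sum>i\<in>S. f i (xs @ w # ys))"
    using multilinear_onD[OF assms, of _ xs ys u w a b]
    by (simp add: sum.distrib sum_distrib_left cong: sum.cong)
qed

lemma multilinear_on_mult:
  assumes "multilinear_on V f"
  shows "multilinear_on V (\<lambda>v. c * f v)" "multilinear_on V (\<lambda>v. f v * c)" "multilinear_on V (\<lambda>v. f v / c)"
  using assms unfolding multilinear_on_def by (auto simp: algebra_simps add_divide_distrib)

lemma multilinear_on_diff:
  assumes "multilinear_on V f" "multilinear_on V g"
  shows "multilinear_on V (\<lambda>v. f v - g v)"
  using assms unfolding multilinear_on_def by (auto simp: algebra_simps)

lemma multilinear_on_expand:
  fixes \<omega> :: "'v::real_vector list \<Rightarrow> real"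
  assumes \<omega>: "multilinear_on V \<omega>" and V: "subspace V" "set xs \<subseteq> V" "set ys \<subseteq> V" "\<And>i. i \<in> S \<Longrightarrow> g i \<in> V"
    and fin: "finite S"
  shows "\<omega> (xs @ (\<Sum>i\<in>S. c i *\<^sub>R g i) # ys) = (\<Sum>i\<in>S. c i * \<omega> (xs @ g i # ys))"
  using fin V(4)
proof (induction S)
  case empty
  have "\<omega> (xs @ (0 *\<^sub>R 0 + 0 *\<^sub>R 0) # ys) = 0"
    using multilinear_onD[OF \<omega> V(2,3), of 0 0 0 0] subspace_0[OF V(1)] by simp
  then show ?case by simp
next
  case (insert i S)
  have "(\<Sum>i\<in>S. c i *\<^sub>R g i) \<in> V"
    using insert.prems by (intro subspace_sum[OF V(1)] subspace_scale[OF V(1)]) auto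
  then have "\<omega> (xs @ (c i *\<^sub>R g i + 1 *\<^sub>R (\<Sum>i\<in>S. c i *\<^sub>R g i)) # ys) =
      c i * \<omega> (xs @ g i # ys) + 1 * \<omega> (xs @ (\<Sum>i\<in>S. c i *\<^sub>R g i) # ys)"
    using insert.prems by (intro multilinear_onD[OF \<omega> V(2,3)]) auto
  then show ?case using insert by simp
qed

text \<open>Polarisation of \<open>\<omega>(\<dots>, x + y, x + y, \<dots>) = 0\<close> gives antisymmetry from the vanishing on repeated entries.
Antisymmetry holds on all lists, not only on those in \<open>V\<close>, since both sides vanish elsewhere.\<close>

lemma alt_forms_iff:
  fixes V :: "'v::real_vector set"
  assumes V: "subspace V"
  shows "\<omega> \<in> alt_forms V p \<longleftrightarrow>
    (\<forall>v. \<not> (length v = p \<and> set v \<subseteq> V) \<longrightarrow> \<omega> v = 0) \<and> multilinear_on V \<omega> \<and> antisymmetric \<omega>"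
    (is "?L \<longleftrightarrow> ?S \<and> ?M \<and> ?A")
proof
  assume L: ?L
  have supp: ?S using L unfolding alt_forms_def by blast
  have lin: "\<omega> (v[i := a *\<^sub>R u + b *\<^sub>R w]) = a * \<omega> (v[i := u]) + b * \<omega> (v[i := w])"
    if "length v = p" "set v \<subseteq> V" "i < p" "u \<in> V" "w \<in> V" for v i a b u w
    using L that unfolding alt_forms_def by blast
  have rep: "\<omega> v = 0" if "length v = p" "set v \<subseteq> V" "i < j" "j < p" "v ! i = v ! j" for v i j
    using L that unfolding alt_forms_def by blast
  have m: ?M
    unfolding multilinear_on_def
  proof (intro allI impI)
    fix xs ys u w a b
    assume *: "set xs \<subseteq> V \<and> set ys \<subseteq> V \<and> u \<in> V \<and> w \<in> V"
    show "\<omega> (xs @ (a *\<^sub>R u + b *\<^sub>R w) # ys) = a * \<omega> (xs @ u # ys) + b * \<omega> (xs @ w # ys)"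
    proof (cases "length (xs @ u # ys) = p")
      case True
      then show ?thesis
        using lin[of "xs @ u # ys" "length xs" u w a b] * by (simp add: list_update_append)
    next
      case False
      then show ?thesis using supp by simp
    qed
  qed
  have ?A
    unfolding antisymmetric_def
  proof (intro allI)
    fix xs x y ys
    show "\<omega> (xs @ x # y # ys) = - \<omega> (xs @ y # x # ys)"
    proof (cases "length (xs @ x # y # ys) = p \<and> set (xs @ x # y # ys) \<subseteq> V")
      case True
      then have in_V: "set xs \<subseteq> V" "set ys \<subseteq> V" "x \<in> V" "y \<in> V" "x + y \<in> V"
        using subspace_add[OF V] by auto
      have diag: "\<omega> (xs @ z # z # ys) = 0" if "z \<in> V" for z
        using rep[of "xs @ z # z # ys" "length xs" "Suc (length xs)"] True that
        by (simp add: nth_append)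
      have add1: "\<omega> (xs @ (x + y) # z # ys) = \<omega> (xs @ x # z # ys) + \<omega> (xs @ y # z # ys)" if "z \<in> V" for z
        using multilinear_onD[OF m, of xs "z # ys" x y 1 1] in_V that by simp
      have add2: "\<omega> (xs @ z # (x + y) # ys) = \<omega> (xs @ z # x # ys) + \<omega> (xs @ z # y # ys)" if "z \<in> V" for z
        using multilinear_onD[OF m, of "xs @ [z]" ys x y 1 1] in_V that by simp
      show ?thesis
        using diag[of "x + y"] diag[of x] diag[of y] add1[of "x + y"] add2[of x] add2[of y] in_V
        by simp
    next
      case False
      then show ?thesis using supp by auto
    qed
  qed
  with supp m show "?S \<and> ?M \<and> ?A" by blast
next
  assume R: "?S \<and> ?M \<and> ?A"
  have lin: "\<omega> (v[i := a *\<^sub>R u + b *\<^sub>R w]) = a * \<omega> (v[i := u]) + b * \<omega> (v[i := w])"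
    if "length v = p" "set v \<subseteq> V" "i < p" "u \<in> V" "w \<in> V" for v i a b u w
  proof -
    have "set (take i v) \<subseteq> V" "set (drop (Suc i) v) \<subseteq> V"
      using that by (auto dest: in_set_takeD in_set_dropD)
    then show ?thesis
      using multilinear_onD[of V \<omega> "take i v" "drop (Suc i) v" u w a b] R that
      by (simp add: upd_conv_take_nth_drop)
  qed
  have rep: "\<omega> v = 0" if "length v = p" "i < j" "j < p" "v ! i = v ! j" for v i j
    using antisymmetric_not_distinct[of \<omega> v] R that
    by (metis nat_neq_iff nth_eq_iff_index_eq order_less_trans)
  show ?L
    unfolding alt_forms_def using R lin rep by blast
qed

lemma alt_forms_outside:
  "\<omega> \<in> alt_forms V p \<Longrightarrow> \<not> (length v = p \<and> set v \<subseteq> V) \<Longrightarrow> \<omega> v = 0"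
  unfolding alt_forms_def by blast

lemma multilinear_on_eq_0:
  assumes \<omega>: "multilinear_on V \<omega>" and V: "subspace V" "set E \<subseteq> V"
    and basis: "\<And>z. z \<in> V \<Longrightarrow> \<exists>c. z = (\<Sum>i<length E. c i *\<^sub>R E ! i)"
    and zero: "\<And>a. a \<in> index_lists (length E) m \<Longrightarrow> \<omega> (map ((!) E) a) = 0"
    and v: "length v = m" "set v \<subseteq> V"
  shows "\<omega> v = 0"
proof -
  have "\<omega> (map ((!) E) a @ v) = 0"
    if "set a \<subseteq> {..<length E}" "length a + length v = m" "set v \<subseteq> V" for a v
    using that
  proof (induction v arbitrary: a)
    case Nil
    then show ?case using zero by (simp add: index_lists_def)
  next
    case (Cons z v)
    obtain c where c: "z = (\<Sum>i<length E. c i *\<^sub>R E ! i)" using basis Cons.prems by auto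
    have E: "E ! i \<in> V" if "i < length E" for i using V(2) that nth_mem by blast
    have "\<omega> (map ((!) E) a @ z # v) = (\<Sum>i<length E. c i * \<omega> (map ((!) E) a @ E ! i # v))"
      unfolding c using Cons.prems E by (intro multilinear_on_expand[OF \<omega> V(1)]) auto
    also have "\<dots> = 0"
      using Cons.IH[of "a @ [_]"] Cons.prems by (intro sum.neutral) auto
    finally show ?case .
  qed
  from this[of "[]" v] v show ?thesis by simp
qed

text \<open>By the pigeonhole principle the index list has a repetition.\<close>

lemma antisymmetric_map_long:
  assumes "antisymmetric \<omega>" "a \<in> index_lists n m" "m > n"
  shows "\<omega> (map f a) = 0"
proof -
  have "card (set a) \<le> n"
    using assms(2) card_mono[of "{..<n}" "set a"] by (simp add: index_lists_def)
  then have "\<not> distinct a"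
    using assms(2,3) distinct_card[of a] by (auto simp: index_lists_def)
  then have "\<not> distinct (map f a)" by (simp add: distinct_map)
  then show ?thesis by (rule antisymmetric_not_distinct[OF assms(1)])
qed

text \<open>For a fixed permutation, the position to which one entry is moved does not depend on its value. This
reduces multilinearity of the wedge product to that of its two factors.\<close>

lemma permute_list_insert:
  assumes "\<sigma> permutes {..<length xs + Suc (length ys)}"
  obtains us vs where "\<And>z. permute_list \<sigma> (xs @ z # ys) = us @ z # vs"
    "set us \<subseteq> set xs \<union> set ys" "set vs \<subseteq> set xs \<union> set ys"
proof -
  let ?m = "length xs + Suc (length ys)" and ?i = "length xs"
  define j where "j = inv \<sigma> ?i"
  have j: "j < ?m" "\<sigma> j = ?i"
    using permutes_inv[OF assms] permutes_in_image[of "inv \<sigma>" "{..<?m}" ?i] permutes_inverses[OF assms]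
    by (auto simp: j_def)
  define g where "g l = (if \<sigma> l < ?i then xs ! (\<sigma> l) else ys ! (\<sigma> l - Suc ?i))" for l
  have g: "(xs @ z # ys) ! (\<sigma> l) = g l" "g l \<in> set xs \<union> set ys" if "l < ?m" "l \<noteq> j" for l z
  proof -
    have "\<sigma> l < ?m" using permutes_in_image[OF assms, of l] that by simp
    moreover have "\<sigma> l \<noteq> ?i" using j that permutes_inj[OF assms] by (metis injD)
    ultimately show "(xs @ z # ys) ! (\<sigma> l) = g l" "g l \<in> set xs \<union> set ys"
      by (auto simp: g_def nth_append nth_Cons')
  qed
  define us where "us = map g [0..<j]"
  define vs where "vs = map g [Suc j..<?m]"
  have split: "[0..<?m] = [0..<j] @ j # [Suc j..<?m]"
    using j upt_add_eq_append[of 0 j "?m - j"] upt_conv_Cons[of j ?m] by simp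
  have insert: "permute_list \<sigma> (xs @ z # ys) = us @ z # vs" for z
  proof -
    have "permute_list \<sigma> (xs @ z # ys) = map (\<lambda>l. (xs @ z # ys) ! (\<sigma> l)) [0..<?m]"
      by (simp add: permute_list_def)
    also have "\<dots> = us @ z # vs"
      unfolding split us_def vs_def using j by (auto intro!: g(1))
    finally show ?thesis .
  qed
  have "g l \<in> set xs \<union> set ys" if "l \<in> {0..<j} \<union> {Suc j..<?m}" for l
    by (rule g(2)) (use that j in auto)
  then have sets: "set us \<subseteq> set xs \<union> set ys" "set vs \<subseteq> set xs \<union> set ys"
    unfolding us_def vs_def set_map set_upt by blast+
  show ?thesis by (rule that[OF insert sets])
qed

lemma multilinear_on_wedge:
  assumes \<alpha>: "multilinear_on V \<alpha>" and \<gamma>: "multilinear_on V \<gamma>"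
  shows "multilinear_on V (wedge p q \<alpha> \<gamma>)"
proof -
  let ?t = "\<lambda>\<sigma> v. \<alpha> (take p (permute_list \<sigma> v)) * \<gamma> (drop p (permute_list \<sigma> v))"
  have lin: "?t \<sigma> (xs @ (a *\<^sub>R u + b *\<^sub>R w) # ys) = a * ?t \<sigma> (xs @ u # ys) + b * ?t \<sigma> (xs @ w # ys)"
    if \<sigma>: "\<sigma> permutes {..<length xs + Suc (length ys)}"
      and V: "set xs \<subseteq> V" "set ys \<subseteq> V" "u \<in> V" "w \<in> V" for \<sigma> xs ys u w a b
  proof -
    obtain us vs where uv: "\<And>z. permute_list \<sigma> (xs @ z # ys) = us @ z # vs"
      "set us \<subseteq> set xs \<union> set ys" "set vs \<subseteq> set xs \<union> set ys"
      by (rule permute_list_insert[OF \<sigma>]) blast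
    have V': "set us \<subseteq> V" "set vs \<subseteq> V" using uv(2,3) V by auto
    show ?thesis
    proof (cases "length us < p")
      case True
      then obtain r where r: "p = length us + Suc r" by (metis less_iff_Suc_add add_Suc_right)
      have "set (take r vs) \<subseteq> V" using V' by (auto dest: in_set_takeD)
      then show ?thesis
        using multilinear_onD[OF \<alpha> V'(1) _ V(3,4), of "take r vs" a b]
        unfolding uv(1) r by (simp add: algebra_simps)
    next
      case False
      have "set (drop p us) \<subseteq> V" using V' by (auto dest: in_set_dropD)
      then show ?thesis
        using multilinear_onD[OF \<gamma> _ V'(2) V(3,4), of "drop p us" a b] False
        unfolding uv(1) by (simp add: algebra_simps)
    qed
  qed
  show ?thesis
    unfolding multilinear_on_def
  proof (intro allI impI)
    fix xs ys u w a b assume *: "set xs \<subseteq> V \<and> set ys \<subseteq> V \<and> u \<in> V \<and> w \<in> V"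
    show "wedge p q \<alpha> \<gamma> (xs @ (a *\<^sub>R u + b *\<^sub>R w) # ys) =
        a * wedge p q \<alpha> \<gamma> (xs @ u # ys) + b * wedge p q \<alpha> \<gamma> (xs @ w # ys)"
    proof (cases "length xs + Suc (length ys) = p + q")
      case True
      let ?S = "\<lambda>v. \<Sum>\<sigma> | \<sigma> permutes {..<p + q}. of_int (sign \<sigma>) * ?t \<sigma> v"
      have "?S (xs @ (a *\<^sub>R u + b *\<^sub>R w) # ys) = a * ?S (xs @ u # ys) + b * ?S (xs @ w # ys)"
        unfolding sum_distrib_left sum.distrib[symmetric]
      proof (rule sum.cong[OF refl])
        fix \<sigma> assume "\<sigma> \<in> {\<sigma>. \<sigma> permutes {..<p + q}}"
        then have "\<sigma> permutes {..<length xs + Suc (length ys)}" using True by simp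
        from lin[OF this, of u w a b] * show "of_int (sign \<sigma>) * ?t \<sigma> (xs @ (a *\<^sub>R u + b *\<^sub>R w) # ys) =
            a * (of_int (sign \<sigma>) * ?t \<sigma> (xs @ u # ys)) + b * (of_int (sign \<sigma>) * ?t \<sigma> (xs @ w # ys))"
          by (simp add: algebra_simps)
      qed
      then show ?thesis using True
        by (simp add: wedge_def mult.assoc add_divide_distrib)
    qed (simp add: wedge_def)
  qed
qed

lemma antisymmetric_wedge: "antisymmetric (wedge p q \<alpha> \<gamma>)"
proof -
  have "wedge p q \<alpha> \<gamma> = (\<lambda>v. (if length v = p + q then
      \<Sum>\<sigma> | \<sigma> permutes {..<p + q}. of_int (sign \<sigma>) *
        (\<lambda>u. \<alpha> (take p u) * \<gamma> (drop p u)) (permute_list \<sigma> v) else 0) * (1 / (fact p * fact q)))"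
    by (auto simp: wedge_def fun_eq_iff mult.assoc)
  then show ?thesis
    using antisymmetric_mult(2)[OF antisymmetric_antisymmetrization[of "p + q" "\<lambda>u. \<alpha> (take p u) * \<gamma> (drop p u)"],
      of "1 / (fact p * fact q)"] by simp
qed

section \<open>Orthonormal frames and the star operator\<close>

locale inner_product_on =
  fixes V :: "'v::real_vector set" and G :: "'v \<Rightarrow> 'v \<Rightarrow> real"
  assumes subspace_V: "subspace V"
    and G_sym: "u \<in> V \<Longrightarrow> v \<in> V \<Longrightarrow> G u v = G v u"
    and G_lin: "u \<in> V \<Longrightarrow> v \<in> V \<Longrightarrow> w \<in> V \<Longrightarrow> G (a *\<^sub>R u + b *\<^sub>R v) w = a * G u w + b * G v w"
    and G_pos: "u \<in> V \<Longrightarrow> u \<noteq> 0 \<Longrightarrow> G u u > 0"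
begin

lemma G_sum:
  assumes "finite S" "\<And>i. i \<in> S \<Longrightarrow> g i \<in> V" "w \<in> V"
  shows "G (\<Sum>i\<in>S. c i *\<^sub>R g i) w = (\<Sum>i\<in>S. c i * G (g i) w)"
  using assms
proof (induction S)
  case empty
  then show ?case using G_lin[of w w w 0 0] by simp
next
  case (insert i S)
  have "(\<Sum>i\<in>S. c i *\<^sub>R g i) \<in> V"
    using insert.prems by (intro subspace_sum[OF subspace_V] subspace_scale[OF subspace_V]) auto
  then show ?case
    using insert G_lin[of "g i" "\<Sum>i\<in>S. c i *\<^sub>R g i" w "c i" 1] by simp
qed

text \<open>The vectors for which the expansion holds form a subspace containing the frame.\<close>

lemma orthonormal_expansion:
  assumes "orthonormal_frame V G E" "z \<in> V"
  shows "z = (\<Sum>i<length E. G z (E ! i) *\<^sub>R E ! i)"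
proof -
  have E: "set E \<subseteq> V" "span (set E) = V"
    and on: "\<And>i j. i < length E \<Longrightarrow> j < length E \<Longrightarrow> G (E ! i) (E ! j) = (if i = j then 1 else 0)"
    using assms(1) unfolding orthonormal_frame_def by auto
  have mem: "E ! i \<in> V" if "i < length E" for i using E(1) that nth_mem by blast
  let ?P = "\<lambda>z. z \<in> V \<and> z = (\<Sum>i<length E. G z (E ! i) *\<^sub>R E ! i)"
  have "z \<in> span (set E)" using E assms by simp
  then have "?P z"
  proof (induction rule: span_induct)
    case base
    show ?case unfolding subspace_def
    proof (intro conjI ballI allI; clarsimp)
      have "G 0 (E ! i) = 0" if "i < length E" for i
        using G_lin[of 0 0 "E ! i" 0 0] mem that subspace_0[OF subspace_V] by simp
      then show "0 \<in> V \<and> (\<Sum>i<length E. G 0 (E ! i) *\<^sub>R E ! i) = 0"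
        using subspace_0[OF subspace_V] by simp
    next
      fix x y assume x: "x \<in> V" "x = (\<Sum>i<length E. G x (E ! i) *\<^sub>R E ! i)"
        and y: "y \<in> V" "y = (\<Sum>i<length E. G y (E ! i) *\<^sub>R E ! i)"
      have "G (x + y) (E ! i) = G x (E ! i) + G y (E ! i)" if "i < length E" for i
        using G_lin[of x y "E ! i" 1 1] mem that x y by simp
      then have "(\<Sum>i<length E. G (x + y) (E ! i) *\<^sub>R E ! i) =
          (\<Sum>i<length E. G x (E ! i) *\<^sub>R E ! i) + (\<Sum>i<length E. G y (E ! i) *\<^sub>R E ! i)"
        by (simp add: scaleR_add_left sum.distrib)
      then show "x + y \<in> V \<and> x + y = (\<Sum>i<length E. G (x + y) (E ! i) *\<^sub>R E ! i)"
        using x y subspace_add[OF subspace_V] by metis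
    next
      fix c x assume x: "x \<in> V" "x = (\<Sum>i<length E. G x (E ! i) *\<^sub>R E ! i)"
      have "G (c *\<^sub>R x) (E ! i) = c * G x (E ! i)" if "i < length E" for i
        using G_lin[of x x "E ! i" c 0] mem that x by simp
      then have "(\<Sum>i<length E. G (c *\<^sub>R x) (E ! i) *\<^sub>R E ! i) =
          c *\<^sub>R (\<Sum>i<length E. G x (E ! i) *\<^sub>R E ! i)"
        by (simp add: scaleR_sum_right)
      then show "c *\<^sub>R x \<in> V \<and> c *\<^sub>R x = (\<Sum>i<length E. G (c *\<^sub>R x) (E ! i) *\<^sub>R E ! i)"
        using x subspace_scale[OF subspace_V] by metis
    qed
  next
    case (step z)
    then obtain j where j: "j < length E" "z = E ! j" by (metis in_set_conv_nth)
    have "(\<Sum>i<length E. G z (E ! i) *\<^sub>R E ! i) = (\<Sum>i<length E. if i = j then E ! i else 0)"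
      using j on by (intro sum.cong) auto
    then show ?case using j mem by simp
  qed
  then show ?thesis by simp
qed

lemma orthonormal_length:
  assumes "orthonormal_frame V G E"
  shows "length E = dim V"
proof -
  have E: "set E \<subseteq> V" "span (set E) = V"
    and on: "\<And>i j. i < length E \<Longrightarrow> j < length E \<Longrightarrow> G (E ! i) (E ! j) = (if i = j then 1 else 0)"
    using assms unfolding orthonormal_frame_def by auto
  have d: "distinct E"
    unfolding distinct_conv_nth using on by (metis zero_neq_one)
  have orth: "G x y = (if x = y then 1 else 0)" if xy: "x \<in> set E" "y \<in> set E" for x y
    using xy on d by (auto simp: in_set_conv_nth nth_eq_iff_index_eq)
  have "independent (set E)"
  proof
    assume "dependent (set E)"
    then obtain u v where u: "v \<in> set E" "u v \<noteq> 0" "(\<Sum>v\<in>set E. u v *\<^sub>R v) = 0"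
      unfolding dependent_finite[OF finite_set] by blast
    have "0 = G (\<Sum>v\<in>set E. u v *\<^sub>R v) v"
      using G_sum[of "{}" _ v] u E(1) by auto
    also have "\<dots> = (\<Sum>x\<in>set E. u x * G x v)"
      using E(1) u by (intro G_sum) auto
    also have "\<dots> = (\<Sum>x\<in>set E. if x = v then u x else 0)"
      using orth u(1) by (intro sum.cong) auto
    finally show False using u by simp
  qed
  then have "dim (span (set E)) = card (set E)"
    by (simp add: dim_eq_card_independent)
  then show ?thesis using E(2) distinct_card[OF d] by simp
qed

text \<open>Gram-Schmidt orthogonalisation, one vector of \<open>B\<close> at a time; a vector that already lies in the span
is skipped.\<close>

lemma orthonormal_frame_exists:
  assumes "finite B" "span B = V"
  shows "\<exists>E. orthonormal_frame V G E"
proof -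
  have "\<exists>E. orthonormal_frame (span B) G E" if "B \<subseteq> V"
    using assms(1) that
  proof (induction B)
    case empty
    then show ?case by (intro exI[of _ "[]"]) (simp add: orthonormal_frame_def)
  next
    case (insert b B)
    then obtain E where E: "set E \<subseteq> span B" "span (set E) = span B"
      "\<And>i j. i < length E \<Longrightarrow> j < length E \<Longrightarrow> G (E ! i) (E ! j) = (if i = j then 1 else 0)"
      unfolding orthonormal_frame_def by auto
    have B: "span B \<subseteq> V" "b \<in> V"
      using insert.prems subspace_V by (auto intro: span_minimal[THEN subsetD])
    then have EV: "E ! i \<in> V" if "i < length E" for i using E(1) that nth_mem by blast
    \<comment> \<open>\<open>s\<close> is the orthogonal projection of \<open>b\<close> to the span, \<open>r\<close> the remainder to be normalised\<close>
    define s where "s = (\<Sum>i<length E. G b (E ! i) *\<^sub>R E ! i)"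
    define r where "r = b - s"
    have s: "s \<in> span (set E)"
      unfolding s_def by (intro span_sum span_scale span_base) auto
    then have r: "r \<in> V" using B E(2) subspace_diff[OF subspace_V] unfolding r_def by auto
    have orth: "G r (E ! j) = 0" if j: "j < length E" for j
    proof -
      have "G s (E ! j) = (\<Sum>i<length E. G b (E ! i) * G (E ! i) (E ! j))"
        unfolding s_def using EV j by (intro G_sum) auto
      also have "\<dots> = (\<Sum>i<length E. if i = j then G b (E ! i) else 0)"
        using E(3) j by (intro sum.cong) auto
      finally have "G s (E ! j) = G b (E ! j)" using j by simp
      moreover have "G r (E ! j) = G b (E ! j) - G s (E ! j)"
        using G_lin[of b s "E ! j" 1 "-1"] EV j B s E(2) by (auto simp: r_def)
      ultimately show ?thesis by simp
    qed
    have insert_span: "span (insert b B) = span (insert b (set E))"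
      unfolding span_insert using E(2) by simp
    show ?case
    proof (cases "r = 0")
      case True
      then have "span (insert b (set E)) = span (set E)"
        using s by (simp add: r_def span_redundant)
      then show ?thesis
        using E insert_span by (intro exI[of _ E]) (simp add: orthonormal_frame_def)
    next
      case False
      define c where "c = 1 / sqrt (G r r)"
      have c: "c \<noteq> 0" "c * (c * G r r) = 1"
        using G_pos[OF r False] by (auto simp: c_def field_simps)
      have cr: "G (c *\<^sub>R r) z = c * G r z" "G z (c *\<^sub>R r) = c * G r z" if "z \<in> V" for z
        using G_lin[of r r z c 0] G_sym[of z "c *\<^sub>R r"] r that subspace_scale[OF subspace_V r] by auto
      have "span (insert b (set E)) = span (insert r (set E))"
      proof (rule span_eq[THEN iffD2], intro conjI insert_subsetI)
        have "r + s \<in> span (insert r (set E))"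
          using s by (intro span_add span_base[of r]) (auto intro: span_mono[THEN subsetD, of "set E"])
        then show "b \<in> span (insert r (set E))" by (simp add: r_def)
        show "r \<in> span (insert b (set E))" unfolding r_def
          using s by (intro span_diff span_base[of b]) (auto intro: span_mono[THEN subsetD, of "set E"])
      qed (auto intro: span_base)
      also have "\<dots> = span (insert (c *\<^sub>R r) (set E))"
      proof (rule span_eq[THEN iffD2], intro conjI insert_subsetI)
        have "(1 / c) *\<^sub>R (c *\<^sub>R r) \<in> span (insert (c *\<^sub>R r) (set E))"
          by (intro span_scale span_base) simp
        then show "r \<in> span (insert (c *\<^sub>R r) (set E))" using c by simp
        show "c *\<^sub>R r \<in> span (insert r (set E))"
          by (intro span_scale span_base) simp
      qed (auto intro: span_base)
      finally have sp: "span (set (E @ [c *\<^sub>R r])) = span (insert b B)"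
        using insert_span by simp
      have "set (E @ [c *\<^sub>R r]) \<subseteq> span (insert b B)"
        using span_superset[of "set (E @ [c *\<^sub>R r])"] unfolding sp .
      moreover have "G ((E @ [c *\<^sub>R r]) ! i) ((E @ [c *\<^sub>R r]) ! j) = (if i = j then 1 else 0)"
        if "i < Suc (length E)" "j < Suc (length E)" for i j
        using that E(3) orth EV cr c(2) r G_sym subspace_scale[OF subspace_V r, of c]
        by (auto simp: nth_append less_Suc_eq)
      ultimately show ?thesis using sp
        by (intro exI[of _ "E @ [c *\<^sub>R r]"]) (simp add: orthonormal_frame_def)
    qed
  qed
  moreover have "B \<subseteq> V" using span_superset[of B] assms(2) by simp
  ultimately show ?thesis using assms(2) by simp
qed

lemma alternating_eq_0_above_dim:
  assumes "finite B" "span B = V" "multilinear_on V \<omega>" "antisymmetric \<omega>" "length v > dim V" "set v \<subseteq> V"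
  shows "\<omega> v = 0"
proof -
  obtain E where E: "orthonormal_frame V G E" using orthonormal_frame_exists[OF assms(1,2)] by blast
  have "set E \<subseteq> V" using E by (simp add: orthonormal_frame_def)
  then show ?thesis
  proof (rule multilinear_on_eq_0[OF assms(3) subspace_V _ _ _ refl assms(6)])
    show "\<exists>c. z = (\<Sum>i<length E. c i *\<^sub>R E ! i)" if "z \<in> V" for z
      using orthonormal_expansion[OF E that] by (rule exI[of _ "\<lambda>i. G z (E ! i)"])
    show "\<omega> (map ((!) E) a) = 0" if "a \<in> index_lists (length E) (length v)" for a
      by (rule antisymmetric_map_long[OF assms(4) that]) (simp add: orthonormal_length[OF E] assms(5))
  qed
qed

end

locale oriented_inner_product_on = inner_product_on V G
  for V :: "'v::real_vector set" and G +
  fixes \<mu> :: "'v form"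
  assumes finite_dimensional: "\<exists>B. finite B \<and> span B = V"
    and \<mu>_alt: "\<mu> \<in> alt_forms V (dim V)"
    and \<mu>_nonzero: "\<exists>v. \<mu> v \<noteq> 0"
begin

text \<open>\<open>E\<close> has to be the very frame that is chosen in \<open>form_inner\<close>, so that inner products of forms are sums over
its index lists.\<close>

definition "n = dim V"
definition E :: "'v list" where "E = (SOME e. orthonormal_frame V G e)"
definition "vol = volume_element V G \<mu>"
definition at_frame :: "nat list \<Rightarrow> 'v list" where "at_frame a = map ((!) E) a"

lemma E_frame: "orthonormal_frame V G E"
  unfolding E_def using orthonormal_frame_exists finite_dimensional by (metis someI_ex)

lemma length_E [simp]: "length E = n"
  using orthonormal_length[OF E_frame] by (simp add: n_def)

lemma E_in_V: "set E \<subseteq> V"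
  using E_frame by (simp add: orthonormal_frame_def)

lemma E_expansion: "z \<in> V \<Longrightarrow> z = (\<Sum>i<n. G z (E ! i) *\<^sub>R E ! i)"
  using orthonormal_expansion[OF E_frame] by simp

lemma E_nth_in_V: "i < n \<Longrightarrow> E ! i \<in> V"
  using E_in_V by (metis length_E nth_mem subsetD)

lemma at_frame_in_V: "a \<in> index_lists n m \<Longrightarrow> set (at_frame a) \<subseteq> V"
  using E_nth_in_V by (auto simp: index_lists_def at_frame_def)

lemma length_at_frame [simp]: "length (at_frame a) = length a"
  by (simp add: at_frame_def)

lemma at_frame_Nil [simp]: "at_frame [] = []"
  by (simp add: at_frame_def)

lemma at_frame_append [simp]: "at_frame (a @ b) = at_frame a @ at_frame b"
  by (simp add: at_frame_def)

lemma at_frame_Cons [simp]: "at_frame (x # a) = E ! x # at_frame a"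
  by (simp add: at_frame_def)

lemma at_frame_upt [simp]: "at_frame [0..<n] = E"
  using map_nth[of E] by (simp add: at_frame_def)

lemma antisymmetric_at_frame: "antisymmetric h \<Longrightarrow> antisymmetric (\<lambda>a. h (at_frame a))"
  unfolding at_frame_def by (rule antisymmetric_map)

lemma multilinear_eq_0:
  assumes "multilinear_on V \<omega>" "\<And>a. a \<in> index_lists n m \<Longrightarrow> \<omega> (at_frame a) = 0"
    "length v = m" "set v \<subseteq> V"
  shows "\<omega> v = 0"
proof (rule multilinear_on_eq_0[OF assms(1) subspace_V E_in_V _ _ assms(3,4)])
  show "\<exists>c. z = (\<Sum>i<length E. c i *\<^sub>R E ! i)" if "z \<in> V" for z
    unfolding length_E using E_expansion[OF that] by (rule exI[of _ "\<lambda>i. G z (E ! i)"])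
qed (use assms(2) in \<open>simp add: at_frame_def\<close>)

text \<open>Top forms are proportional: up to sign the only value on frame vectors is the one at \<open>E\<close>. Two top
forms are therefore compared at \<open>E\<close> alone.\<close>

lemma alternating_eq_0_top:
  assumes "multilinear_on V \<omega>" "antisymmetric \<omega>" "\<omega> E = 0" "length v = n" "set v \<subseteq> V"
  shows "\<omega> v = 0"
proof (rule multilinear_eq_0[OF assms(1) _ assms(4,5)])
  fix a assume a: "a \<in> index_lists n n"
  show "\<omega> (at_frame a) = 0"
  proof (cases "distinct a")
    case False
    then show ?thesis
      using antisymmetric_not_distinct[OF antisymmetric_at_frame[OF assms(2)]] by simp
  next
    case True
    then have "set a = {..<n}"
      using a distinct_card[OF True] by (intro card_subset_eq) (auto simp: index_lists_def)
    then have "mset a = mset [0..<n]"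
      using True by (intro set_eq_iff_mset_eq_distinct[THEN iffD1]) (simp_all add: atLeast0LessThan)
    then have "\<omega> (at_frame a) * \<omega> (at_frame a) = \<omega> (at_frame [0..<n]) * \<omega> (at_frame [0..<n])"
      using antisymmetric_at_frame[OF assms(2)] by (intro antisymmetric_mset_eq)
    then show ?thesis using assms(3) by simp
  qed
qed

lemma \<mu>_E: "\<mu> E \<noteq> 0"
proof
  assume "\<mu> E = 0"
  moreover obtain v where "\<mu> v \<noteq> 0" using \<mu>_nonzero by blast
  ultimately show False
    using alternating_eq_0_top[of \<mu> v] \<mu>_alt alt_forms_outside[OF \<mu>_alt]
    unfolding alt_forms_iff[OF subspace_V] n_def by blast
qed

text \<open>Each increasing list of indices has \<open>p!\<close> rearrangements, and the product of two antisymmetric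
functions takes the same value on all of them.\<close>

lemma form_inner_eq:
  assumes \<alpha>: "antisymmetric \<alpha>" and \<beta>: "antisymmetric \<beta>"
  shows "form_inner V G p \<alpha> \<beta> =
    (\<Sum>a\<in>index_lists n p. \<alpha> (at_frame a) * \<beta> (at_frame a)) / fact p"
proof -
  let ?f = "\<lambda>a. \<alpha> (at_frame a) * \<beta> (at_frame a)"
  let ?D = "{a \<in> index_lists n p. distinct a}" and ?T = "{I. I \<subseteq> {..<n} \<and> card I = p}"
  have "(\<Sum>a\<in>index_lists n p. ?f a) = (\<Sum>a\<in>?D. ?f a)"
    using antisymmetric_not_distinct[OF antisymmetric_at_frame[OF \<alpha>]]
    by (intro sum.mono_neutral_right) auto
  also have "\<dots> = (\<Sum>I\<in>?T. \<Sum>a\<in>{a \<in> ?D. set a = I}. ?f a)"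
    by (intro sum.group[symmetric]) (simp_all, auto simp: index_lists_def distinct_card)
  also have "\<dots> = (\<Sum>I\<in>?T. fact p * (\<alpha> (nths E I) * \<beta> (nths E I)))"
  proof (rule sum.cong[OF refl])
    fix I assume I: "I \<in> ?T"
    have fin: "finite I" using I finite_subset by auto
    have D: "{a \<in> ?D. set a = I} = permutations_of_set I"
      using I by (auto simp: permutations_of_set_def index_lists_def) (metis distinct_card)
    let ?b = "nths [0..<n] I"
    have b: "nths E I = at_frame ?b"
      by (metis at_frame_def at_frame_upt nths_map)
    have "?f a = ?f ?b" if a: "a \<in> permutations_of_set I" for a
    proof -
      have "set ?b = I" using I by (force simp: set_nths)
      then have "mset a = mset ?b"
        using a by (intro set_eq_iff_mset_eq_distinct[THEN iffD1])
          (simp_all add: permutations_of_set_def distinct_nthsI)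
      then show ?thesis
        by (intro antisymmetric_mset_eq antisymmetric_at_frame \<alpha> \<beta>)
    qed
    then show "(\<Sum>a\<in>{a \<in> ?D. set a = I}. ?f a) = fact p * (\<alpha> (nths E I) * \<beta> (nths E I))"
      unfolding D b using I fin by simp
  qed
  also have "\<dots> = fact p * form_inner V G p \<alpha> \<beta>"
    unfolding form_inner_def Let_def E_def[symmetric] n_def[symmetric] by (simp add: sum_distrib_left)
  finally show ?thesis by simp
qed

lemma vol_alt: "vol \<in> alt_forms V n"
  and vol_E: "vol E ^ 2 = 1"
proof -
  have top: "{I. I \<subseteq> {..<n} \<and> card I = n} = {{..<n}}"
    using card_subset_eq[of "{..<n}"] by auto
  have "form_inner V G n \<mu> \<mu> = \<mu> E ^ 2"
    unfolding form_inner_def Let_def E_def[symmetric] n_def[symmetric] top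
    by (simp add: nths_upt_eq_take power2_eq_square)
  then have vol: "vol = (\<lambda>v. \<mu> v / \<bar>\<mu> E\<bar>)"
    by (simp add: vol_def volume_element_def n_def[symmetric])
  have "multilinear_on V \<mu>" "antisymmetric \<mu>" and *: "\<And>v. \<not> (length v = n \<and> set v \<subseteq> V) \<Longrightarrow> \<mu> v = 0"
    using \<mu>_alt unfolding alt_forms_iff[OF subspace_V] n_def by auto
  then have "multilinear_on V vol" "antisymmetric vol"
    unfolding vol using antisymmetric_mult(2)[of \<mu> "inverse \<bar>\<mu> E\<bar>"]
    by (auto simp: multilinear_on_mult divide_inverse)
  then show "vol \<in> alt_forms V n"
    using * unfolding alt_forms_iff[OF subspace_V] vol by simp
  show "vol E ^ 2 = 1" using \<mu>_E by (simp add: vol power_divide)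
qed

lemma vol_multilinear: "multilinear_on V vol" and vol_antisymmetric: "antisymmetric vol"
  and vol_outside: "\<not> (length v = n \<and> set v \<subseteq> V) \<Longrightarrow> vol v = 0"
  using vol_alt unfolding alt_forms_iff[OF subspace_V] by auto

lemma vol_append_alt:
  assumes "p + q = n" "a \<in> index_lists n p"
  shows "(\<lambda>v. vol (at_frame a @ v)) \<in> alt_forms V q" "(\<lambda>v. vol (v @ at_frame a)) \<in> alt_forms V q"
  unfolding alt_forms_iff[OF subspace_V]
  using assms at_frame_in_V[OF assms(2)] vol_outside
  by (auto intro!: multilinear_on_append_left multilinear_on_append_right vol_multilinear
      antisymmetric_append_left antisymmetric_append_right vol_antisymmetric simp: index_lists_def)

text \<open>The sign of a permutation is \<open>\<epsilon>\<close> of the permuted frame divided by \<open>\<epsilon>(E) = \<plusminus>1\<close>, and \<open>\<epsilon>\<close> extends it by \<open>0\<close>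
to all index lists. So the sum over permutations becomes a contraction with \<open>\<epsilon>\<close>.\<close>

lemma wedge_at_frame:
  assumes "p + q = n"
  shows "wedge p q \<alpha> \<gamma> E = vol E / (fact p * fact q) *
    (\<Sum>a\<in>index_lists n p. \<Sum>b\<in>index_lists n q.
      vol (at_frame (a @ b)) * (\<alpha> (at_frame a) * \<gamma> (at_frame b)))"
proof -
  let ?f = "\<lambda>c. vol (at_frame c) * (\<alpha> (at_frame (take p c)) * \<gamma> (at_frame (drop p c)))"
  have "(\<Sum>\<sigma> | \<sigma> permutes {..<p + q}. of_int (sign \<sigma>) *
        \<alpha> (take p (permute_list \<sigma> E)) * \<gamma> (drop p (permute_list \<sigma> E))) =
      (\<Sum>\<sigma> | \<sigma> permutes {..<n}. vol E * ?f (map \<sigma> [0..<n]))"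
    unfolding assms
  proof (rule sum.cong[OF refl])
    fix \<sigma> assume "\<sigma> \<in> {\<sigma>. \<sigma> permutes {..<n}}"
    then have s: "\<sigma> permutes {..<length E}" by simp
    have *: "permute_list \<sigma> E = at_frame (map \<sigma> [0..<n])"
      by (simp add: permute_list_def at_frame_def)
    have "vol (permute_list \<sigma> E) = of_int (sign \<sigma>) * vol E"
      by (rule antisymmetric_permute[OF vol_antisymmetric s])
    then have "of_int (sign \<sigma>) = vol E * vol (at_frame (map \<sigma> [0..<n]))"
      unfolding * using vol_E by (simp add: power2_eq_square)
    then show "of_int (sign \<sigma>) * \<alpha> (take p (permute_list \<sigma> E)) * \<gamma> (drop p (permute_list \<sigma> E)) =
        vol E * ?f (map \<sigma> [0..<n])"
      unfolding * by (simp add: at_frame_def take_map drop_map)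
  qed
  also have "\<dots> = vol E * (\<Sum>c\<in>index_lists n n. ?f c)"
    unfolding sum_distrib_left[symmetric]
    using antisymmetric_not_distinct[OF antisymmetric_at_frame[OF vol_antisymmetric]]
    by (subst sum_permutations_index_lists) auto
  also have "(\<Sum>c\<in>index_lists n n. ?f c) = (\<Sum>a\<in>index_lists n p. \<Sum>b\<in>index_lists n q. ?f (a @ b))"
    unfolding assms[symmetric] by (rule sum_index_lists_append)
  also have "\<dots> = (\<Sum>a\<in>index_lists n p. \<Sum>b\<in>index_lists n q.
      vol (at_frame (a @ b)) * (\<alpha> (at_frame a) * \<gamma> (at_frame b)))"
    by (intro sum.cong refl) (simp add: index_lists_def)
  finally show ?thesis using assms by (simp add: wedge_def)
qed

lemma vol_contraction:
  assumes "antisymmetric \<beta>" "p + q = n" "a \<in> index_lists n p"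
  shows "(\<Sum>a'\<in>index_lists n p. \<Sum>b\<in>index_lists n q.
      \<beta> (at_frame a') * (vol (at_frame (a @ b)) * vol (at_frame (a' @ b)))) =
    fact p * fact q * \<beta> (at_frame a)"
  using contraction_identity[of "\<lambda>a. \<beta> (at_frame a)" "\<lambda>c. vol (at_frame c)" n p q a]
  by (simp add: assms antisymmetric_at_frame vol_antisymmetric vol_E del: at_frame_append)

text \<open>The star operator as contraction with the volume element. Both sides see \<open>\<beta>\<close> only through its values at
frame vectors, where antisymmetry is what the contraction identity asks for; this makes the formula
applicable to \<open>dpow\<close>, which is antisymmetric on lists of arbitrary vectors.\<close>

lemma hodge_eq:
  assumes \<beta>: "antisymmetric \<beta>" and p: "p \<le> n"
  shows "hodge V G \<mu> p \<beta> =
    (\<lambda>v. (\<Sum>a\<in>index_lists n p. \<beta> (at_frame a) * vol (at_frame a @ v)) / fact p)"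
proof -
  define q where "q = n - p"
  have pq: "p + q = n" "q + p = n" using p by (auto simp: q_def)
  define s where "s v = (\<Sum>a\<in>index_lists n p. \<beta> (at_frame a) * vol (at_frame a @ v)) / fact p" for v
  have s_alt: "s \<in> alt_forms V q"
  proof -
    have "(\<lambda>v. vol (at_frame a @ v)) \<in> alt_forms V q" if "a \<in> index_lists n p" for a
      by (rule vol_append_alt(1)[OF pq(1) that])
    then show ?thesis
      unfolding alt_forms_iff[OF subspace_V] s_def divide_inverse
      by (intro conjI allI impI multilinear_on_mult multilinear_on_sum antisymmetric_mult antisymmetric_sum)
        auto
  qed
  \<comment> \<open>Both sides are top forms; at \<open>E\<close> they agree by the contraction identity.\<close>
  have exists: "wedge p q \<alpha> s v = form_inner V G p \<alpha> \<beta> * vol v" if \<alpha>: "\<alpha> \<in> alt_forms V p" for \<alpha> v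
  proof (cases "length v = n \<and> set v \<subseteq> V")
    case True
    have A: "antisymmetric \<alpha>" "multilinear_on V \<alpha>" and S: "multilinear_on V s"
      using \<alpha> s_alt unfolding alt_forms_iff[OF subspace_V] by auto
    have "(\<Sum>b\<in>index_lists n q. vol (at_frame (a @ b)) * s (at_frame b)) = fact q * \<beta> (at_frame a)"
      if a: "a \<in> index_lists n p" for a
    proof -
      have "(\<Sum>b\<in>index_lists n q. vol (at_frame (a @ b)) * s (at_frame b)) =
          (\<Sum>b\<in>index_lists n q. \<Sum>a'\<in>index_lists n p.
            \<beta> (at_frame a') * (vol (at_frame (a @ b)) * vol (at_frame (a' @ b))) / fact p)"
        unfolding s_def
        by (simp add: sum_distrib_left sum_divide_distrib mult_ac)
      also have "\<dots> = fact p * fact q * \<beta> (at_frame a) / fact p"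
        by (subst sum.swap) (simp only: sum_divide_distrib[symmetric] vol_contraction[OF \<beta> pq(1) a])
      finally show ?thesis by simp
    qed
    then have "wedge p q \<alpha> s E = vol E / (fact p * fact q) *
        (\<Sum>a\<in>index_lists n p. \<alpha> (at_frame a) * (fact q * \<beta> (at_frame a)))"
      unfolding wedge_at_frame[OF pq(1)]
      by (simp only: mult.left_commute[of "vol _" "\<alpha> _"] sum_distrib_left[symmetric] cong: sum.cong)
    also have "\<dots> = form_inner V G p \<alpha> \<beta> * vol E"
      unfolding form_inner_eq[OF A(1) \<beta>]
      by (simp add: mult.left_commute[of "\<alpha> _"] sum_distrib_left[symmetric])
    finally have zero: "wedge p q \<alpha> s E - form_inner V G p \<alpha> \<beta> * vol E = 0" by simp
    have "wedge p q \<alpha> s v - form_inner V G p \<alpha> \<beta> * vol v = 0"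
    proof (rule alternating_eq_0_top[where \<omega> = "\<lambda>v. wedge p q \<alpha> s v - form_inner V G p \<alpha> \<beta> * vol v"])
      show "multilinear_on V (\<lambda>v. wedge p q \<alpha> s v - form_inner V G p \<alpha> \<beta> * vol v)"
        by (intro multilinear_on_diff multilinear_on_wedge A S multilinear_on_mult vol_multilinear)
      show "antisymmetric (\<lambda>v. wedge p q \<alpha> s v - form_inner V G p \<alpha> \<beta> * vol v)"
        by (intro antisymmetric_diff antisymmetric_wedge antisymmetric_mult vol_antisymmetric)
    qed (use zero True in simp_all)
    then show ?thesis by simp
  next
    case False
    have "\<alpha> (take p (permute_list \<sigma> v)) * s (drop p (permute_list \<sigma> v)) = 0"
      if "\<sigma> permutes {..<p + q}" "length v = p + q" for \<sigma>
    proof -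
      have "set (permute_list \<sigma> v) = set v" using that by (intro set_permute_list) simp
      moreover have "set (permute_list \<sigma> v) =
          set (take p (permute_list \<sigma> v)) \<union> set (drop p (permute_list \<sigma> v))"
        by (metis append_take_drop_id set_append)
      moreover have "\<not> set v \<subseteq> V" using False that pq by simp
      ultimately have "\<not> set (take p (permute_list \<sigma> v)) \<subseteq> V \<or> \<not> set (drop p (permute_list \<sigma> v)) \<subseteq> V"
        by blast
      then show ?thesis
        using alt_forms_outside[OF \<alpha>] alt_forms_outside[OF s_alt] by (metis mult_eq_0_iff)
    qed
    then have "wedge p q \<alpha> s v = 0"
      by (auto simp: wedge_def mult.assoc intro!: sum.neutral)
    then show ?thesis using vol_outside[OF False] by simp
  qed
  \<comment> \<open>Testing the difference \<open>\<gamma> - s\<close> against \<open>\<alpha>(u) = \<epsilon>(u, E\<^sub>b)\<close>, a multiple of the coframe product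
    complementary to \<open>b\<close>, extracts its value at \<open>E\<^sub>b\<close>.\<close>
  have unique: "\<gamma> = s" if \<gamma>: "\<gamma> \<in> alt_forms V q"
    and w: "\<And>\<alpha>. \<alpha> \<in> alt_forms V p \<Longrightarrow> wedge p q \<alpha> \<gamma> E = form_inner V G p \<alpha> \<beta> * vol E" for \<gamma>
  proof
    fix v
    let ?d = "\<lambda>v. \<gamma> v - s v"
    have d: "multilinear_on V ?d" "antisymmetric ?d"
      using \<gamma> s_alt unfolding alt_forms_iff[OF subspace_V]
      by (auto intro: multilinear_on_diff antisymmetric_diff)
    have zero: "?d (at_frame b) = 0" if b: "b \<in> index_lists n q" for b
    proof -
      let ?\<alpha> = "\<lambda>u. vol (u @ at_frame b)"
      have \<alpha>: "?\<alpha> \<in> alt_forms V p" by (rule vol_append_alt(2)[OF pq(2) b])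
      have sq: "((-1) ^ m * x) * ((-1) ^ m * y) = x * y" for m and x y :: real
        by (simp add: mult_ac power_mult_distrib[symmetric] power_add[symmetric] flip: mult_2)
      have sym: "vol (at_frame (a @ c)) * vol (at_frame (a @ b)) =
          vol (at_frame (b @ a)) * vol (at_frame (c @ a))"
        if "c \<in> index_lists n q" for a c
        using antisymmetric_append_commute[OF vol_antisymmetric, of "at_frame a" "at_frame c"]
          antisymmetric_append_commute[OF vol_antisymmetric, of "at_frame a" "at_frame b"] that b
        by (simp add: index_lists_def sq mult.commute)
      have "wedge p q ?\<alpha> \<gamma> E - wedge p q ?\<alpha> s E = 0"
        using w[OF \<alpha>] exists[OF \<alpha>] by simp
      then have "0 = (\<Sum>a\<in>index_lists n p. \<Sum>c\<in>index_lists n q.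
          vol (at_frame (a @ c)) * (vol (at_frame a @ at_frame b) * ?d (at_frame c)))"
        unfolding wedge_at_frame[OF pq(1)] right_diff_distrib[symmetric] sum_subtractf[symmetric]
        using vol_E by (auto simp: right_diff_distrib sum_subtractf)
      also have "\<dots> = (\<Sum>c\<in>index_lists n q. \<Sum>a\<in>index_lists n p.
          ?d (at_frame c) * (vol (at_frame (b @ a)) * vol (at_frame (c @ a))))"
        by (subst sum.swap, intro sum.cong refl) (use sym in \<open>simp add: mult_ac\<close>)
      also have "\<dots> = fact q * fact p * ?d (at_frame b)"
        by (rule vol_contraction[OF d(2) pq(2) b])
      finally show ?thesis by simp
    qed
    show "\<gamma> v = s v"
    proof (cases "length v = q \<and> set v \<subseteq> V")
      case True
      then show ?thesis using multilinear_eq_0[OF d(1) zero] by simp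
    next
      case False
      then show ?thesis using alt_forms_outside[OF \<gamma>] alt_forms_outside[OF s_alt] by simp
    qed
  qed
  have "hodge V G \<mu> p \<beta> = s"
    unfolding hodge_def n_def[symmetric] vol_def[symmetric] q_def[symmetric]
  proof (rule the_equality)
    show "s \<in> alt_forms V q \<and> (\<forall>\<alpha>\<in>alt_forms V p. wedge p q \<alpha> s = (\<lambda>v. form_inner V G p \<alpha> \<beta> * vol v))"
      using s_alt exists by auto
    show "\<gamma> = s" if "\<gamma> \<in> alt_forms V q \<and>
      (\<forall>\<alpha>\<in>alt_forms V p. wedge p q \<alpha> \<gamma> = (\<lambda>v. form_inner V G p \<alpha> \<beta> * vol v))" for \<gamma>
      using that by (intro unique) auto
  qed
  then show ?thesis unfolding s_def .
qed

end

section \<open>Powers of a double form against antisymmetric functions\<close>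

lemma antisymmetric_dwedge_left: "antisymmetric (\<lambda>v. dwedge p q \<Phi> \<Psi> v w)"
proof -
  let ?f = "\<lambda>u. \<Sum>\<tau> | \<tau> permutes {..<p + q}. of_int (sign \<tau>) *
    (\<Phi> (take p u) (take p (permute_list \<tau> w)) * \<Psi> (drop p u) (drop p (permute_list \<tau> w)))"
  let ?c = "if length w = p + q then 1 / ((fact p * fact q) * (fact p * fact q)) else 0"
  have "(\<lambda>v. dwedge p q \<Phi> \<Psi> v w) = (\<lambda>v. (if length v = p + q then
      \<Sum>\<sigma> | \<sigma> permutes {..<p + q}. of_int (sign \<sigma>) * ?f (permute_list \<sigma> v) else 0) * ?c)"
    by (simp add: fun_eq_iff dwedge_def sum_distrib_left mult.assoc)
  then show ?thesis
    using antisymmetric_mult(2)[OF antisymmetric_antisymmetrization[of "p + q" ?f], of ?c] by simp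
qed

lemma antisymmetric_dwedge_right: "antisymmetric (dwedge p q \<Phi> \<Psi> v)"
proof -
  have "dwedge p q \<Phi> \<Psi> v = (\<lambda>w. dwedge p q (\<lambda>x y. \<Phi> y x) (\<lambda>x y. \<Psi> y x) w v)"
    unfolding fun_eq_iff dwedge_def by (subst sum.swap) (simp add: mult_ac)
  then show ?thesis by (simp only: antisymmetric_dwedge_left)
qed

lemma antisymmetric_dpow:
  "antisymmetric (\<lambda>v. dpow p \<Phi> k v w)" "antisymmetric (dpow p \<Phi> k v)"
proof -
  have "antisymmetric (\<lambda>v. if v = [] \<and> w = [] then 1 else 0)"
    "antisymmetric (\<lambda>w. if v = [] \<and> w = [] then 1 else 0)"
    unfolding antisymmetric_def by simp_all
  then show "antisymmetric (\<lambda>v. dpow p \<Phi> k v w)" "antisymmetric (dpow p \<Phi> k v)"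
    by (cases k; simp add: antisymmetric_dwedge_left antisymmetric_dwedge_right)+
qed

text \<open>The product \<open>\<Phi>(a\<^sub>1 \<dots> a\<^sub>p; b\<^sub>1 \<dots> b\<^sub>p) \<Phi>(a\<^sub>p\<^sub>+\<^sub>1 \<dots>; b\<^sub>p\<^sub>+\<^sub>1 \<dots>) \<dots>\<close> of which the power of \<open>\<Phi>\<close> is the
skew-symmetrisation, up to a factor.\<close>

primrec block_product :: "nat \<Rightarrow> 'v double_form \<Rightarrow> nat \<Rightarrow> 'v double_form" where
  "block_product p \<Phi> 0 v w = 1"
| "block_product p \<Phi> (Suc k) v w =
    \<Phi> (take p v) (take p w) * block_product p \<Phi> k (drop p v) (drop p w)"

lemma sum_pull:
  "(\<Sum>y\<in>A. \<Sum>a\<in>B. \<Sum>z\<in>C. g y a z) = (\<Sum>z\<in>C. \<Sum>y\<in>A. \<Sum>a\<in>B. g y a z)"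
proof -
  have "(\<Sum>y\<in>A. \<Sum>a\<in>B. \<Sum>z\<in>C. g y a z) = (\<Sum>y\<in>A. \<Sum>z\<in>C. \<Sum>a\<in>B. g y a z)"
    by (intro sum.cong refl sum.swap)
  also have "\<dots> = (\<Sum>z\<in>C. \<Sum>y\<in>A. \<Sum>a\<in>B. g y a z)"
    by (rule sum.swap)
  finally show ?thesis .
qed

text \<open>Every pair of permutations in the double wedge product contributes the same amount, because its sign is
absorbed by \<open>F\<close> and \<open>H\<close> and the sum over index lists is invariant.\<close>

lemma sum_dwedge_antisymmetric:
  fixes F H :: "nat list \<Rightarrow> real" and f :: "nat \<Rightarrow> 'v"
  assumes F: "antisymmetric F" and H: "antisymmetric H"
  shows "(\<Sum>a\<in>index_lists n (p + q). \<Sum>b\<in>index_lists n (p + q).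
      dwedge p q \<Phi> \<Psi> (map f a) (map f b) * (F a * H b)) =
    (fact (p + q) / (fact p * fact q)) ^ 2 *
    (\<Sum>a\<in>index_lists n (p + q). \<Sum>b\<in>index_lists n (p + q).
      \<Phi> (map f (take p a)) (map f (take p b)) * \<Psi> (map f (drop p a)) (map f (drop p b)) * (F a * H b))"
proof -
  let ?m = "p + q" and ?c = "((fact p * fact q) * (fact p * fact q)) :: real"
  let ?L = "index_lists n ?m" and ?P = "{\<sigma>. \<sigma> permutes {..<?m}}"
  define X where "X a b = \<Phi> (map f (take p a)) (map f (take p b)) *
    \<Psi> (map f (drop p a)) (map f (drop p b)) * (F a * H b)" for a b
  have "dwedge p q \<Phi> \<Psi> (map f a) (map f b) * (F a * H b) =
      (\<Sum>\<sigma>\<in>?P. \<Sum>\<tau>\<in>?P. X (permute_list \<sigma> a) (permute_list \<tau> b)) / ?c"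
    if ab: "a \<in> ?L" "b \<in> ?L" for a b
  proof -
    have len: "length a = ?m" "length b = ?m" using ab by (simp_all add: index_lists_def)
    have "of_int (sign \<sigma>) * of_int (sign \<tau>) *
          \<Phi> (take p (permute_list \<sigma> (map f a))) (take p (permute_list \<tau> (map f b))) *
          \<Psi> (drop p (permute_list \<sigma> (map f a))) (drop p (permute_list \<tau> (map f b))) * (F a * H b) =
        X (permute_list \<sigma> a) (permute_list \<tau> b)"
      if "\<sigma> \<in> ?P" "\<tau> \<in> ?P" for \<sigma> \<tau>
      using antisymmetric_permute[OF F, of \<sigma> a] antisymmetric_permute[OF H, of \<tau> b] that len
      by (simp add: X_def permute_list_map take_map drop_map)
    then have "(\<Sum>\<sigma>\<in>?P. \<Sum>\<tau>\<in>?P. of_int (sign \<sigma>) * of_int (sign \<tau>) *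
          \<Phi> (take p (permute_list \<sigma> (map f a))) (take p (permute_list \<tau> (map f b))) *
          \<Psi> (drop p (permute_list \<sigma> (map f a))) (drop p (permute_list \<tau> (map f b)))) * (F a * H b) =
        (\<Sum>\<sigma>\<in>?P. \<Sum>\<tau>\<in>?P. X (permute_list \<sigma> a) (permute_list \<tau> b))"
      by (simp only: sum_distrib_right cong: sum.cong)
    then show ?thesis
      using len unfolding dwedge_def by (simp only: length_map if_True simp_thms times_divide_eq_left)
  qed
  then have "(\<Sum>a\<in>?L. \<Sum>b\<in>?L. dwedge p q \<Phi> \<Psi> (map f a) (map f b) * (F a * H b)) =
      (\<Sum>a\<in>?L. \<Sum>b\<in>?L. \<Sum>\<sigma>\<in>?P. \<Sum>\<tau>\<in>?P. X (permute_list \<sigma> a) (permute_list \<tau> b)) / ?c"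
    by (simp only: sum_divide_distrib cong: sum.cong)
  also have "(\<Sum>a\<in>?L. \<Sum>b\<in>?L. \<Sum>\<sigma>\<in>?P. \<Sum>\<tau>\<in>?P. X (permute_list \<sigma> a) (permute_list \<tau> b)) =
      (\<Sum>\<sigma>\<in>?P. \<Sum>\<tau>\<in>?P. \<Sum>a\<in>?L. \<Sum>b\<in>?L. X (permute_list \<sigma> a) (permute_list \<tau> b))"
    by (rule trans[OF sum_pull]) (intro sum.cong refl sum_pull)
  also have "\<dots> = (\<Sum>\<sigma>\<in>?P. \<Sum>\<tau>\<in>?P. \<Sum>a\<in>?L. \<Sum>b\<in>?L. X a b)"
  proof (rule sum.cong[OF refl], rule sum.cong[OF refl])
    fix \<sigma> \<tau> assume s: "\<sigma> \<in> ?P" "\<tau> \<in> ?P"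
    have "(\<Sum>a\<in>?L. \<Sum>b\<in>?L. X (permute_list \<sigma> a) (permute_list \<tau> b)) =
        (\<Sum>a\<in>?L. \<Sum>b\<in>?L. X (permute_list \<sigma> a) b)"
      using s by (intro sum.cong refl sum_index_lists_permute) simp
    also have "\<dots> = (\<Sum>a\<in>?L. \<Sum>b\<in>?L. X a b)"
      using s sum_index_lists_permute[of \<sigma> ?m "\<lambda>a. \<Sum>b\<in>?L. X a b" n] by simp
    finally show "(\<Sum>a\<in>?L. \<Sum>b\<in>?L. X (permute_list \<sigma> a) (permute_list \<tau> b)) =
        (\<Sum>a\<in>?L. \<Sum>b\<in>?L. X a b)" .
  qed
  also have "\<dots> = fact ?m * (fact ?m * (\<Sum>a\<in>?L. \<Sum>b\<in>?L. X a b))"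
    using card_permutations[of "{..<?m}" ?m] by simp
  finally show ?thesis
    by (simp add: X_def power2_eq_square)
qed

text \<open>Contracted with antisymmetric functions, the power of \<open>\<Phi>\<close> may be replaced by the plain product of copies of
\<open>\<Phi>\<close>. Only the independence of \<open>C\<close> from \<open>F\<close> and \<open>H\<close> matters; \<open>C\<close> is \<open>((pk)! / (p!)\<^sup>k)\<^sup>2\<close>.\<close>

lemma sum_dpow_antisymmetric:
  fixes f :: "nat \<Rightarrow> 'v"
  obtains C where "\<And>F H. antisymmetric F \<Longrightarrow> antisymmetric H \<Longrightarrow>
    (\<Sum>a\<in>index_lists n (p * k). \<Sum>b\<in>index_lists n (p * k).
      dpow p \<Phi> k (map f a) (map f b) * (F a * H b)) =
    C * (\<Sum>a\<in>index_lists n (p * k). \<Sum>b\<in>index_lists n (p * k).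
      block_product p \<Phi> k (map f a) (map f b) * (F a * H b))"
proof -
  have "\<exists>C. \<forall>F H. antisymmetric F \<longrightarrow> antisymmetric H \<longrightarrow>
    (\<Sum>a\<in>index_lists n (p * k). \<Sum>b\<in>index_lists n (p * k).
      dpow p \<Phi> k (map f a) (map f b) * (F a * H b)) =
    C * (\<Sum>a\<in>index_lists n (p * k). \<Sum>b\<in>index_lists n (p * k).
      block_product p \<Phi> k (map f a) (map f b) * (F a * H b))"
  proof (induction k)
    case 0
    show ?case by (intro exI[of _ 1]) simp
  next
    case (Suc k)
    then obtain C where C: "\<And>F H. antisymmetric F \<Longrightarrow> antisymmetric H \<Longrightarrow>
      (\<Sum>a\<in>index_lists n (p * k). \<Sum>b\<in>index_lists n (p * k).
        dpow p \<Phi> k (map f a) (map f b) * (F a * H b)) =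
      C * (\<Sum>a\<in>index_lists n (p * k). \<Sum>b\<in>index_lists n (p * k).
        block_product p \<Phi> k (map f a) (map f b) * (F a * H b))"
      by blast
    let ?q = "p * k"
    let ?L = "index_lists n (p + ?q)" and ?A = "index_lists n p" and ?B = "index_lists n ?q"
    have split: "(\<Sum>a\<in>?L. \<Sum>b\<in>?L. \<Phi> (map f (take p a)) (map f (take p b)) *
          \<Psi> (map f (drop p a)) (map f (drop p b)) * (F a * H b)) =
        (\<Sum>a\<in>?A. \<Sum>b\<in>?A. \<Phi> (map f a) (map f b) *
          (\<Sum>a'\<in>?B. \<Sum>b'\<in>?B. \<Psi> (map f a') (map f b') * (F (a @ a') * H (b @ b'))))"
      for \<Psi> and F H :: "nat list \<Rightarrow> real"
    proof -
      have "(\<Sum>a\<in>?L. \<Sum>b\<in>?L. \<Phi> (map f (take p a)) (map f (take p b)) *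
            \<Psi> (map f (drop p a)) (map f (drop p b)) * (F a * H b)) =
          (\<Sum>a\<in>?A. \<Sum>a'\<in>?B. \<Sum>b\<in>?A. \<Sum>b'\<in>?B. \<Phi> (map f a) (map f b) *
            (\<Psi> (map f a') (map f b') * (F (a @ a') * H (b @ b'))))"
        unfolding sum_index_lists_append
        by (intro sum.cong refl) (simp add: index_lists_def)
      also have "\<dots> = (\<Sum>a\<in>?A. \<Sum>b\<in>?A. \<Sum>a'\<in>?B. \<Sum>b'\<in>?B. \<Phi> (map f a) (map f b) *
            (\<Psi> (map f a') (map f b') * (F (a @ a') * H (b @ b'))))"
        by (intro sum.cong refl sum.swap)
      finally show ?thesis by (simp only: sum_distrib_left)
    qed
    show ?case
    proof (intro exI allI impI)
      fix F H :: "nat list \<Rightarrow> real"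
      assume FH: "antisymmetric F" "antisymmetric H"
      let ?c = "(fact (p + ?q) / (fact p * fact ?q)) ^ 2"
      have block: "block_product p \<Phi> (Suc k) (map f a) (map f b) = \<Phi> (map f (take p a)) (map f (take p b)) *
          block_product p \<Phi> k (map f (drop p a)) (map f (drop p b))" for a b
        by (simp add: take_map drop_map)
      have IH: "(\<Sum>a'\<in>?B. \<Sum>b'\<in>?B. dpow p \<Phi> k (map f a') (map f b') * (F (a @ a') * H (b @ b'))) =
          C * (\<Sum>a'\<in>?B. \<Sum>b'\<in>?B. block_product p \<Phi> k (map f a') (map f b') * (F (a @ a') * H (b @ b')))" for a b
        by (rule C) (intro antisymmetric_append_left FH)+
      have "(\<Sum>a\<in>?L. \<Sum>b\<in>?L. dpow p \<Phi> (Suc k) (map f a) (map f b) * (F a * H b)) =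
          ?c * (\<Sum>a\<in>?A. \<Sum>b\<in>?A. \<Phi> (map f a) (map f b) *
            (C * (\<Sum>a'\<in>?B. \<Sum>b'\<in>?B. block_product p \<Phi> k (map f a') (map f b') * (F (a @ a') * H (b @ b')))))"
        unfolding dpow.simps sum_dwedge_antisymmetric[OF FH] split IH ..
      also have "\<dots> = (?c * C) * (\<Sum>a\<in>?L. \<Sum>b\<in>?L. block_product p \<Phi> (Suc k) (map f a) (map f b) * (F a * H b))"
        unfolding block split by (simp only: sum_distrib_left mult_ac)
      finally show "(\<Sum>a\<in>index_lists n (p * Suc k). \<Sum>b\<in>index_lists n (p * Suc k).
            dpow p \<Phi> (Suc k) (map f a) (map f b) * (F a * H b)) =
          (?c * C) * (\<Sum>a\<in>index_lists n (p * Suc k). \<Sum>b\<in>index_lists n (p * Suc k).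
            block_product p \<Phi> (Suc k) (map f a) (map f b) * (F a * H b))"
        unfolding mult_Suc_right .
    qed
  qed
  then show ?thesis using that by blast
qed

section \<open>Contractions with the Bianchi identity\<close>

lemma sum_cyclic_eq_0:
  fixes t :: "'a \<Rightarrow> 'a \<Rightarrow> 'a \<Rightarrow> real"
  assumes "\<And>x y z. x \<in> A \<Longrightarrow> y \<in> A \<Longrightarrow> z \<in> A \<Longrightarrow> t x y z + t y z x + t z x y = 0"
  shows "(\<Sum>x\<in>A. \<Sum>y\<in>A. \<Sum>z\<in>A. t x y z) = 0"
proof -
  let ?S = "\<lambda>t. \<Sum>x\<in>A. \<Sum>y\<in>A. \<Sum>z\<in>A. t x y z"
  have rot: "?S (\<lambda>x y z. t y z x) = ?S t" for t :: "'a \<Rightarrow> 'a \<Rightarrow> 'a \<Rightarrow> real"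
    using sum_pull[of "\<lambda>y z x. t y z x" A A A] by simp
  have "?S t + ?S (\<lambda>x y z. t y z x) + ?S (\<lambda>x y z. t z x y) = 0"
    unfolding sum.distrib[symmetric] using assms by (intro sum.neutral ballI)
  moreover have "?S (\<lambda>x y z. t z x y) = ?S t"
    using rot[of "\<lambda>x y z. t y z x"] rot[of t] by simp
  ultimately show ?thesis using rot[of t] by simp
qed

text \<open>A 3-cycle is an even permutation, wherever the three entries stand.\<close>

lemma antisymmetric_rotate3:
  assumes "antisymmetric H"
  shows "H (z # w # b @ [x]) = H (w # x # b @ [z])"
proof -
  have move: "H (u # v # y # b) = (-1) ^ length b * H (u # v # b @ [y])" for u v y
    using antisymmetric_move[OF assms, of "[u, v]" y b "[]"] by simp
  have "H (w # x # z # b) = H (z # w # x # b)"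
    using antisymmetricD[OF assms, of "[w]" x z b] antisymmetricD[OF assms, of "[]" w z "x # b"] by simp
  then show ?thesis unfolding move by simp
qed

text \<open>The summand contains \<open>a ! j\<close> twice: in one factor \<open>\<Phi>\<close> of the product and as the last argument of \<open>H\<close>.
If it sits in the first factor, whose other indices are \<open>z\<close> and \<open>w\<close> on the right, then \<open>H\<close> is invariant under
cyclic permutation of \<open>a ! j, z, w\<close>, and the cyclic sum of \<open>\<Phi>\<close> is zero; \<open>j = 0\<close> and \<open>j = 1\<close> need the two
forms of the Bianchi identity. The factor with \<open>F\<close> does not see the rotating indices. Otherwise the first
factor is split off and the induction hypothesis applies to the remaining ones.\<close>

lemma bianchi_contraction:
  fixes f :: "nat \<Rightarrow> 'v" and H :: "nat list \<Rightarrow> real"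
  assumes bianchi_left: "\<And>x y z w. x \<in> f ` {..<n} \<Longrightarrow> y \<in> f ` {..<n} \<Longrightarrow> z \<in> f ` {..<n} \<Longrightarrow> w \<in> f ` {..<n} \<Longrightarrow>
      \<Phi> [x, y] [z, w] + \<Phi> [z, y] [w, x] + \<Phi> [w, y] [x, z] = 0"
    and bianchi_right: "\<And>x y z w. x \<in> f ` {..<n} \<Longrightarrow> y \<in> f ` {..<n} \<Longrightarrow> z \<in> f ` {..<n} \<Longrightarrow> w \<in> f ` {..<n} \<Longrightarrow>
      \<Phi> [x, y] [z, w] + \<Phi> [x, z] [w, y] + \<Phi> [x, w] [y, z] = 0"
    and H: "antisymmetric H" and j: "j < 2 * k"
  shows "(\<Sum>a\<in>index_lists n (2 * k). \<Sum>b\<in>index_lists n (2 * k).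
    block_product 2 \<Phi> k (map f a) (map f b) * (F (take j a @ drop (Suc j) a) * H (b @ [a ! j]))) = 0"
  using H j
proof (induction k arbitrary: j F H)
  case (Suc k)
  let ?L = "index_lists n (2 * k)" and ?B = "block_product 2 \<Phi> k"
  define T where "T x y a z w b = \<Phi> [f x, f y] [f z, f w] * (?B (map f a) (map f b) *
    (F (take j (x # y # a) @ drop (Suc j) (x # y # a)) * H (z # w # b @ [(x # y # a) ! j])))"
    for x y a z w b
  have "(\<Sum>a\<in>index_lists n (2 * Suc k). \<Sum>b\<in>index_lists n (2 * Suc k).
      block_product 2 \<Phi> (Suc k) (map f a) (map f b) * (F (take j a @ drop (Suc j) a) * H (b @ [a ! j]))) =
    (\<Sum>x<n. \<Sum>y<n. \<Sum>a\<in>?L. \<Sum>z<n. \<Sum>w<n. \<Sum>b\<in>?L. T x y a z w b)"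
    by (simp add: sum_index_lists_Suc T_def numeral_2_eq_2 mult.assoc)
  also have "\<dots> = (\<Sum>x<n. \<Sum>y<n. \<Sum>z<n. \<Sum>w<n. \<Sum>a\<in>?L. \<Sum>b\<in>?L. T x y a z w b)"
  proof (rule sum.cong[OF refl], rule sum.cong[OF refl])
    fix x y
    have "(\<Sum>a\<in>?L. \<Sum>z<n. \<Sum>w<n. \<Sum>b\<in>?L. T x y a z w b) = (\<Sum>z<n. \<Sum>a\<in>?L. \<Sum>w<n. \<Sum>b\<in>?L. T x y a z w b)"
      by (rule sum.swap)
    also have "\<dots> = (\<Sum>z<n. \<Sum>w<n. \<Sum>a\<in>?L. \<Sum>b\<in>?L. T x y a z w b)"
      by (intro sum.cong refl sum.swap)
    finally show "(\<Sum>a\<in>?L. \<Sum>z<n. \<Sum>w<n. \<Sum>b\<in>?L. T x y a z w b) = \<dots>" .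
  qed
  also have "\<dots> = 0"
  proof -
    consider "j = 0" | "j = 1" | i where "j = Suc (Suc i)" "i < 2 * k"
      using Suc.prems(2) by (metis One_nat_def Suc_less_eq add_2_eq_Suc mult_Suc_right not0_implies_Suc)
    then show ?thesis
    proof cases
      case 1
      have "(\<Sum>x<n. \<Sum>z<n. \<Sum>w<n. \<Sum>a\<in>?L. \<Sum>b\<in>?L. T x y a z w b) = 0" if y: "y < n" for y
      proof (rule sum_cyclic_eq_0)
        fix x z w assume xzw: "x \<in> {..<n}" "z \<in> {..<n}" "w \<in> {..<n}"
        have "T x y a z w b + T z y a w x b + T w y a x z b = 0" for a b
        proof -
          have "H (w # x # b @ [z]) = H (z # w # b @ [x])" "H (x # z # b @ [w]) = H (z # w # b @ [x])"
            using antisymmetric_rotate3[OF Suc.prems(1)] by metis+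
          then have "T x y a z w b + T z y a w x b + T w y a x z b =
              (\<Phi> [f x, f y] [f z, f w] + \<Phi> [f z, f y] [f w, f x] + \<Phi> [f w, f y] [f x, f z]) *
              (?B (map f a) (map f b) * (F (y # a) * H (z # w # b @ [x])))"
            using 1 by (simp add: T_def algebra_simps)
          then show ?thesis using bianchi_left y xzw by simp
        qed
        then show "(\<Sum>a\<in>?L. \<Sum>b\<in>?L. T x y a z w b) + (\<Sum>a\<in>?L. \<Sum>b\<in>?L. T z y a w x b) +
            (\<Sum>a\<in>?L. \<Sum>b\<in>?L. T w y a x z b) = 0"
          unfolding sum.distrib[symmetric] by simp
      qed
      then show ?thesis by (subst sum.swap) simp
    next
      case 2
      have "(\<Sum>y<n. \<Sum>z<n. \<Sum>w<n. \<Sum>a\<in>?L. \<Sum>b\<in>?L. T x y a z w b) = 0" if x: "x < n" for x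
      proof (rule sum_cyclic_eq_0)
        fix y z w assume yzw: "y \<in> {..<n}" "z \<in> {..<n}" "w \<in> {..<n}"
        have "T x y a z w b + T x z a w y b + T x w a y z b = 0" for a b
        proof -
          have "H (w # y # b @ [z]) = H (z # w # b @ [y])" "H (y # z # b @ [w]) = H (z # w # b @ [y])"
            using antisymmetric_rotate3[OF Suc.prems(1)] by metis+
          then have "T x y a z w b + T x z a w y b + T x w a y z b =
              (\<Phi> [f x, f y] [f z, f w] + \<Phi> [f x, f z] [f w, f y] + \<Phi> [f x, f w] [f y, f z]) *
              (?B (map f a) (map f b) * (F (x # a) * H (z # w # b @ [y])))"
            using 2 by (simp add: T_def algebra_simps)
          then show ?thesis using bianchi_right x yzw by simp
        qed
        then show "(\<Sum>a\<in>?L. \<Sum>b\<in>?L. T x y a z w b) + (\<Sum>a\<in>?L. \<Sum>b\<in>?L. T x z a w y b) +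
            (\<Sum>a\<in>?L. \<Sum>b\<in>?L. T x w a y z b) = 0"
          unfolding sum.distrib[symmetric] by simp
      qed
      then show ?thesis by simp
    next
      case 3
      have "(\<Sum>a\<in>?L. \<Sum>b\<in>?L. T x y a z w b) = 0" for x y z w
      proof -
        have "(\<Sum>a\<in>?L. \<Sum>b\<in>?L. T x y a z w b) = \<Phi> [f x, f y] [f z, f w] *
            (\<Sum>a\<in>?L. \<Sum>b\<in>?L. ?B (map f a) (map f b) *
              ((\<lambda>c. F (x # y # c)) (take i a @ drop (Suc i) a) * (\<lambda>c. H (z # w # c)) (b @ [a ! i])))"
          unfolding T_def 3 by (simp add: sum_distrib_left)
        also have "\<dots> = 0"
          using Suc.IH[of "\<lambda>c. H (z # w # c)" i "\<lambda>c. F (x # y # c)"] 3(2)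
          by (simp add: antisymmetric_Cons[OF antisymmetric_Cons[OF Suc.prems(1)]])
        finally show ?thesis .
      qed
      then show ?thesis by simp
    qed
  qed
  finally show ?case .
qed simp

section \<open>Alternating sums with one deleted entry\<close>

text \<open>The sum \<open>\<Sum>\<^sub>j (-1)\<^sup>j f(u\<^sub>j, u without u\<^sub>j)\<close>, which is the form of the Bianchi sum. The recursion, rather than
this closed form (\<open>deletion_sum_eq\<close>), lets the properties below be proved by induction on lists.\<close>

fun deletion_sum :: "('a \<Rightarrow> 'a list \<Rightarrow> real) \<Rightarrow> 'a list \<Rightarrow> real" where
  "deletion_sum f [] = 0"
| "deletion_sum f (x # u) = f x u - deletion_sum (\<lambda>y t. f y (x # t)) u"

lemma deletion_sum_eq:
  "deletion_sum f u = (\<Sum>j<length u. (-1) ^ j * f (u ! j) (take j u @ drop (Suc j) u))"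
proof (induction u arbitrary: f)
  case (Cons x u)
  show ?case
    by (simp add: Cons sum.lessThan_Suc_shift sum_negf del: sum.lessThan_Suc)
qed simp

lemma deletion_sum_cong:
  assumes "\<And>y t. y \<in> set u \<Longrightarrow> set t \<subseteq> set u \<Longrightarrow> f y t = g y t"
  shows "deletion_sum f u = deletion_sum g u"
  unfolding deletion_sum_eq
  by (intro sum.cong refl) (auto intro!: assms dest: in_set_takeD in_set_dropD)

lemma deletion_sum_linear:
  "deletion_sum (\<lambda>y t. a * f y t + b * g y t) u = a * deletion_sum f u + b * deletion_sum g u"
  by (simp add: deletion_sum_eq sum.distrib sum_distrib_left algebra_simps)

lemma deletion_sum_sum:
  "deletion_sum (\<lambda>y t. \<Sum>i\<in>S. c i * f i y t) u = (\<Sum>i\<in>S. c i * deletion_sum (f i) u)"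
  unfolding deletion_sum_eq sum_distrib_left by (subst sum.swap) (simp add: mult_ac)

text \<open>Cutting a list in two separates the deletions in its two parts; it is the step that moves the sum from
the vectors \<open>v\<close> to the frame vectors.\<close>

lemma deletion_sum_append:
  "deletion_sum f (us @ v) =
    deletion_sum (\<lambda>y t. f y (t @ v)) us + (-1) ^ length us * deletion_sum (\<lambda>y t. f y (us @ t)) v"
  by (induction us arbitrary: f) (simp_all add: algebra_simps)

text \<open>Up to a factor this is the wedge product of the linear form \<open>l\<close> with \<open>\<omega>\<close>, so it is alternating. For adjacent
entries \<open>x, y\<close> at the front the deletions of \<open>x\<close> and of \<open>y\<close> are exchanged, and in all others \<open>\<omega>\<close> changes
sign.\<close>

lemma antisymmetric_deletion_sum:
  assumes "antisymmetric \<omega>"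
  shows "antisymmetric (deletion_sum (\<lambda>y t. l y * \<omega> t))"
  unfolding antisymmetric_def
proof (intro allI)
  fix xs x y ys
  show "deletion_sum (\<lambda>y t. l y * \<omega> t) (xs @ x # y # ys) =
      - deletion_sum (\<lambda>y t. l y * \<omega> t) (xs @ y # x # ys)"
    using assms
  proof (induction xs arbitrary: \<omega>)
    case Nil
    have "(\<lambda>z t. l z * \<omega> (x # y # t)) = (\<lambda>z t. (-1) * (l z * \<omega> (y # x # t)) + 0 * 0)"
      using antisymmetricD[OF Nil, of "[]" x y] by simp
    then have "deletion_sum (\<lambda>z t. l z * \<omega> (x # y # t)) ys = - deletion_sum (\<lambda>z t. l z * \<omega> (y # x # t)) ys"
      using deletion_sum_linear[of "-1" "\<lambda>z t. l z * \<omega> (y # x # t)" 0 "\<lambda>_ _. 0" ys] by simp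
    then show ?case by simp
  next
    case (Cons z xs)
    show ?case
      using Cons.IH[OF antisymmetric_Cons[OF Cons.prems]] antisymmetricD[OF Cons.prems, of xs x y ys]
      by simp
  qed
qed

lemma multilinear_on_deletion_sum:
  assumes "multilinear_on V \<omega>"
    and l: "\<And>u w a b. u \<in> V \<Longrightarrow> w \<in> V \<Longrightarrow> l (a *\<^sub>R u + b *\<^sub>R w) = a * l u + b * l w"
  shows "multilinear_on V (deletion_sum (\<lambda>y t. l y * \<omega> t))"
  unfolding multilinear_on_def
proof (intro allI impI)
  fix xs ys u w a b
  assume "set xs \<subseteq> V \<and> set ys \<subseteq> V \<and> u \<in> V \<and> w \<in> V"
  then show "deletion_sum (\<lambda>y t. l y * \<omega> t) (xs @ (a *\<^sub>R u + b *\<^sub>R w) # ys) =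
      a * deletion_sum (\<lambda>y t. l y * \<omega> t) (xs @ u # ys) + b * deletion_sum (\<lambda>y t. l y * \<omega> t) (xs @ w # ys)"
    using assms(1)
  proof (induction xs arbitrary: \<omega>)
    case Nil
    let ?D = "\<lambda>z. deletion_sum (\<lambda>y t. l y * \<omega> (z # t)) ys"
    have "?D (a *\<^sub>R u + b *\<^sub>R w) =
        deletion_sum (\<lambda>y t. a * (l y * \<omega> (u # t)) + b * (l y * \<omega> (w # t))) ys"
    proof (rule deletion_sum_cong)
      fix y t assume "set t \<subseteq> set ys"
      then show "l y * \<omega> ((a *\<^sub>R u + b *\<^sub>R w) # t) = a * (l y * \<omega> (u # t)) + b * (l y * \<omega> (w # t))"
        using multilinear_onD[OF Nil(2), of "[]" t u w a b] Nil(1) by (auto simp: algebra_simps)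
    qed
    also have "\<dots> = a * ?D u + b * ?D w"
      by (rule deletion_sum_linear)
    finally show ?case using l Nil(1) by (simp add: algebra_simps)
  next
    case (Cons z xs)
    have "multilinear_on V (\<lambda>v. \<omega> (z # v))"
      using Cons.prems by (intro multilinear_on_Cons) auto
    then show ?case
      using Cons.IH[of "\<lambda>v. \<omega> (z # v)"] Cons.prems multilinear_onD[OF Cons.prems(2), of xs ys u w a b]
      by (simp add: algebra_simps)
  qed
qed

section \<open>The star of a power of a Bianchi form\<close>

context oriented_inner_product_on
begin

lemma dhodge_eq:
  assumes "\<And>w. antisymmetric (\<lambda>v. \<Psi> v w)" "\<And>v. antisymmetric (\<Psi> v)" "p \<le> n"
  shows "dhodge V G \<mu> p \<Psi> v w = (\<Sum>a\<in>index_lists n p. \<Sum>b\<in>index_lists n p.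
    \<Psi> (at_frame a) (at_frame b) * (vol (at_frame a @ v) * vol (at_frame b @ w))) / (fact p) ^ 2"
proof -
  have "antisymmetric (\<lambda>v'. (\<Sum>b\<in>index_lists n p. \<Psi> v' (at_frame b) * vol (at_frame b @ w)) / fact p)"
    unfolding divide_inverse by (intro antisymmetric_mult antisymmetric_sum assms)
  then show ?thesis
    unfolding dhodge_def hodge_eq[OF assms(2,3)]
    by (simp add: hodge_eq[OF _ assms(3)] sum_distrib_left sum_distrib_right sum_divide_distrib power2_eq_square mult_ac)
qed

text \<open>The alternating \<open>(n+1)\<close>-form \<open>l \<and> \<epsilon>\<close> is zero. Its value on \<open>E\<^sub>a, u\<close>, split at the end of \<open>E\<^sub>a\<close>, is the
asserted relation between deletions from \<open>u\<close> and deletions from \<open>a\<close>.\<close>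

lemma cramer_identity:
  assumes l: "\<And>u w a b. u \<in> V \<Longrightarrow> w \<in> V \<Longrightarrow> l (a *\<^sub>R u + b *\<^sub>R w) = a * l u + b * l w"
    and a: "a \<in> index_lists n m" and u: "set u \<subseteq> V" "m + length u = Suc n"
  shows "(-1) ^ m * deletion_sum (\<lambda>y t. l y * vol (at_frame a @ t)) u =
    - (\<Sum>j<m. (-1) ^ j * (l (E ! (a ! j)) * vol (at_frame (take j a @ drop (Suc j) a) @ u)))"
proof -
  obtain B where B: "finite B" "span B = V" using finite_dimensional by blast
  have len: "length a = m" using a by (simp add: index_lists_def)
  have "deletion_sum (\<lambda>y t. l y * vol t) (at_frame a @ u) = 0"
    using at_frame_in_V[OF a] u len B
    by (intro alternating_eq_0_above_dim[of B] multilinear_on_deletion_sum antisymmetric_deletion_sum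
        vol_multilinear vol_antisymmetric l) (auto simp: n_def)
  moreover have "deletion_sum (\<lambda>y t. l y * vol (t @ u)) (at_frame a) =
      (\<Sum>j<m. (-1) ^ j * (l (E ! (a ! j)) * vol (at_frame (take j a @ drop (Suc j) a) @ u)))"
    unfolding deletion_sum_eq
    by (intro sum.cong) (simp_all add: len at_frame_def take_map drop_map)
  ultimately show ?thesis
    unfolding deletion_sum_append by (simp add: len)
qed

text \<open>The two assumptions on \<open>\<Phi>\<close> are cyclic identities that hold the second, respectively the first, argument of
the left pair fixed while the other three rotate. After \<open>cramer_identity\<close> the rotating argument of the left
pair is the one at position \<open>j\<close>, of either parity.\<close>

theorem star_power_bianchi:
  assumes bianchi_left: "\<And>x y z w. x \<in> V \<Longrightarrow> y \<in> V \<Longrightarrow> z \<in> V \<Longrightarrow> w \<in> V \<Longrightarrow>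
      \<Phi> [x, y] [z, w] + \<Phi> [z, y] [w, x] + \<Phi> [w, y] [x, z] = 0"
    and bianchi_right: "\<And>x y z w. x \<in> V \<Longrightarrow> y \<in> V \<Longrightarrow> z \<in> V \<Longrightarrow> w \<in> V \<Longrightarrow>
      \<Phi> [x, y] [z, w] + \<Phi> [x, z] [w, y] + \<Phi> [x, w] [y, z] = 0"
    and k: "2 * k \<le> n"
    and u: "length u = Suc (n - 2 * k)" "set u \<subseteq> V" and w: "set w \<subseteq> V"
  shows "deletion_sum (\<lambda>y t. dhodge V G \<mu> (2 * k) (dpow 2 \<Phi> k) t (y # w)) u = 0"
proof -
  let ?L = "index_lists n (2 * k)"
  let ?P = "\<lambda>a b. block_product 2 \<Phi> k (at_frame a) (at_frame b)"
  let ?del = "\<lambda>j a. take j a @ drop (Suc j) a"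
  obtain C where C: "\<And>F H. antisymmetric F \<Longrightarrow> antisymmetric H \<Longrightarrow>
    (\<Sum>a\<in>?L. \<Sum>b\<in>?L. dpow 2 \<Phi> k (at_frame a) (at_frame b) * (F a * H b)) =
    C * (\<Sum>a\<in>?L. \<Sum>b\<in>?L. ?P a b * (F a * H b))"
    using sum_dpow_antisymmetric[where n = n and p = 2 and k = k and \<Phi> = \<Phi> and f = "(!) E"] unfolding at_frame_def by blast
  define c where "c = C / (fact (2 * k)) ^ 2"
  have star: "dhodge V G \<mu> (2 * k) (dpow 2 \<Phi> k) t s =
      (\<Sum>a\<in>?L. c * (\<Sum>b\<in>?L. ?P a b * (vol (at_frame b @ s) * vol (at_frame a @ t))))"
    for t s
  proof -
    have "antisymmetric (\<lambda>a. vol (at_frame a @ v))" for v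
      by (intro antisymmetric_at_frame[of "\<lambda>x. vol (x @ v)"] antisymmetric_append_right vol_antisymmetric)
    from C[OF this this] show ?thesis
      unfolding dhodge_eq[OF antisymmetric_dpow k]
      by (simp add: c_def sum_distrib_left sum_divide_distrib mult_ac)
  qed
  have "deletion_sum (\<lambda>y t. dhodge V G \<mu> (2 * k) (dpow 2 \<Phi> k) t (y # w)) u =
      c * (\<Sum>a\<in>?L. \<Sum>b\<in>?L. ?P a b *
        deletion_sum (\<lambda>y t. vol (at_frame b @ y # w) * vol (at_frame a @ t)) u)"
    unfolding star deletion_sum_sum by (simp only: sum_distrib_left)
  also have "\<dots> = c * (\<Sum>a\<in>?L. \<Sum>b\<in>?L. ?P a b *
        - (\<Sum>j<2 * k. (-1) ^ j * (vol (at_frame b @ E ! (a ! j) # w) * vol (at_frame (?del j a) @ u))))"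
  proof (intro arg_cong[where f = "(*) c"] sum.cong refl arg_cong2[where f = "(*)"])
    fix a b assume a: "a \<in> ?L" and b: "b \<in> ?L"
    have "vol (at_frame b @ (s *\<^sub>R y + t *\<^sub>R z) # w) =
        s * vol (at_frame b @ y # w) + t * vol (at_frame b @ z # w)" if "y \<in> V" "z \<in> V" for y z s t
      using at_frame_in_V[OF b] w that by (intro multilinear_onD[OF vol_multilinear])
    from cramer_identity[of "\<lambda>y. vol (at_frame b @ y # w)", OF this a] u k
    show "deletion_sum (\<lambda>y t. vol (at_frame b @ y # w) * vol (at_frame a @ t)) u =
        - (\<Sum>j<2 * k. (-1) ^ j * (vol (at_frame b @ E ! (a ! j) # w) * vol (at_frame (?del j a) @ u)))"
      by simp
  qed
  also have "\<dots> = - c * (\<Sum>j<2 * k. (-1) ^ j * (\<Sum>a\<in>?L. \<Sum>b\<in>?L.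
      ?P a b * (vol (at_frame (?del j a) @ u) * vol (at_frame (b @ [a ! j]) @ w))))"
    unfolding sum_distrib_left mult_minus_right sum_negf
    by (subst sum_pull) (simp add: mult_ac sum_negf)
  also have "\<dots> = 0"
  proof -
    have "(\<Sum>a\<in>?L. \<Sum>b\<in>?L. ?P a b * (vol (at_frame (?del j a) @ u) * vol (at_frame (b @ [a ! j]) @ w))) = 0"
      if "j < 2 * k" for j
      unfolding at_frame_def
    proof (rule bianchi_contraction[where H = "\<lambda>c. vol (map ((!) E) c @ w)" and
          F = "\<lambda>c. vol (map ((!) E) c @ u)" and f = "(!) E" and \<Phi> = \<Phi>])
      show "antisymmetric (\<lambda>c. vol (map ((!) E) c @ w))"
        by (intro antisymmetric_map[of "\<lambda>v. vol (v @ w)"] antisymmetric_append_right vol_antisymmetric)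
    qed (use that E_nth_in_V in \<open>auto intro!: bianchi_left bianchi_right\<close>)
    then show ?thesis by simp
  qed
  finally show ?thesis .
qed

end

section \<open>Calculus of differentiable functions\<close>

lemma has_derivative_cong_open:
  assumes "open S" "x \<in> S" "\<And>y. y \<in> S \<Longrightarrow> f y = g y"
  shows "(f has_derivative D) (at x) \<longleftrightarrow> (g has_derivative D) (at x)"
  using has_derivative_transform_within_open[OF _ assms(1,2), of f D UNIV g]
    has_derivative_transform_within_open[OF _ assms(1,2), of g D UNIV f] assms(3) by auto

lemma frechet_derivative_cong_open:
  assumes "open S" "x \<in> S" "\<And>y. y \<in> S \<Longrightarrow> f y = g y"
  shows "frechet_derivative f (at x) = frechet_derivative g (at x)"
  unfolding frechet_derivative_def using has_derivative_cong_open[OF assms] by simp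

lemma differentiable_cong_open:
  assumes "open S" "x \<in> S" "\<And>y. y \<in> S \<Longrightarrow> f y = g y"
  shows "f differentiable (at x) \<longleftrightarrow> g differentiable (at x)"
  unfolding differentiable_def using has_derivative_cong_open[OF assms] by simp

lemma Ck_on_cong:
  assumes "open S" "\<And>x. x \<in> S \<Longrightarrow> f x = g x" "Ck_on k S f"
  shows "Ck_on k S g"
  using assms(2,3)
proof (induction k arbitrary: f g)
  case 0
  then show ?case using continuous_on_cong[of S S f g] by simp
next
  case (Suc k)
  have eq: "frechet_derivative f (at x) = frechet_derivative g (at x)"
      "f differentiable (at x) \<longleftrightarrow> g differentiable (at x)" if "x \<in> S" for x
    by (rule frechet_derivative_cong_open[OF assms(1) that Suc.prems(1)], assumption)
      (rule differentiable_cong_open[OF assms(1) that Suc.prems(1)])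
  have "Ck_on k S (\<lambda>x. frechet_derivative g (at x) u)" for u
    by (rule Suc.IH[of "\<lambda>x. frechet_derivative f (at x) u"]) (use Suc.prems(2) eq(1) in auto)
  then show ?case
    using Suc.prems(2) eq(2) by auto
qed

lemma Ck_on_subset: "Ck_on k S f \<Longrightarrow> T \<subseteq> S \<Longrightarrow> Ck_on k T f"
  by (induction k arbitrary: f) (auto intro: continuous_on_subset)

lemma Ck_on_pred: "Ck_on (Suc k) S f \<Longrightarrow> Ck_on k S f"
proof (induction k arbitrary: f)
  case 0
  then show ?case
    by (auto intro!: continuous_at_imp_continuous_on differentiable_imp_continuous_within)
qed auto

text \<open>Smoothness is local; this is what allows a field defined by cases on an open cover to be recognised as
smooth.\<close>

lemma Ck_on_local:
  assumes "\<And>x. x \<in> S \<Longrightarrow> \<exists>T. open T \<and> x \<in> T \<and> Ck_on k T f"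
  shows "Ck_on k S f"
  using assms
proof (induction k arbitrary: f)
  case 0
  then show ?case
    by (metis (no_types, lifting) Ck_on.simps(1) continuous_at_imp_continuous_on continuous_on_eq_continuous_at)
next
  case (Suc k)
  have "f differentiable (at x)" if "x \<in> S" for x using Suc.prems[OF that] by auto
  moreover have "Ck_on k S (\<lambda>x. frechet_derivative f (at x) u)" for u
    by (rule Suc.IH) (use Suc.prems in \<open>metis Ck_on.simps(2)\<close>)
  ultimately show ?case by simp
qed

lemma Ck_on_const: "Ck_on k S (\<lambda>x. c)"
  by (induction k arbitrary: c) auto

lemma Ck_on_add:
  assumes "open S" "Ck_on k S f" "Ck_on k S g"
  shows "Ck_on k S (\<lambda>x. f x + g x)"
  using assms(2,3)
proof (induction k arbitrary: f g)
  case 0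
  then show ?case by (simp add: continuous_on_add)
next
  case (Suc k)
  have d: "f differentiable (at x)" "g differentiable (at x)" if "x \<in> S" for x
    using Suc.prems that by auto
  have D: "frechet_derivative f (at x) u + frechet_derivative g (at x) u =
      frechet_derivative (\<lambda>x. f x + g x) (at x) u" if "x \<in> S" for x u
    by (rule fun_cong[OF frechet_derivative_at])
      (use d[OF that] in \<open>auto intro!: has_derivative_add simp: frechet_derivative_works\<close>)
  have "Ck_on k S (\<lambda>x. frechet_derivative f (at x) u + frechet_derivative g (at x) u)" for u
    using Suc.prems by (intro Suc.IH) auto
  then have "Ck_on k S (\<lambda>x. frechet_derivative (\<lambda>x. f x + g x) (at x) u)" for u
    by (rule Ck_on_cong[OF assms(1), rotated]) (rule D)
  then show ?case using d by (auto intro!: differentiable_add)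
qed

lemma Ck_on_sum:
  assumes "open S" "finite I" "\<And>i. i \<in> I \<Longrightarrow> Ck_on k S (f i)"
  shows "Ck_on k S (\<lambda>x. \<Sum>i\<in>I. f i x)"
  using assms(2,3) by (induction I) (auto intro: Ck_on_const Ck_on_add[OF assms(1)])

lemma Ck_on_mult:
  fixes f g :: "'a::real_normed_vector \<Rightarrow> real"
  assumes "open S" "Ck_on k S f" "Ck_on k S g"
  shows "Ck_on k S (\<lambda>x. f x * g x)"
  using assms(2,3)
proof (induction k arbitrary: f g)
  case 0
  then show ?case by (simp add: continuous_on_mult)
next
  case (Suc k)
  have d: "f differentiable (at x)" "g differentiable (at x)" if "x \<in> S" for x
    using Suc.prems that by auto
  have D: "f x * frechet_derivative g (at x) u + frechet_derivative f (at x) u * g x =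
      frechet_derivative (\<lambda>x. f x * g x) (at x) u" if "x \<in> S" for x u
    by (rule fun_cong[OF frechet_derivative_at])
      (use d[OF that] in \<open>auto intro!: has_derivative_mult simp: frechet_derivative_works\<close>)
  have "Ck_on k S (\<lambda>x. f x * frechet_derivative g (at x) u + frechet_derivative f (at x) u * g x)" for u
    using Suc.prems Suc.prems[THEN Ck_on_pred] by (intro Ck_on_add[OF assms(1)] Suc.IH) auto
  then have "Ck_on k S (\<lambda>x. frechet_derivative (\<lambda>x. f x * g x) (at x) u)" for u
    by (rule Ck_on_cong[OF assms(1), rotated]) (rule D)
  then show ?case using d by (auto intro!: differentiable_mult)
qed

lemma Ck_on_inner_const:
  assumes "open S" "Ck_on k S h"
  shows "Ck_on k S (\<lambda>x. h x \<bullet> b)"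
  using assms(2)
proof (induction k arbitrary: h)
  case 0
  then show ?case by (simp add: continuous_on_inner)
next
  case (Suc k)
  have d: "h differentiable (at x)" if "x \<in> S" for x using Suc.prems that by auto
  have D: "((\<lambda>x. h x \<bullet> b) has_derivative (\<lambda>u. frechet_derivative h (at x) u \<bullet> b)) (at x)" if "x \<in> S" for x
    using d[OF that] by (intro has_derivative_inner_left) (simp add: frechet_derivative_works)
  have "Ck_on k S (\<lambda>x. frechet_derivative h (at x) u \<bullet> b)" for u
    using Suc.prems by (intro Suc.IH) auto
  then have "Ck_on k S (\<lambda>x. frechet_derivative (\<lambda>x. h x \<bullet> b) (at x) u)" for u
    by (rule Ck_on_cong[OF assms(1), rotated]) (rule fun_cong[OF frechet_derivative_at[OF D]])
  then show ?case using D by (auto simp: differentiable_def)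
qed

lemma linear_eq_sum_Basis:
  fixes D :: "'a::euclidean_space \<Rightarrow> real"
  assumes "linear D"
  shows "D u = (\<Sum>b\<in>Basis. (u \<bullet> b) * D b)"
proof -
  have "D u = D (\<Sum>b\<in>Basis. (u \<bullet> b) *\<^sub>R b)" by (simp add: euclidean_representation)
  also have "\<dots> = (\<Sum>b\<in>Basis. (u \<bullet> b) * D b)"
    using assms by (simp add: linear_sum linear_cmul)
  finally show ?thesis .
qed

text \<open>By the chain rule a directional derivative of \<open>f \<circ> h\<close> is the sum, over the basis, of components of the
derivative of \<open>h\<close> times partial derivatives of \<open>f\<close> composed with \<open>h\<close>; so one degree of differentiability can
be peeled off.\<close>

lemma Ck_on_compose:
  fixes f :: "'b::euclidean_space \<Rightarrow> real" and h :: "'a::real_normed_vector \<Rightarrow> 'b"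
  assumes "open S" "h ` S \<subseteq> T" "Ck_on k S h" "Ck_on k T f"
  shows "Ck_on k S (\<lambda>x. f (h x))"
  using assms(3,4)
proof (induction k arbitrary: f)
  case 0
  then show ?case using assms(2) by (auto intro: continuous_on_compose2)
next
  case (Suc k)
  have d: "h differentiable (at x)" "f differentiable (at (h x))" if "x \<in> S" for x
    using Suc.prems that assms(2) by auto
  have D: "((\<lambda>x. f (h x)) has_derivative
      (\<lambda>u. frechet_derivative f (at (h x)) (frechet_derivative h (at x) u))) (at x)" if "x \<in> S" for x
    by (rule has_derivative_compose[OF d(1)[OF that, unfolded frechet_derivative_works]
          d(2)[OF that, unfolded frechet_derivative_works]])
  have eq: "(\<Sum>b\<in>Basis. (frechet_derivative h (at x) u \<bullet> b) * frechet_derivative f (at (h x)) b) =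
      frechet_derivative (\<lambda>x. f (h x)) (at x) u" if "x \<in> S" for x u
    using linear_eq_sum_Basis[OF linear_frechet_derivative[OF d(2)[OF that]], symmetric]
      fun_cong[OF frechet_derivative_at[OF D[OF that]], of u] by simp
  have "Ck_on k S (\<lambda>x. \<Sum>b\<in>Basis. (frechet_derivative h (at x) u \<bullet> b) * frechet_derivative f (at (h x)) b)" for u
    using Suc.prems Ck_on_pred[OF Suc.prems(1)]
    by (intro Ck_on_sum Ck_on_mult Ck_on_inner_const Suc.IH assms(1)) auto
  then have "Ck_on k S (\<lambda>x. frechet_derivative (\<lambda>x. f (h x)) (at x) u)" for u
    by (rule Ck_on_cong[OF assms(1), rotated]) (rule eq)
  then show ?case using D by (auto simp: differentiable_def)
qed

lemma Ck_on_affine_inner: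
  fixes p u :: "'a::euclidean_space"
  shows "Ck_on k S (\<lambda>y. (y - p) \<bullet> u)"
proof (cases k)
  case 0
  then show ?thesis by (auto intro!: continuous_intros)
next
  case (Suc m)
  have D: "((\<lambda>y. (y - p) \<bullet> u) has_derivative (\<lambda>w. w \<bullet> u)) (at x)" for x
    by (auto intro!: derivative_eq_intros)
  have "frechet_derivative (\<lambda>y. (y - p) \<bullet> u) (at x) = (\<lambda>w. w \<bullet> u)" for x
    by (rule frechet_derivative_at[OF D, symmetric])
  then show ?thesis using D Suc by (auto simp: differentiable_def intro: Ck_on_const)
qed

section \<open>Bump functions\<close>

text \<open>The functions \<open>t\<^sup>-\<^sup>m exp(-1/t)\<close>, extended by \<open>0\<close> to \<open>t \<le> 0\<close>. Their linear span is closed under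
differentiation (\<open>flat_derivative\<close>), which makes all of them smooth.\<close>

definition flat :: "nat \<Rightarrow> real \<Rightarrow> real" where
  "flat m t = (if t > 0 then inverse t ^ m * exp (- inverse t) else 0)"

lemma flat_tendsto_0: "(flat m \<longlongrightarrow> 0) (at 0)"
proof -
  have "((\<lambda>s::real. s ^ m / exp s) \<longlongrightarrow> 0) at_top" by (rule tendsto_power_div_exp_0)
  then have "((\<lambda>t::real. inverse t ^ m / exp (inverse t)) \<longlongrightarrow> 0) (at_right 0)"
    by (rule filterlim_compose) (rule filterlim_inverse_at_top_right)
  then have "(flat m \<longlongrightarrow> 0) (at_right 0)"
    by (rule Lim_transform_eventually)
      (auto simp: flat_def exp_minus divide_inverse eventually_at_right_less intro!: eventually_at_right_less[THEN eventually_mono])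
  moreover have "(flat m \<longlongrightarrow> 0) (at_left 0)"
    by (rule Lim_transform_eventually[OF tendsto_const])
      (auto simp: flat_def eventually_at_left_real[of "-1"] intro!: eventually_mono[OF eventually_at_left_real[of "-1" "0::real"]])
  ultimately show ?thesis by (simp add: filterlim_split_at)
qed

lemma flat_derivative:
  "(flat m has_real_derivative flat (m + 2) t - real m * flat (m + 1) t) (at t)"
proof -
  consider "t > 0" | "t < 0" | "t = 0" by linarith
  then show ?thesis
  proof cases
    case 1
    have "((\<lambda>t. inverse t ^ m * exp (- inverse t)) has_real_derivative
        flat (m + 2) t - real m * flat (m + 1) t) (at t)"
    proof (rule DERIV_cong)
      show "((\<lambda>t. inverse t ^ m * exp (- inverse t)) has_real_derivative
          inverse t ^ m * (exp (- inverse t) * (inverse t * inverse t)) +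
          real m * (- (inverse t * inverse t)) * inverse t ^ (m - 1) * exp (- inverse t)) (at t)"
        using 1 by (auto intro!: derivative_eq_intros)
      show "inverse t ^ m * (exp (- inverse t) * (inverse t * inverse t)) +
          real m * (- (inverse t * inverse t)) * inverse t ^ (m - 1) * exp (- inverse t) =
          flat (m + 2) t - real m * flat (m + 1) t"
        using 1 by (cases m) (simp_all add: flat_def algebra_simps)
    qed
    then show ?thesis
      by (rule has_field_derivative_transform_within_open[where S = "{0<..}"])
        (use 1 in \<open>auto simp: flat_def\<close>)
  next
    case 2
    have "((\<lambda>t. 0) has_real_derivative flat (m + 2) t - real m * flat (m + 1) t) (at t)"
      using 2 by (simp add: flat_def)
    then show ?thesis
      by (rule has_field_derivative_transform_within_open[where S = "{..<0}"])
        (use 2 in \<open>auto simp: flat_def\<close>)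
  next
    case 3
    have "(\<lambda>h. (flat m (0 + h) - flat m 0) / h) = flat (m + 1)"
      by (auto simp: flat_def fun_eq_iff divide_inverse)
    then show ?thesis
      using flat_tendsto_0[of "m + 1"] unfolding 3 DERIV_def by (simp add: flat_def)
  qed
qed

lemma Ck_on_flat: "Ck_on k UNIV (flat m)"
proof (induction k arbitrary: m)
  case 0
  show ?case
    using DERIV_isCont[OF flat_derivative] by (simp add: continuous_at_imp_continuous_on)
next
  case (Suc k)
  have D: "(flat m has_derivative (\<lambda>u. (flat (m + 2) t - real m * flat (m + 1) t) * u)) (at t)" for t
    using flat_derivative[of m t] by (simp add: has_field_derivative_def)
  have eq: "frechet_derivative (flat m) (at t) = (\<lambda>u. (flat (m + 2) t - real m * flat (m + 1) t) * u)" for t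
    by (rule frechet_derivative_at[OF D, symmetric])
  have "Ck_on k UNIV (\<lambda>t. (flat (m + 2) t + (- real m) * flat (m + 1) t) * u)" for u
    by (intro Ck_on_mult Ck_on_add Ck_on_const Suc open_UNIV)
  then show ?case using D by (auto simp: eq differentiable_def)
qed

lemma bump_function_exists:
  fixes p :: "'a::euclidean_space"
  assumes "r > 0"
  obtains \<rho> :: "'a \<Rightarrow> real" where "\<And>k S. open S \<Longrightarrow> Ck_on k S \<rho>" "\<rho> p = 1" "\<And>y. y \<notin> cball p r \<Longrightarrow> \<rho> y = 0"
proof
  \<comment> \<open>\<open>?h y\<close> is \<open>r\<^sup>2\<close> minus the squared distance of \<open>y\<close> from \<open>p\<close>, in coordinates\<close>
  let ?h = "\<lambda>y. r ^ 2 + (-1) * (\<Sum>b\<in>Basis. ((y - p) \<bullet> b) * ((y - p) \<bullet> b))"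
  let ?\<rho> = "\<lambda>y. flat 0 (?h y) * (1 / flat 0 (r ^ 2))"
  show "Ck_on k S ?\<rho>" if S: "open S" for k and S :: "'a set"
  proof -
    have "Ck_on k S ?h"
      by (intro Ck_on_add Ck_on_mult Ck_on_sum Ck_on_const Ck_on_affine_inner S finite_Basis)
    then have "Ck_on k S (\<lambda>y. flat 0 (?h y))"
      by (rule Ck_on_compose[OF S subset_UNIV _ Ck_on_flat])
    then show ?thesis by (intro Ck_on_mult[OF S] Ck_on_const)
  qed
  show "?\<rho> p = 1" using assms by (simp add: flat_def)
  show "?\<rho> y = 0" if "y \<notin> cball p r" for y
  proof -
    have "(\<Sum>b\<in>Basis. ((y - p) \<bullet> b) * ((y - p) \<bullet> b)) = (norm (y - p)) ^ 2"
      by (simp add: power2_norm_eq_inner euclidean_inner[of "y - p" "y - p"])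
    moreover have "norm (y - p) > r" using that by (simp add: dist_norm norm_minus_commute)
    then have "(norm (y - p)) ^ 2 \<ge> r ^ 2" using assms by (intro power_mono) auto
    ultimately show ?thesis by (simp add: flat_def)
  qed
qed

section \<open>Tangent vectors and vector fields\<close>

locale smooth_manifold =
  fixes A :: "('m::t2_space, 'e::euclidean_space) chart set"
  assumes atlas: "smooth_atlas A"
begin

lemma chart_at: obtains c where "c \<in> A" "x \<in> fst c"
  using atlas unfolding smooth_atlas_def by (metis (no_types, lifting) UN_E UNIV_I case_prod_beta)

lemma
  assumes "c \<in> A"
  shows chart_open: "open (fst c)" "open (snd c ` fst c)"
    and chart_homeomorphism: "homeomorphism (fst c) (snd c ` fst c) (snd c) (inv_into (fst c) (snd c))"
  using atlas assms unfolding smooth_atlas_def by (auto simp: case_prod_beta)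

lemma chart_inv [simp]:
  assumes "c \<in> A" "x \<in> fst c"
  shows "inv_into (fst c) (snd c) (snd c x) = x"
  using homeomorphism_apply1[OF chart_homeomorphism[OF assms(1)] assms(2)] .

lemma chart_image_open:
  assumes "c \<in> A" "open W"
  shows "open (snd c ` (fst c \<inter> W))"
proof -
  have "openin (top_of_set (fst c)) (fst c \<inter> W)"
    using assms(2) by (auto intro: openin_open_Int)
  then have "openin (top_of_set (snd c ` fst c)) (snd c ` (fst c \<inter> W))"
    using homeomorphism_imp_open_map[OF chart_homeomorphism[OF assms(1)]] by blast
  then show ?thesis using chart_open(2)[OF assms(1)] openin_open_eq by blast
qed

lemma transition_smooth:
  assumes "c \<in> A" "d \<in> A"
  shows "smooth_on (snd c ` (fst c \<inter> fst d)) (snd d \<circ> inv_into (fst c) (snd c))"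
  using atlas assms unfolding smooth_atlas_def by (auto simp: case_prod_beta)

lemma smooth_fun_iff:
  "smooth_fun A W f \<longleftrightarrow> (\<forall>c\<in>A. \<forall>k. Ck_on k (snd c ` (fst c \<inter> W)) (\<lambda>z. f (inv_into (fst c) (snd c) z)))"
  unfolding smooth_fun_def smooth_on_def by (auto simp: case_prod_beta o_def)

lemma smooth_fun_cong:
  assumes "open W" "\<And>x. x \<in> W \<Longrightarrow> f x = g x" "smooth_fun A W f"
  shows "smooth_fun A W g"
  unfolding smooth_fun_iff
proof (intro ballI allI)
  fix c k assume c: "c \<in> A"
  show "Ck_on k (snd c ` (fst c \<inter> W)) (\<lambda>z. g (inv_into (fst c) (snd c) z))"
  proof (rule Ck_on_cong[OF chart_image_open[OF c assms(1)]])
    show "Ck_on k (snd c ` (fst c \<inter> W)) (\<lambda>z. f (inv_into (fst c) (snd c) z))"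
      using assms(3) c unfolding smooth_fun_iff by blast
  qed (use c assms(2) in auto)
qed

lemma smooth_fun_subset: "smooth_fun A W f \<Longrightarrow> W' \<subseteq> W \<Longrightarrow> smooth_fun A W' f"
  unfolding smooth_fun_iff by (metis Ck_on_subset Int_mono image_mono order_refl)

lemma smooth_fun_linear_combination:
  assumes "open W" "smooth_fun A W f" "smooth_fun A W g"
  shows "smooth_fun A W (\<lambda>x. a * f x + b * g x)"
  using assms(2,3) chart_image_open[OF _ assms(1)] unfolding smooth_fun_iff
  by (auto intro!: Ck_on_add Ck_on_mult Ck_on_const)

lemma smooth_near_cong:
  assumes "open W" "x \<in> W" "\<And>y. y \<in> W \<Longrightarrow> f y = g y"
  shows "smooth_near A x f \<longleftrightarrow> smooth_near A x g"
proof -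
  have "smooth_near A x g" if fg: "\<And>y. y \<in> W \<Longrightarrow> f y = g y" and f: "smooth_near A x f" for f g
  proof -
    obtain W' where "open W'" "x \<in> W'" "smooth_fun A W' f" using f unfolding smooth_near_def by blast
    then show ?thesis
      using assms(1,2) fg smooth_fun_cong[of "W \<inter> W'" f g] smooth_fun_subset[of W' f "W \<inter> W'"]
      unfolding smooth_near_def by (metis IntD1 IntI inf_le2 open_Int)
  qed
  from this[of f g] this[of g f] assms(3) show ?thesis by metis
qed

lemma smooth_near_linear_combination:
  assumes "smooth_near A x f" "smooth_near A x g"
  shows "smooth_near A x (\<lambda>y. a * f y + b * g y)"
proof -
  obtain W W' where "open W" "x \<in> W" "smooth_fun A W f" "open W'" "x \<in> W'" "smooth_fun A W' g"
    using assms unfolding smooth_near_def by blast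
  then have "open (W \<inter> W')" "x \<in> W \<inter> W'" "smooth_fun A (W \<inter> W') f" "smooth_fun A (W \<inter> W') g"
    by (auto intro: smooth_fun_subset)
  then show ?thesis
    unfolding smooth_near_def using smooth_fun_linear_combination by blast
qed

lemma smooth_near_differentiable:
  assumes "smooth_near A x f" "c \<in> A" "x \<in> fst c"
  shows "(f \<circ> inv_into (fst c) (snd c)) differentiable (at (snd c x))"
proof -
  obtain W where W: "x \<in> W" "smooth_fun A W f" using assms(1) unfolding smooth_near_def by blast
  then have "Ck_on (Suc 0) (snd c ` (fst c \<inter> W)) (\<lambda>z. f (inv_into (fst c) (snd c) z))"
    using assms(2) unfolding smooth_fun_iff by blast
  then show ?thesis using W assms(3) by (auto simp: o_def)
qed

lemma chart_vector_apply:
  assumes "smooth_near A x f" "c \<in> A" "x \<in> fst c"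
  shows "((f \<circ> inv_into (fst c) (snd c)) has_derivative (\<lambda>u. chart_vector A c x u f)) (at (snd c x))"
  using smooth_near_differentiable[OF assms] assms(1)
  by (simp add: chart_vector_def frechet_derivative_works)

lemma linear_chart_vector:
  assumes "c \<in> A" "x \<in> fst c"
  shows "linear (chart_vector A c x)"
proof -
  have lin: "linear (\<lambda>u. chart_vector A c x u f)" for f
  proof (cases "smooth_near A x f")
    case True
    then show ?thesis using chart_vector_apply[OF True assms] has_derivative_linear by blast
  next
    case False
    then show ?thesis by (simp add: chart_vector_def linear_iff)
  qed
  show ?thesis
    by (rule linearI) (auto simp: fun_eq_iff plus_fun_def scaleR_fun_def linear_add[OF lin] linear_cmul[OF lin])
qed

lemma change_of_chart:
  assumes "c \<in> A" "d \<in> A" "x \<in> fst c" "x \<in> fst d"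
  shows "chart_vector A c x u =
    chart_vector A d x (frechet_derivative (snd d \<circ> inv_into (fst c) (snd c)) (at (snd c x)) u)"
proof
  fix f
  let ?t = "snd d \<circ> inv_into (fst c) (snd c)"
  show "chart_vector A c x u f = chart_vector A d x (frechet_derivative ?t (at (snd c x)) u) f"
  proof (cases "smooth_near A x f")
    case True
    have "Ck_on (Suc 0) (snd c ` (fst c \<inter> fst d)) ?t"
      using transition_smooth[OF assms(1,2)] unfolding smooth_on_def by blast
    then have "?t differentiable (at (snd c x))" using assms(3,4) by auto
    then have t: "(?t has_derivative frechet_derivative ?t (at (snd c x))) (at (snd c x))"
      by (simp add: frechet_derivative_works)
    have "?t (snd c x) = snd d x" using assms by simp
    then have "((f \<circ> inv_into (fst d) (snd d)) has_derivative (\<lambda>u. chart_vector A d x u f)) (at (?t (snd c x)))"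
      using chart_vector_apply[OF True assms(2,4)] by simp
    from diff_chain_at[OF t this]
    have D: "((f \<circ> inv_into (fst d) (snd d) \<circ> ?t) has_derivative
        (\<lambda>u. chart_vector A d x u f) \<circ> frechet_derivative ?t (at (snd c x))) (at (snd c x))" .
    have "((f \<circ> inv_into (fst c) (snd c)) has_derivative
        (\<lambda>u. chart_vector A d x u f) \<circ> frechet_derivative ?t (at (snd c x))) (at (snd c x))"
    proof (rule has_derivative_cong_open[THEN iffD1, OF _ _ _ D])
      show "open (snd c ` (fst c \<inter> fst d))" by (rule chart_image_open[OF assms(1) chart_open(1)[OF assms(2)]])
      show "snd c x \<in> snd c ` (fst c \<inter> fst d)" using assms by blast
    qed (use assms in auto)
    then have "(\<lambda>u. chart_vector A c x u f) =
        (\<lambda>u. chart_vector A d x u f) \<circ> frechet_derivative ?t (at (snd c x))"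
      using chart_vector_apply[OF True assms(1,3)] has_derivative_unique by blast
    then show ?thesis by (metis comp_apply)
  qed (simp add: chart_vector_def)
qed

text \<open>The tangent space was defined as a union over all charts; by the change of coordinates one chart is
enough, which makes it a vector space.\<close>

lemma tangent_space_eq:
  assumes "c \<in> A" "x \<in> fst c"
  shows "tangent_space A x = range (chart_vector A c x)"
proof
  show "tangent_space A x \<subseteq> range (chart_vector A c x)"
    using change_of_chart[OF _ assms(1) _ assms(2)] unfolding tangent_space_def by blast
  show "range (chart_vector A c x) \<subseteq> tangent_space A x"
    using assms unfolding tangent_space_def by blast
qed

lemma subspace_tangent_space: "subspace (tangent_space A x)"
proof -
  obtain c where c: "c \<in> A" "x \<in> fst c" by (rule chart_at)
  show ?thesis
    unfolding tangent_space_eq[OF c] by (intro linear_subspace_image linear_chart_vector c subspace_UNIV)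
qed

lemma dim_tangent_space_le: "dim (tangent_space A x) \<le> DIM('e)"
proof -
  obtain c where c: "c \<in> A" "x \<in> fst c" by (rule chart_at)
  have "tangent_space A x = span (chart_vector A c x ` Basis)"
    unfolding tangent_space_eq[OF c] linear_span_image[OF linear_chart_vector[OF c]] span_Basis ..
  then show ?thesis
    by (metis card_image_le dim_le_card dim_span finite_Basis finite_imageI le_trans order_refl)
qed

lemma tangent_linear_combination:
  assumes "v \<in> tangent_space A x" "smooth_near A x f" "smooth_near A x g"
  shows "v (\<lambda>y. a * f y + b * g y) = a * v f + b * v g"
proof -
  obtain c u where c: "c \<in> A" "x \<in> fst c" "v = chart_vector A c x u"
    using assms(1) unfolding tangent_space_def by blast
  have "(((\<lambda>y. a * f y + b * g y) \<circ> inv_into (fst c) (snd c)) has_derivative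
      (\<lambda>u. a * chart_vector A c x u f + b * chart_vector A c x u g)) (at (snd c x))"
    using chart_vector_apply[OF assms(2) c(1,2)] chart_vector_apply[OF assms(3) c(1,2)]
    unfolding o_def by (intro has_derivative_add has_derivative_mult_right)
  from has_derivative_unique[OF this
      chart_vector_apply[OF smooth_near_linear_combination[OF assms(2,3)] c(1,2)]]
  show ?thesis unfolding c(3) by metis
qed

text \<open>Tangent vectors only see germs of functions, including whether the function is smooth near the
point.\<close>

lemma tangent_cong:
  assumes "v \<in> tangent_space A x" "open W" "x \<in> W" "\<And>y. y \<in> W \<Longrightarrow> f y = g y"
  shows "v f = v g"
proof -
  obtain c u where c: "c \<in> A" "x \<in> fst c" "v = chart_vector A c x u"
    using assms(1) unfolding tangent_space_def by blast
  have "frechet_derivative (f \<circ> inv_into (fst c) (snd c)) (at (snd c x)) =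
      frechet_derivative (g \<circ> inv_into (fst c) (snd c)) (at (snd c x))"
    by (rule frechet_derivative_cong_open[OF chart_image_open[OF c(1) assms(2)]])
      (use c assms in auto)
  then show ?thesis
    unfolding c(3) chart_vector_def using smooth_near_cong[OF assms(2-4)] by simp
qed

lemma vector_field_tangent: "X \<in> vector_fields A \<Longrightarrow> X x \<in> tangent_space A x"
  unfolding vector_fields_def by blast

lemma vector_field_smooth:
  "X \<in> vector_fields A \<Longrightarrow> open W \<Longrightarrow> smooth_fun A W f \<Longrightarrow> smooth_fun A W (\<lambda>x. X x f)"
  unfolding vector_fields_def by blast

lemma vector_field_smooth_near:
  "X \<in> vector_fields A \<Longrightarrow> smooth_near A x f \<Longrightarrow> smooth_near A x (\<lambda>y. X y f)"
  unfolding smooth_near_def using vector_field_smooth by blast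

lemma vector_field_diff:
  assumes "X \<in> vector_fields A" "Y \<in> vector_fields A"
  shows "X - Y \<in> vector_fields A"
  unfolding vector_fields_def
proof (intro CollectI conjI allI impI)
  show "(X - Y) x \<in> tangent_space A x" for x
    using assms[THEN vector_field_tangent] subspace_diff[OF subspace_tangent_space] by simp
  show "smooth_fun A W (\<lambda>x. (X - Y) x f)" if "open W \<and> smooth_fun A W f" for W f
    using smooth_fun_linear_combination[of W "\<lambda>x. X x f" "\<lambda>x. Y x f" 1 "-1"] that
      vector_field_smooth[OF assms(1)] vector_field_smooth[OF assms(2)] by simp
qed

text \<open>In a chart around \<open>x\<close> the vector \<open>u\<close> is a constant coordinate vector \<open>w\<close>; the field with these coordinates is
multiplied by a bump function and continued by \<open>0\<close>.\<close>

lemma vector_field_extension: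
  assumes u: "u \<in> tangent_space A x"
  shows "\<exists>X\<in>vector_fields A. X x = u"
proof -
  obtain c w where c: "c \<in> A" "x \<in> fst c" "u = chart_vector A c x w"
    using u unfolding tangent_space_def by blast
  let ?U = "fst c" and ?\<phi> = "snd c" and ?i = "inv_into (fst c) (snd c)"
  have "?\<phi> x \<in> ?\<phi> ` ?U" using c by blast
  then obtain r where r: "r > 0" "cball (?\<phi> x) r \<subseteq> ?\<phi> ` ?U"
    using chart_open(2)[OF c(1)] unfolding open_contains_cball by blast
  obtain \<rho> where \<rho>: "\<And>k S. open S \<Longrightarrow> Ck_on k S \<rho>" "\<rho> (?\<phi> x) = (1::real)"
    "\<And>y. y \<notin> cball (?\<phi> x) r \<Longrightarrow> \<rho> y = 0"
    using bump_function_exists[OF r(1)] by metis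
  define K where "K = ?i ` cball (?\<phi> x) r"
  have "continuous_on (cball (?\<phi> x) r) ?i"
    using homeomorphism_cont2[OF chart_homeomorphism[OF c(1)]] r(2) continuous_on_subset by blast
  \<comment> \<open>\<open>K\<close> is compact, hence closed in the Hausdorff space, so \<open>X\<close> vanishes on the open complement of \<open>K\<close>.\<close>
  then have K: "closed K"
    unfolding K_def by (intro compact_imp_closed compact_continuous_image compact_cball)
  define X where "X y = (if y \<in> ?U then \<rho> (?\<phi> y) *\<^sub>R chart_vector A c y w else 0)" for y
  have X_tangent: "X y \<in> tangent_space A y" for y
  proof (cases "y \<in> ?U")
    case True
    then show ?thesis
      using linear_cmul[OF linear_chart_vector[OF c(1) True], symmetric] tangent_space_eq[OF c(1) True]
      by (simp add: X_def)
  next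
    case False
    then show ?thesis using subspace_0[OF subspace_tangent_space] by (simp add: X_def)
  qed
  have "smooth_fun A W (\<lambda>y. X y f)" if W: "open W" and f: "smooth_fun A W f" for W f
    unfolding smooth_fun_iff
  proof (intro ballI allI)
    fix d k assume d: "d \<in> A"
    let ?V = "fst d" and ?j = "inv_into (fst d) (snd d)"
    let ?F = "\<lambda>z. X (?j z) f"
    define S1 where "S1 = snd d ` (?V \<inter> (W \<inter> ?U))"
    define S2 where "S2 = snd d ` (?V \<inter> (W - K))"
    have S: "open S1" "open S2"
      unfolding S1_def S2_def using W K chart_open(1)[OF c(1)] by (auto intro!: chart_image_open[OF d])
    define g where "g p = \<rho> p * frechet_derivative (\<lambda>z. f (?i z)) (at p) w" for p
    \<comment> \<open>\<open>g\<close> is the function \<open>X f\<close> in the coordinates of \<open>c\<close>; the transition map carries it to those of \<open>d\<close>.\<close>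
    have "Ck_on (Suc k) (?\<phi> ` (?U \<inter> W)) (\<lambda>z. f (?i z))"
      using f c(1) unfolding smooth_fun_iff by blast
    then have g: "Ck_on k (?\<phi> ` (?U \<inter> W)) g"
      unfolding g_def using chart_image_open[OF c(1) W] \<rho>(1) by (intro Ck_on_mult) auto
    have "Ck_on k (snd d ` (?V \<inter> ?U)) (\<lambda>z. ?\<phi> (?j z))"
      using transition_smooth[OF d c(1)] unfolding smooth_on_def o_def by blast
    then have h: "Ck_on k S1 (\<lambda>z. ?\<phi> (?j z))"
      by (rule Ck_on_subset) (auto simp: S1_def)
    have "Ck_on k S1 (\<lambda>z. g (?\<phi> (?j z)))"
      by (rule Ck_on_compose[OF S(1) _ h g]) (use d in \<open>auto simp: S1_def\<close>)
    then have C1: "Ck_on k S1 ?F"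
    proof (rule Ck_on_cong[OF S(1), rotated])
      fix z assume "z \<in> S1"
      then obtain y where y: "z = snd d y" "y \<in> ?V" "y \<in> W" "y \<in> ?U" unfolding S1_def by blast
      have "smooth_near A y f" using W f y(3) unfolding smooth_near_def by blast
      then show "g (?\<phi> (?j z)) = ?F z"
        using y d c(1) by (simp add: g_def X_def scaleR_fun_def chart_vector_def o_def)
    qed
    have C2: "Ck_on k S2 ?F"
    proof (rule Ck_on_cong[OF S(2) _ Ck_on_const[of k S2 0]])
      fix z assume "z \<in> S2"
      then obtain y where y: "z = snd d y" "y \<in> ?V" "y \<notin> K" unfolding S2_def by blast
      have "\<rho> (?\<phi> y) = 0" if "y \<in> ?U"
      proof (rule \<rho>(3))
        show "?\<phi> y \<notin> cball (?\<phi> x) r"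
          using y(3) chart_inv[OF c(1) that] unfolding K_def by (metis imageI)
      qed
      then show "0 = ?F z" using y d by (simp add: X_def scaleR_fun_def zero_fun_def)
    qed
    show "Ck_on k (snd d ` (?V \<inter> W)) ?F"
    proof (rule Ck_on_local)
      fix z assume "z \<in> snd d ` (?V \<inter> W)"
      then obtain y where y: "z = snd d y" "y \<in> ?V" "y \<in> W" by blast
      have "K \<subseteq> ?U"
        unfolding K_def using r(2) inv_into_into[of _ ?\<phi> ?U] by blast
      then have "z \<in> S1 \<or> z \<in> S2" using y unfolding S1_def S2_def by blast
      then show "\<exists>T. open T \<and> z \<in> T \<and> Ck_on k T ?F" using S C1 C2 by blast
    qed
  qed
  then have "X \<in> vector_fields A"
    unfolding vector_fields_def using X_tangent by blast
  moreover have "X x = u" using c \<rho>(2) by (simp add: X_def)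
  ultimately show ?thesis by blast
qed

lemma extend_vector:
  assumes "u \<in> tangent_space A x"
  shows "extend_vector A x u \<in> vector_fields A" "extend_vector A x u x = u"
  unfolding extend_vector_def using vector_field_extension[OF assms] by (metis (mono_tags, lifting) someI_ex)+

lemma lie_bracket_apply:
  assumes "smooth_near A x f"
  shows "lie_bracket A X Y x f = X x (\<lambda>y. Y y f) - Y x (\<lambda>y. X y f)"
  using assms by (simp add: lie_bracket_def)

text \<open>Applied to a function, the twelve threefold derivatives cancel in pairs. The inner bracket is the
difference of its two terms only where the function is smooth, that is near \<open>x\<close>, so a tangent vector is
applied to it through its germ.\<close>

lemma jacobi_identity:
  assumes "X \<in> vector_fields A" "Y \<in> vector_fields A" "Z \<in> vector_fields A"
  shows "lie_bracket A X (lie_bracket A Y Z) + lie_bracket A Y (lie_bracket A Z X) +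
    lie_bracket A Z (lie_bracket A X Y) = 0"
proof (intro ext)
  fix x f
  have outer: "lie_bracket A X (lie_bracket A Y Z) x f =
      X x (\<lambda>y. Y y (\<lambda>y. Z y f)) - X x (\<lambda>y. Z y (\<lambda>y. Y y f)) -
      (Y x (\<lambda>y. Z y (\<lambda>y. X y f)) - Z x (\<lambda>y. Y y (\<lambda>y. X y f)))"
    if V: "X \<in> vector_fields A" "Y \<in> vector_fields A" "Z \<in> vector_fields A"
      and f: "smooth_near A x f" for X Y Z
  proof -
    obtain W where W: "open W" "x \<in> W" "smooth_fun A W f" using f unfolding smooth_near_def by blast
    note near = vector_field_smooth_near[OF V(1)] vector_field_smooth_near[OF V(2)] vector_field_smooth_near[OF V(3)]
    have "X x (\<lambda>y. lie_bracket A Y Z y f) = X x (\<lambda>y. 1 * Y y (\<lambda>y. Z y f) + (-1) * Z y (\<lambda>y. Y y f))"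
    proof (rule tangent_cong[OF vector_field_tangent[OF V(1)] W(1,2)])
      fix y assume "y \<in> W"
      then have "smooth_near A y f" using W unfolding smooth_near_def by blast
      then show "lie_bracket A Y Z y f = 1 * Y y (\<lambda>y. Z y f) + (-1) * Z y (\<lambda>y. Y y f)"
        by (simp add: lie_bracket_apply)
    qed
    also have "\<dots> = 1 * X x (\<lambda>y. Y y (\<lambda>y. Z y f)) + (-1) * X x (\<lambda>y. Z y (\<lambda>y. Y y f))"
      by (rule tangent_linear_combination[OF vector_field_tangent[OF V(1)]
            near(2)[OF near(3)[OF f]] near(3)[OF near(2)[OF f]]])
    finally show ?thesis
      using lie_bracket_apply[OF f, of X "lie_bracket A Y Z"]
        lie_bracket_apply[OF near(1)[OF f], of Y Z] by simp
  qed
  show "(lie_bracket A X (lie_bracket A Y Z) + lie_bracket A Y (lie_bracket A Z X) +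
    lie_bracket A Z (lie_bracket A X Y)) x f = 0 x f"
  proof (cases "smooth_near A x f")
    case True
    then show ?thesis
      using outer[OF assms(1,2,3)] outer[OF assms(2,3,1)] outer[OF assms(3,1,2)] by simp
  next
    case False
    then show ?thesis by (simp add: lie_bracket_def)
  qed
qed

end

section \<open>Curvature\<close>

locale riemannian_manifold = smooth_manifold A
  for A :: "('m::t2_space, 'e::euclidean_space) chart set" +
  fixes g :: "'m \<Rightarrow> 'm tangent \<Rightarrow> 'm tangent \<Rightarrow> real"
    and nabla :: "'m vfield \<Rightarrow> 'm vfield \<Rightarrow> 'm vfield"
  assumes metric: "riemannian_metric A g" and connection: "levi_civita A g nabla"
begin

lemma inner_product_on_tangent_space: "inner_product_on (tangent_space A x) (g x)"
  using metric subspace_tangent_space unfolding riemannian_metric_def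
  by unfold_locales blast+

lemma metric_sym:
  "X \<in> vector_fields A \<Longrightarrow> Y \<in> vector_fields A \<Longrightarrow> g x (X x) (Y x) = g x (Y x) (X x)"
  using inner_product_on.G_sym[OF inner_product_on_tangent_space] vector_field_tangent by blast

lemma metric_diff:
  assumes "X \<in> vector_fields A" "Y \<in> vector_fields A" "Z \<in> vector_fields A"
  shows "g x (X x - Y x) (Z x) = g x (X x) (Z x) - g x (Y x) (Z x)"
  using inner_product_on.G_lin[OF inner_product_on_tangent_space assms[THEN vector_field_tangent], of x 1 "-1"]
  by simp

lemma nabla_vector_field: "X \<in> vector_fields A \<Longrightarrow> Y \<in> vector_fields A \<Longrightarrow> nabla X Y \<in> vector_fields A"
  using connection unfolding levi_civita_def affine_connection_def by blast

lemma nabla_add: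
  assumes "X \<in> vector_fields A" "Y \<in> vector_fields A" "Z \<in> vector_fields A"
  shows "nabla (X + Y) Z = nabla X Z + nabla Y Z" "nabla Z (X + Y) = nabla Z X + nabla Z Y"
  using connection assms unfolding levi_civita_def affine_connection_def by blast+

lemma nabla_diff:
  assumes "X \<in> vector_fields A" "Y \<in> vector_fields A" "Z \<in> vector_fields A"
  shows "nabla (X - Y) Z = nabla X Z - nabla Y Z" "nabla Z (X - Y) = nabla Z X - nabla Z Y"
  using nabla_add[OF vector_field_diff[OF assms(1,2)] assms(2,3)] by simp_all

lemma torsion_free:
  "X \<in> vector_fields A \<Longrightarrow> Y \<in> vector_fields A \<Longrightarrow> lie_bracket A X Y = nabla X Y - nabla Y X"
  using connection unfolding levi_civita_def by simp

text \<open>That second derivatives cancel in the bracket need not be computed: the bracket is a difference of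
covariant derivatives.\<close>

lemma lie_bracket_vector_field:
  "X \<in> vector_fields A \<Longrightarrow> Y \<in> vector_fields A \<Longrightarrow> lie_bracket A X Y \<in> vector_fields A"
  by (simp add: torsion_free vector_field_diff nabla_vector_field)

lemma nabla_metric:
  assumes "X \<in> vector_fields A" "Y \<in> vector_fields A" "Z \<in> vector_fields A"
  shows "X x (\<lambda>y. g y (Y y) (Z y)) = g x (nabla X Y x) (Z x) + g x (Y x) (nabla X Z x)"
  using connection assms unfolding levi_civita_def by blast

lemma metric_smooth_near:
  assumes "X \<in> vector_fields A" "Y \<in> vector_fields A"
  shows "smooth_near A x (\<lambda>y. g y (X y) (Y y))"
proof -
  have "smooth_fun A UNIV (\<lambda>y. g y (X y) (Y y))"
    using metric assms unfolding riemannian_metric_def by simp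
  then show ?thesis unfolding smooth_near_def by (intro exI[of _ UNIV]) simp
qed

abbreviation "curv \<equiv> curvature_operator A nabla"

lemma curvature_vector_field:
  "X \<in> vector_fields A \<Longrightarrow> Y \<in> vector_fields A \<Longrightarrow> W \<in> vector_fields A \<Longrightarrow> curv X Y W \<in> vector_fields A"
  unfolding curvature_operator_def
  by (intro vector_field_diff nabla_vector_field lie_bracket_vector_field)

lemma curvature_swap:
  assumes "X \<in> vector_fields A" "Y \<in> vector_fields A" "W \<in> vector_fields A"
  shows "curv X Y W = 0 - curv Y X W"
  unfolding curvature_operator_def
  using assms by (simp add: torsion_free nabla_diff nabla_vector_field)

text \<open>Grouping the second covariant derivatives by their outer field and using torsion-freeness twice leaves
the Jacobi sum.\<close>

lemma curvature_bianchi: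
  assumes "X \<in> vector_fields A" "Y \<in> vector_fields A" "Z \<in> vector_fields A"
  shows "curv X Y Z + curv Y Z X + curv Z X Y = 0"
proof -
  have "nabla X (nabla Y Z) - nabla X (nabla Z Y) - nabla (lie_bracket A Y Z) X = lie_bracket A X (lie_bracket A Y Z)"
    if "X \<in> vector_fields A" "Y \<in> vector_fields A" "Z \<in> vector_fields A" for X Y Z
    using that torsion_free[of X "lie_bracket A Y Z"]
    by (simp add: lie_bracket_vector_field torsion_free[of Y Z] nabla_diff nabla_vector_field vector_field_diff)
  from this[OF assms] this[OF assms(2,3,1)] this[OF assms(3,1,2)]
  have "curv X Y Z + curv Y Z X + curv Z X Y = lie_bracket A X (lie_bracket A Y Z) +
      lie_bracket A Y (lie_bracket A Z X) + lie_bracket A Z (lie_bracket A X Y)"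
    unfolding curvature_operator_def by (simp add: algebra_simps)
  then show ?thesis using jacobi_identity[OF assms] by simp
qed

text \<open>Differentiate \<open>g(Z, W)\<close>: the commutator of the derivatives along \<open>X\<close> and \<open>Y\<close> is the derivative along
\<open>[X,Y]\<close>, and the mixed first order terms are symmetric in \<open>X\<close> and \<open>Y\<close>.\<close>

lemma curvature_skew:
  assumes X: "X \<in> vector_fields A" and Y: "Y \<in> vector_fields A"
    and Z: "Z \<in> vector_fields A" and W: "W \<in> vector_fields A"
  shows "g x (curv X Y Z x) (W x) + g x (Z x) (curv X Y W x) = 0"
proof -
  let ?h = "\<lambda>y. g y (Z y) (W y)"
  have second: "X x (\<lambda>y. Y y ?h) = g x (nabla X (nabla Y Z) x) (W x) + g x (nabla Y Z x) (nabla X W x) +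
      g x (nabla X Z x) (nabla Y W x) + g x (Z x) (nabla X (nabla Y W) x)"
    if X: "X \<in> vector_fields A" and Y: "Y \<in> vector_fields A" for X Y
  proof -
    have "X x (\<lambda>y. Y y ?h) = X x (\<lambda>y. 1 * g y (nabla Y Z y) (W y) + 1 * g y (Z y) (nabla Y W y))"
      by (simp add: nabla_metric[OF Y Z W])
    also have "\<dots> = 1 * X x (\<lambda>y. g y (nabla Y Z y) (W y)) + 1 * X x (\<lambda>y. g y (Z y) (nabla Y W y))"
      by (rule tangent_linear_combination[OF vector_field_tangent[OF X]])
        (intro metric_smooth_near nabla_vector_field Y Z W)+
    finally show ?thesis
      by (simp add: nabla_metric[OF X nabla_vector_field[OF Y Z] W] nabla_metric[OF X Z nabla_vector_field[OF Y W]])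
  qed
  have bracket: "X x (\<lambda>y. Y y ?h) - Y x (\<lambda>y. X y ?h) =
      g x (nabla (lie_bracket A X Y) Z x) (W x) + g x (Z x) (nabla (lie_bracket A X Y) W x)"
    using lie_bracket_apply[OF metric_smooth_near[OF Z W], of X Y]
      nabla_metric[OF lie_bracket_vector_field[OF X Y] Z W] by simp
  have split: "g x (curv X Y U x) (U' x) = g x (nabla X (nabla Y U) x) (U' x) -
      g x (nabla Y (nabla X U) x) (U' x) - g x (nabla (lie_bracket A X Y) U x) (U' x)"
    if U: "U \<in> vector_fields A" "U' \<in> vector_fields A" for U U'
  proof -
    note vf = nabla_vector_field[OF X nabla_vector_field[OF Y U(1)]]
      nabla_vector_field[OF Y nabla_vector_field[OF X U(1)]]
      nabla_vector_field[OF lie_bracket_vector_field[OF X Y] U(1)]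
    show ?thesis
      using metric_diff[OF vector_field_diff[OF vf(1,2)] vf(3) U(2), of x] metric_diff[OF vf(1,2) U(2), of x]
      by (simp add: curvature_operator_def)
  qed
  have sym: "g x (Z x) (U x) = g x (U x) (Z x)" if "U \<in> vector_fields A" for U
    using metric_sym[OF Z that] .
  show ?thesis
    using second[OF X Y] second[OF Y X] bracket split[OF Z W] split[OF W Z]
      sym[OF curvature_vector_field[OF X Y W]] sym[OF nabla_vector_field[OF X nabla_vector_field[OF Y W]]]
      sym[OF nabla_vector_field[OF Y nabla_vector_field[OF X W]]]
      sym[OF nabla_vector_field[OF lie_bracket_vector_field[OF X Y] W]] by linarith
qed

text \<open>The tensor is by definition evaluated on fixed extensions of its arguments, so its symmetries are those of
the curvature operator on these fields. The cyclic identity fixes the third argument; the exchange of pairs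
carries it to the other positions.\<close>

lemma riemann_bianchi:
  assumes "p \<in> tangent_space A x" "q \<in> tangent_space A x" "r \<in> tangent_space A x" "s \<in> tangent_space A x"
  shows "riemann_tensor A g nabla x p q r s + riemann_tensor A g nabla x r q s p +
      riemann_tensor A g nabla x s q p r = 0"
    and "riemann_tensor A g nabla x p q r s + riemann_tensor A g nabla x p r s q +
      riemann_tensor A g nabla x p s q r = 0"
proof -
  let ?V = "tangent_space A x" and ?F = "riemann_tensor A g nabla x" and ?e = "extend_vector A x"
  note ext = extend_vector
  have F: "?F p q r s = g x (curv (?e p) (?e q) (?e s) x) (?e r x)" if "r \<in> ?V" for p q r s
    using ext(2)[OF that] by (simp add: riemann_tensor_def)
  have skew1: "?F p q r s = - ?F q p r s" if "p \<in> ?V" "q \<in> ?V" "r \<in> ?V" "s \<in> ?V" for p q r s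
  proof -
    note c = curvature_vector_field[OF ext(1)[OF that(1)] ext(1)[OF that(2)] ext(1)[OF that(4)]]
    note c' = curvature_vector_field[OF ext(1)[OF that(2)] ext(1)[OF that(1)] ext(1)[OF that(4)]]
    have "curv (?e p) (?e q) (?e s) x = curv (?e p) (?e q) (?e s) x - curv (?e p) (?e q) (?e s) x - curv (?e q) (?e p) (?e s) x"
      using curvature_swap[OF ext(1)[OF that(1)] ext(1)[OF that(2)] ext(1)[OF that(4)]] by simp
    then show ?thesis
      using metric_diff[OF vector_field_diff[OF c c] c' ext(1)[OF that(3)], of x]
        metric_diff[OF c c ext(1)[OF that(3)], of x] that(3)
      by (simp add: F)
  qed
  have skew2: "?F p q r s = - ?F p q s r" if "p \<in> ?V" "q \<in> ?V" "r \<in> ?V" "s \<in> ?V" for p q r s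
    using curvature_skew[OF that[THEN ext(1)], of x]
      metric_sym[OF ext(1)[OF that(3)] curvature_vector_field[OF ext(1)[OF that(1)] ext(1)[OF that(2)] ext(1)[OF that(4)]], of x]
      that by (simp add: F)
  have cyclic: "?F p q r s + ?F q s r p + ?F s p r q = 0" if "p \<in> ?V" "q \<in> ?V" "r \<in> ?V" "s \<in> ?V" for p q r s
  proof -
    interpret inner_product_on ?V "g x" by (rule inner_product_on_tangent_space)
    have V: "curv (?e p) (?e q) (?e s) x \<in> ?V" "curv (?e q) (?e s) (?e p) x \<in> ?V" "curv (?e s) (?e p) (?e q) x \<in> ?V"
      by (intro vector_field_tangent curvature_vector_field ext(1) that)+
    have "curv (?e p) (?e q) (?e s) x + curv (?e q) (?e s) (?e p) x + curv (?e s) (?e p) (?e q) x = 0"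
      using fun_cong[OF curvature_bianchi[OF ext(1)[OF that(1)] ext(1)[OF that(2)] ext(1)[OF that(4)]], of x] by simp
    moreover have "g x (u + v) r = g x u r + g x v r" if "u \<in> ?V" "v \<in> ?V" for u v
      using G_lin[OF that \<open>r \<in> ?V\<close>, of 1 1] by simp
    moreover have "g x 0 r = 0" using G_lin[of r r r 0 0] that(3) by simp
    ultimately show ?thesis
      using V subspace_add[OF subspace_V V(1,2)] unfolding riemann_tensor_def by metis
  qed
  \<comment> \<open>the cyclic identities with each of the four arguments fixed, combined by the skew-symmetries\<close>
  have pair: "?F p q r s = ?F r s p q" if "p \<in> ?V" "q \<in> ?V" "r \<in> ?V" "s \<in> ?V" for p q r s
    using cyclic[of p q r s] cyclic[of p q s r] cyclic[of r s p q] cyclic[of r s q p]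
      skew2[of p q r s] skew2[of q s r p] skew2[of s p r q] skew2[of r s p q] skew2[of q r s p] skew2[of r p s q]
      skew1[of q s r p] skew1[of s p r q] skew1[of q s p r] skew1[of s p q r] skew1[of q r s p] skew1[of r p s q]
      skew1[of q r p s] skew1[of r p q s] skew1[of r s p q] skew1[of r s q p] skew1[of p q r s]
      that by simp
  have right: "?F p q r s + ?F p r s q + ?F p s q r = 0" if "p \<in> ?V" "q \<in> ?V" "r \<in> ?V" "s \<in> ?V" for p q r s
    using cyclic[of r s p q] pair[of p q r s] pair[of p r s q] pair[of p s q r] that by simp
  show "?F p q r s + ?F r q s p + ?F s q p r = 0"
    using right[of q p r s] skew1[of p q r s] skew1[of r q s p] skew1[of s q p r] assms by simp
  show "?F p q r s + ?F p r s q + ?F p s q r = 0"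
    by (rule right[OF assms])
qed

end

theorem corollary4p6:
  fixes A :: "('m::{t2_space, second_countable_topology}, 'e::euclidean_space) chart set"
    and g :: "'m \<Rightarrow> 'm tangent \<Rightarrow> 'm tangent \<Rightarrow> real"
    and \<mu> :: "'m \<Rightarrow> 'm tangent form"
    and nabla :: "'m vfield \<Rightarrow> 'm vfield \<Rightarrow> 'm vfield"
    and k :: nat and x :: 'm and e :: "'m tangent list" and I J :: "nat list"
  assumes "k \<ge> 1"
    and "compact (UNIV :: 'm set)"
    and "smooth_atlas A"
    and "DIM('e) = 4 * k"
    and "orientation_form A \<mu>"
    and "riemannian_metric A g"
    and "levi_civita A g nabla"
    and "distinct e" and "independent (set e)" and "span (set e) = tangent_space A x"
    and "length I = 2 * k + 1" and "set I \<subseteq> {..<4 * k}"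
    and "length J = 2 * k - 1" and "set J \<subseteq> {..<4 * k}"
  shows "(\<Sum>l = 1..2 * k + 1. (-1) ^ l *
           component e (star_riemann_pow A g \<mu> nabla k x)
             (take (l - 1) I @ drop l I) (I ! (l - 1) # J)) = 0"
proof -
  interpret riemannian_manifold A g nabla
    using assms by unfold_locales
  let ?V = "tangent_space A x" and ?R = "riemann_double_form A g nabla x"
  interpret T: inner_product_on ?V "g x" by (rule inner_product_on_tangent_space)
  have \<mu>: "\<mu> x \<in> alt_forms ?V (4 * k)" "\<exists>v. \<mu> x v \<noteq> 0"
    using assms(4,5) unfolding orientation_form_def by auto
  have "dim ?V \<ge> 4 * k"
  proof (rule ccontr)
    assume small: "\<not> dim ?V \<ge> 4 * k"
    obtain v where v: "\<mu> x v \<noteq> 0" using \<mu>(2) by blast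
    then have "length v = 4 * k" "set v \<subseteq> ?V" using alt_forms_outside[OF \<mu>(1)] by blast+
    then show False
      using v small \<mu>(1) T.alternating_eq_0_above_dim[OF finite_set assms(10), of "\<mu> x" v]
      unfolding alt_forms_iff[OF subspace_tangent_space] by auto
  qed
  then have dim: "dim ?V = 4 * k" using dim_tangent_space_le[of x] assms(4) by simp
  interpret T: oriented_inner_product_on ?V "g x" "\<mu> x"
    using \<mu> assms(10) by unfold_locales (auto simp: dim intro: finite_set)
  have "length e = dim (span (set e))"
    using assms(8,9) by (simp add: dim_span dim_eq_card_independent distinct_card)
  then have "length e = 4 * k" using dim assms(10) by simp
  then have e: "e ! i \<in> ?V" if "i < 4 * k" for i
    using that assms(10) span_superset[of "set e"] nth_mem[of i e] by auto
  let ?u = "map ((!) e) I" and ?w = "map ((!) e) J"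
  have "deletion_sum (\<lambda>y t. dhodge ?V (g x) (\<mu> x) (2 * k) (dpow 2 ?R k) t (y # ?w)) ?u = 0"
  proof (rule T.star_power_bianchi)
    show "?R [a, b] [c, d] + ?R [c, b] [d, a] + ?R [d, b] [a, c] = 0"
      "?R [a, b] [c, d] + ?R [a, c] [d, b] + ?R [a, d] [b, c] = 0"
      if "a \<in> ?V" "b \<in> ?V" "c \<in> ?V" "d \<in> ?V" for a b c d
      using riemann_bianchi[OF that] by (simp_all add: riemann_double_form_def)
    show "2 * k \<le> T.n" "length ?u = Suc (T.n - 2 * k)"
      using assms(11) by (simp_all add: T.n_def dim)
    show "set ?u \<subseteq> ?V" "set ?w \<subseteq> ?V"
      using assms(12,14) e by auto
  qed
  then have "(\<Sum>j<2 * k + 1. (-1) ^ j *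
      component e (star_riemann_pow A g \<mu> nabla k x) (take j I @ drop (Suc j) I) (I ! j # J)) = 0"
    using assms(11)
    by (simp add: deletion_sum_eq component_def star_riemann_pow_def take_map drop_map del: sum.lessThan_Suc)
  then show ?thesis
    by (simp add: sum.atLeast1_atMost_eq sum_negf del: sum.lessThan_Suc sum.cl_ivl_Suc)
qed

end
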